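(* Let $\Gamma$ be an ordered group, let $\Lambda\subseteq\Gamma$ be any subset, and let $FR$ be a $\Gamma$-filtered ring. (1) The categories $\operatorname{Preglid}_\Lambda FR$ and $\operatorname{Prefrag}_\Lambda FR$ are complete and cocomplete quasi-abelian categories. (2) The category $\operatorname{Glid}_\Lambda FR$ is a complete and cocomplete deflation quasi-abelian category.
   Context: Rings are unital. An ordered group $(\Gamma,\le)$ is a group with a (partial) order such that $\alpha\le\beta$ and $\gamma\le\delta$ imply $\alpha\gamma\le\beta\delta$; its unit is $e$. A $\Gamma$-filtered ring $FR$ is a ring $R$ with additive subgroups $\{F_\gamma R\}_{\gamma\in\Gamma}$ such that $1_R\in F_eR$, $F_\alpha R\subseteq F_\beta R$ if $\alpha\le\beta$, and $(F_\alpha R)(F_\beta R)\subseteq F_{\alpha\beta}R$. Let $\Lambda\subseteq\Gamma$. The preadditive category $\mathcal F_\Lambda R$ has object set $\Lambda$ and $\operatorname{Hom}(\alpha,\beta)=F_{\beta\alpha^{-1}}R$ if $\alpha\le\beta$, and $0$ otherwise; composition is multiplication in $R$. The preadditive category $\overline{\mathcal F}_\Lambda R$ has object set $\Lambda\sqcup\{\infty\}$, contains $\mathcal F_\Lambda R$ as a full subcategory, and has $\operatorname{Hom}(\alpha,\infty)=R$ for all $\alpha\in\Lambda\sqcup\{\infty\}$ and $\operatorname{Hom}(\infty,\alpha)=0$ for $\alpha\in\Lambda$; composition is multiplication in $R$. If $\alpha\le\beta$ or $\beta=\infty$, write $1_{\alpha,\beta}\in\operatorname{Hom}(\alpha,\beta)$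 for the element $1_R$. For a small preadditive category $\mathfrak a$, $\operatorname{Mod}\mathfrak a$ is the category of additive covariant functors from $\mathfrak a$ to abelian groups. $\operatorname{Prefrag}_\Lambda FR\subseteq\operatorname{Mod}\mathcal F_\Lambda R$ is the full subcategory of those $M$ such that $M(1_{\alpha,\beta})$ is a monomorphism for all $\alpha\le\beta$ in $\Lambda$. $\operatorname{Preglid}_\Lambda FR\subseteq\operatorname{Mod}\overline{\mathcal F}_\Lambda R$ is the full subcategory of those $M$ such that $M(1_{\alpha,\beta})$ is a monomorphism for all $\alpha,\beta\in\Lambda\sqcup\{\infty\}$ with $\alpha\le\beta$ or $\beta=\infty$. Let $\Sigma$ be the class of morphisms $f\colon M\to N$ in $\operatorname{Preglid}_\Lambda FR$ such that $f_\lambda$ is an isomorphism for all $\lambda\in\Lambda$ (no condition on $f_\infty$). Then $\operatorname{Glid}_\Lambda FR=(\operatorname{Preglid}_\Lambda FR)[\Sigma^{-1}]$. A category is pre-abelian if it is additive and has kernels and cokernels. A deflation quasi-abelian (or left quasi-abelian) category is a pre-abelian category in which cokernels (morphisms that are cokernels of some morphism) are stable under pullback; dually, an inflation quasi-abelian category is a pre-abelian category in which kernels are stable under pushout; quasi-abelian means both. *)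

theory Defs
  imports "HOL-Algebra.AbelCoset" "HOL-Library.Equipollence"
begin

section \<open>Smallness\<close>

text \<open>
  HOL has no type of all sets, so ``small'' is relative to a collection \<open>U\<close> of subsets of a
  fixed type: the underlying sets of all abelian groups are members of \<open>U\<close>, and objects and arrows
  of the index categories of limits are taken from the same type.  A Grothendieck universe is the
  special case in which \<open>U\<close> is moreover closed under power sets.  That axiom is omitted because HOL
  proves no instance of it together with an infinite member, whereas the collection of all subsets
  of any infinite type is a \<open>universe\<close> (see \<open>universe_UNIV\<close>).
\<close>

definition universe :: "'u set set \<Rightarrow> bool" where
  "universe U \<longleftrightarrow>
     (\<exists>A\<in>U. infinite A) \<and>
     (\<forall>A\<in>U. \<forall>B. B \<lesssim> A \<longrightarrow> B \<in> U) \<and>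
     (\<forall>A\<in>U. \<forall>X. (\<forall>a\<in>A. X a \<in> U) \<longrightarrow> (\<Union>a\<in>A. X a) \<in> U)"

definition small_set :: "'u set set \<Rightarrow> 'a set \<Rightarrow> bool" where
  "small_set U X \<longleftrightarrow> (\<exists>A\<in>U. X \<lesssim> A)"

text \<open>
  In a Grothendieck universe the index sets in the following sense are exactly the small sets, see
  \<open>index_set_iff_small\<close>.  Without closure under power sets a member of \<open>U\<close> need not be one: if
  \<open>U\<close> consists of all subsets of a type of cardinality \<open>\<kappa>\<close>, they are the sets \<open>I\<close> such that
  \<open>\<kappa>\<close> to the power \<open>|I|\<close> is \<open>\<kappa>\<close>.
\<close>

definition index_set :: "'u set set \<Rightarrow> 'i set \<Rightarrow> bool" where
  "index_set U I \<longleftrightarrow> (\<forall>X. (\<forall>i\<in>I. X i \<in> U) \<longrightarrow> small_set U (Pi\<^sub>E I X))"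

lemma universe_UNIV: "infinite (UNIV :: 'u set) \<Longrightarrow> universe (UNIV :: 'u set set)"
  unfolding universe_def by blast

lemma index_set_iff_small:
  fixes U :: "'u set set" and I :: "'i set"
  assumes U: "universe U" and Pow: "\<And>A. A \<in> U \<Longrightarrow> small_set U (Pow A)"
  shows "index_set U I \<longleftrightarrow> small_set U I"
proof
  obtain A where A: "A \<in> U" "infinite A"
    using U unfolding universe_def by blast
  have sub: "B \<in> U" if "B \<lesssim> C" "C \<in> U" for B C
    using U that unfolding universe_def by blast
  have UN: "(\<Union>c\<in>C. X c) \<in> U" if "C \<in> U" "\<And>c. c \<in> C \<Longrightarrow> X c \<in> U" for C and X :: "'u \<Rightarrow> 'u set"
    using U that unfolding universe_def by blast
  obtain a where a: "a \<in> A" using A(2) by fastforce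
  obtain b where b: "b \<in> A" "b \<noteq> a"
    using A(2) by (metis finite.emptyI finite_insert finite_subset insertI1 subsetI)
  have ab: "{a, b} \<in> U"
    using a b by (intro sub[OF subset_imp_lepoll A(1)]) auto
  {
    assume "index_set U I"
    then have "small_set U (I \<rightarrow>\<^sub>E {a, b})"
      using ab unfolding index_set_def by (auto dest: spec[of _ "\<lambda>_. {a, b}"])
    moreover have "I \<lesssim> I \<rightarrow>\<^sub>E {a, b}"
      unfolding lepoll_def
    proof (intro exI conjI)
      show "inj_on (\<lambda>i. \<lambda>j\<in>I. if i = j then a else b) I"
      proof (rule inj_onI)
        fix i j assume "i \<in> I" "j \<in> I"
          and eq: "(\<lambda>k\<in>I. if i = k then a else b) = (\<lambda>k\<in>I. if j = k then a else b)"
        from fun_cong[OF eq, of i] show "i = j"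
          using \<open>i \<in> I\<close> b by (simp split: if_splits)
      qed
    qed auto
    ultimately show "small_set U I"
      unfolding small_set_def by (meson lepoll_trans)
  next
    assume "small_set U I"
    then obtain J where J: "J \<in> U" "I \<lesssim> J"
      unfolding small_set_def by blast
    show "index_set U I"
      unfolding index_set_def
    proof (intro allI impI)
      fix X :: "'i \<Rightarrow> 'u set" assume X: "\<forall>i\<in>I. X i \<in> U"
      obtain g where g: "inj_on g I" "g ` I \<subseteq> J"
        using J(2) unfolding lepoll_def by blast
      define Y where "Y = (\<Union>i\<in>I. X i)"
      have "(\<Union>j\<in>g ` I. X (inv_into I g j)) \<in> U"
      proof (rule UN)
        show "g ` I \<in> U" using g J(1) by (meson sub subset_imp_lepoll)
      qed (use X in \<open>auto simp: inv_into_into\<close>)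
      also have "(\<Union>j\<in>g ` I. X (inv_into I g j)) = Y"
        unfolding Y_def using g(1) by auto
      finally have Y: "Y \<in> U" .
      have Un: "S \<union> T \<in> U" if "S \<in> U" "T \<in> U" for S T
        using UN[OF ab, of "\<lambda>c. if c = a then S else T"] that b by (auto simp: Un_commute)
      define Z where "Z = J \<union> Y \<union> A"
      have Z: "Z \<in> U" "infinite Z"
        unfolding Z_def using Un J(1) Y A by auto
      have ZZ: "Z \<times> Z \<lesssim> Z"
        using card_of_Times_same_infinite[OF Z(2)]
        by (metis card_of_ordLeq lepoll_def ordIso_iff_ordLeq)
      have "Pi\<^sub>E I X \<lesssim> Pow (I \<times> Y)"
        unfolding lepoll_def
      proof (intro exI conjI)
        show "inj_on (\<lambda>f. (\<lambda>i. (i, f i)) ` I) (Pi\<^sub>E I X)"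
          by (rule inj_onI, rule PiE_ext) auto
        show "(\<lambda>f. (\<lambda>i. (i, f i)) ` I) ` Pi\<^sub>E I X \<subseteq> Pow (I \<times> Y)"
          unfolding Y_def by (auto simp: PiE_def Pi_def)
      qed
      also have "Pow (I \<times> Y) \<lesssim> Pow Z"
      proof -
        have "I \<times> Y \<lesssim> Z \<times> Z"
          using J(2) unfolding Z_def
          by (intro times_lepoll_mono) (auto intro: lepoll_trans subset_imp_lepoll)
        then have "I \<times> Y \<lesssim> Z" using ZZ lepoll_trans by blast
        then obtain h where "inj_on h (I \<times> Y)" "h ` (I \<times> Y) \<subseteq> Z"
          unfolding lepoll_def by blast
        then show ?thesis
          unfolding lepoll_def by (intro exI[of _ "image h"]) (auto simp: inj_on_image_Pow)
      qed
      finally show "small_set U (Pi\<^sub>E I X)"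
        using Pow[OF Z(1)] unfolding small_set_def by (meson lepoll_trans)
    qed
  }
qed


section \<open>Categories\<close>

text \<open>
  Hom sets are indexed by pairs of objects and need not be disjoint, so composition takes the three
  objects as arguments: for \<open>f\<close> from \<open>x\<close> to \<open>y\<close> and \<open>g\<close> from \<open>y\<close> to \<open>z\<close>, \<open>Comp C x y z g f\<close> is
  \<open>g\<close> after \<open>f\<close>.
\<close>

record ('o, 'm) cat =
  Obj :: "'o set"
  Hom :: "'o \<Rightarrow> 'o \<Rightarrow> 'm set"
  Ident :: "'o \<Rightarrow> 'm"
  Comp :: "'o \<Rightarrow> 'o \<Rightarrow> 'o \<Rightarrow> 'm \<Rightarrow> 'm \<Rightarrow> 'm"

locale category =
  fixes C :: "('o, 'm, 'z) cat_scheme"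
  assumes Ident_in_Hom: "x \<in> Obj C \<Longrightarrow> Ident C x \<in> Hom C x x"
    and Comp_in_Hom: "\<lbrakk>x \<in> Obj C; y \<in> Obj C; z \<in> Obj C; f \<in> Hom C x y; g \<in> Hom C y z\<rbrakk>
      \<Longrightarrow> Comp C x y z g f \<in> Hom C x z"
    and Comp_Ident: "\<lbrakk>x \<in> Obj C; y \<in> Obj C; f \<in> Hom C x y\<rbrakk> \<Longrightarrow> Comp C x x y f (Ident C x) = f"
    and Ident_Comp: "\<lbrakk>x \<in> Obj C; y \<in> Obj C; f \<in> Hom C x y\<rbrakk> \<Longrightarrow> Comp C x y y (Ident C y) f = f"
    and Comp_assoc: "\<lbrakk>w \<in> Obj C; x \<in> Obj C; y \<in> Obj C; z \<in> Obj C;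
        f \<in> Hom C w x; g \<in> Hom C x y; h \<in> Hom C y z\<rbrakk>
      \<Longrightarrow> Comp C w x z (Comp C x y z h g) f = Comp C w y z h (Comp C w x y g f)"

definition dual :: "('o, 'm) cat \<Rightarrow> ('o, 'm) cat" where
  "dual C = \<lparr>Obj = Obj C, Hom = (\<lambda>x y. Hom C y x), Ident = Ident C,
     Comp = (\<lambda>x y z g f. Comp C z y x f g)\<rparr>"

definition full_subcategory :: "('o, 'm) cat \<Rightarrow> ('o \<Rightarrow> bool) \<Rightarrow> ('o, 'm) cat" where
  "full_subcategory C P = C\<lparr>Obj := {x \<in> Obj C. P x}\<rparr>"

text \<open>
  The values of a functor off the objects and hom sets of its source are unconstrained; functors
  that differ only there are distinct but isomorphic objects of a functor category.
\<close>

record ('o, 'm, 'p, 'n) func =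
  on_obj :: "'o \<Rightarrow> 'p"
  on_hom :: "'o \<Rightarrow> 'o \<Rightarrow> 'm \<Rightarrow> 'n"

definition is_functor ::
  "('o, 'm, 'z) cat_scheme \<Rightarrow> ('p, 'n, 'w) cat_scheme \<Rightarrow> ('o, 'm, 'p, 'n) func \<Rightarrow> bool" where
  "is_functor C D F \<longleftrightarrow>
     (\<forall>x\<in>Obj C. on_obj F x \<in> Obj D) \<and>
     (\<forall>x\<in>Obj C. \<forall>y\<in>Obj C. \<forall>f\<in>Hom C x y. on_hom F x y f \<in> Hom D (on_obj F x) (on_obj F y)) \<and>
     (\<forall>x\<in>Obj C. on_hom F x x (Ident C x) = Ident D (on_obj F x)) \<and>
     (\<forall>x\<in>Obj C. \<forall>y\<in>Obj C. \<forall>z\<in>Obj C. \<forall>f\<in>Hom C x y. \<forall>g\<in>Hom C y z.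
        on_hom F x z (Comp C x y z g f) =
        Comp D (on_obj F x) (on_obj F y) (on_obj F z) (on_hom F y z g) (on_hom F x y f))"


subsection \<open>Limits\<close>

definition is_cone ::
  "('i, 'j) cat \<Rightarrow> ('o, 'm) cat \<Rightarrow> ('i, 'j, 'o, 'm) func \<Rightarrow> 'o \<Rightarrow> ('i \<Rightarrow> 'm) \<Rightarrow> bool" where
  "is_cone J C D x c \<longleftrightarrow>
     x \<in> Obj C \<and>
     (\<forall>i\<in>Obj J. c i \<in> Hom C x (on_obj D i)) \<and>
     (\<forall>i\<in>Obj J. \<forall>j\<in>Obj J. \<forall>a\<in>Hom J i j.
        Comp C x (on_obj D i) (on_obj D j) (on_hom D i j a) (c i) = c j)"

definition is_limit ::
  "('i, 'j) cat \<Rightarrow> ('o, 'm) cat \<Rightarrow> ('i, 'j, 'o, 'm) func \<Rightarrow> 'o \<Rightarrow> ('i \<Rightarrow> 'm) \<Rightarrow> bool" where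
  "is_limit J C D x c \<longleftrightarrow>
     is_cone J C D x c \<and>
     (\<forall>y d. is_cone J C D y d \<longrightarrow>
        (\<exists>!u. u \<in> Hom C y x \<and> (\<forall>i\<in>Obj J. Comp C y x (on_obj D i) (c i) u = d i)))"

definition small_index_category :: "'u set set \<Rightarrow> ('u, 'u) cat \<Rightarrow> bool" where
  "small_index_category U J \<longleftrightarrow>
     category J \<and> index_set U (Obj J) \<and> (\<forall>i\<in>Obj J. \<forall>j\<in>Obj J. index_set U (Hom J i j))"

definition complete_category :: "'u set set \<Rightarrow> ('o, 'm) cat \<Rightarrow> bool" where
  "complete_category U C \<longleftrightarrow>
     (\<forall>J D. small_index_category U J \<and> is_functor J C D \<longrightarrow> (\<exists>x c. is_limit J C D x c))"

definition cocomplete_category :: "'u set set \<Rightarrow> ('o, 'm) cat \<Rightarrow> bool" where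
  "cocomplete_category U C \<longleftrightarrow> complete_category U (dual C)"


subsection \<open>Quasi-abelian categories\<close>

definition zero_object :: "('o, 'm) cat \<Rightarrow> 'o \<Rightarrow> bool" where
  "zero_object C z \<longleftrightarrow>
     z \<in> Obj C \<and> (\<forall>x\<in>Obj C. (\<exists>!f. f \<in> Hom C x z) \<and> (\<exists>!f. f \<in> Hom C z x))"

definition zero_morphism :: "('o, 'm) cat \<Rightarrow> 'o \<Rightarrow> 'o \<Rightarrow> 'm \<Rightarrow> bool" where
  "zero_morphism C x y f \<longleftrightarrow>
     (\<exists>z g h. zero_object C z \<and> g \<in> Hom C x z \<and> h \<in> Hom C z y \<and> f = Comp C x z y h g)"

definition is_product :: "('o, 'm) cat \<Rightarrow> 'o \<Rightarrow> 'o \<Rightarrow> 'o \<Rightarrow> 'm \<Rightarrow> 'm \<Rightarrow> bool" where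
  "is_product C x y p p1 p2 \<longleftrightarrow>
     p \<in> Obj C \<and> p1 \<in> Hom C p x \<and> p2 \<in> Hom C p y \<and>
     (\<forall>w\<in>Obj C. \<forall>q1\<in>Hom C w x. \<forall>q2\<in>Hom C w y.
        \<exists>!u. u \<in> Hom C w p \<and> Comp C w p x p1 u = q1 \<and> Comp C w p y p2 u = q2)"

definition is_pullback ::
  "('o, 'm) cat \<Rightarrow> 'o \<Rightarrow> 'o \<Rightarrow> 'o \<Rightarrow> 'm \<Rightarrow> 'm \<Rightarrow> 'o \<Rightarrow> 'm \<Rightarrow> 'm \<Rightarrow> bool" where
  "is_pullback C x y z f g p p1 p2 \<longleftrightarrow>
     p \<in> Obj C \<and> p1 \<in> Hom C p x \<and> p2 \<in> Hom C p y \<and> Comp C p x z f p1 = Comp C p y z g p2 \<and>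
     (\<forall>w\<in>Obj C. \<forall>q1\<in>Hom C w x. \<forall>q2\<in>Hom C w y.
        Comp C w x z f q1 = Comp C w y z g q2 \<longrightarrow>
        (\<exists>!u. u \<in> Hom C w p \<and> Comp C w p x p1 u = q1 \<and> Comp C w p y p2 u = q2))"

definition is_kernel :: "('o, 'm) cat \<Rightarrow> 'o \<Rightarrow> 'o \<Rightarrow> 'm \<Rightarrow> 'o \<Rightarrow> 'm \<Rightarrow> bool" where
  "is_kernel C x y f k i \<longleftrightarrow>
     k \<in> Obj C \<and> i \<in> Hom C k x \<and> zero_morphism C k y (Comp C k x y f i) \<and>
     (\<forall>w\<in>Obj C. \<forall>h\<in>Hom C w x. zero_morphism C w y (Comp C w x y f h) \<longrightarrow>
        (\<exists>!u. u \<in> Hom C w k \<and> Comp C w k x i u = h))"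

definition is_cokernel :: "('o, 'm) cat \<Rightarrow> 'o \<Rightarrow> 'o \<Rightarrow> 'm \<Rightarrow> 'o \<Rightarrow> 'm \<Rightarrow> bool" where
  "is_cokernel C x y f c q \<longleftrightarrow> is_kernel (dual C) y x f c q"

record ('o, 'm) preadd = "('o, 'm) cat" +
  Plus :: "'o \<Rightarrow> 'o \<Rightarrow> 'm \<Rightarrow> 'm \<Rightarrow> 'm"
  Zero :: "'o \<Rightarrow> 'o \<Rightarrow> 'm"

definition hom_group :: "('o, 'm, 'z) preadd_scheme \<Rightarrow> 'o \<Rightarrow> 'o \<Rightarrow> 'm monoid" where
  "hom_group A x y = \<lparr>carrier = Hom A x y, mult = Plus A x y, one = Zero A x y\<rparr>"

locale preadditive = category A for A :: "('o, 'm, 'z) preadd_scheme" +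
  assumes comm_group_Hom: "\<lbrakk>x \<in> Obj A; y \<in> Obj A\<rbrakk> \<Longrightarrow> comm_group (hom_group A x y)"
    and Comp_hom_right: "\<lbrakk>x \<in> Obj A; y \<in> Obj A; z \<in> Obj A; g \<in> Hom A y z\<rbrakk>
      \<Longrightarrow> (\<lambda>f. Comp A x y z g f) \<in> hom (hom_group A x y) (hom_group A x z)"
    and Comp_hom_left: "\<lbrakk>x \<in> Obj A; y \<in> Obj A; z \<in> Obj A; f \<in> Hom A x y\<rbrakk>
      \<Longrightarrow> (\<lambda>g. Comp A x y z g f) \<in> hom (hom_group A y z) (hom_group A x z)"

definition additive_category :: "('o, 'm) cat \<Rightarrow> bool" where
  "additive_category C \<longleftrightarrow>
     (\<exists>A :: ('o, 'm) preadd. preadditive A \<and> cat.truncate A = C) \<and>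
     (\<exists>z. zero_object C z) \<and>
     (\<forall>x\<in>Obj C. \<forall>y\<in>Obj C. \<exists>p p1 p2. is_product C x y p p1 p2)"

definition pre_abelian :: "('o, 'm) cat \<Rightarrow> bool" where
  "pre_abelian C \<longleftrightarrow>
     additive_category C \<and>
     (\<forall>x\<in>Obj C. \<forall>y\<in>Obj C. \<forall>f\<in>Hom C x y.
        (\<exists>k i. is_kernel C x y f k i) \<and> (\<exists>c q. is_cokernel C x y f c q))"

definition cokernels_stable_under_pullback :: "('o, 'm) cat \<Rightarrow> bool" where
  "cokernels_stable_under_pullback C \<longleftrightarrow>
     (\<forall>x\<in>Obj C. \<forall>y\<in>Obj C. \<forall>z\<in>Obj C. \<forall>f\<in>Hom C x z. \<forall>g\<in>Hom C y z. \<forall>p p1 p2.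
        (\<exists>w\<in>Obj C. \<exists>h\<in>Hom C w x. is_cokernel C w x h z f) \<and> is_pullback C x y z f g p p1 p2 \<longrightarrow>
        (\<exists>w\<in>Obj C. \<exists>h\<in>Hom C w p. is_cokernel C w p h y p2))"

definition kernels_stable_under_pushout :: "('o, 'm) cat \<Rightarrow> bool" where
  "kernels_stable_under_pushout C \<longleftrightarrow> cokernels_stable_under_pullback (dual C)"

definition deflation_quasi_abelian :: "('o, 'm) cat \<Rightarrow> bool" where
  "deflation_quasi_abelian C \<longleftrightarrow> pre_abelian C \<and> cokernels_stable_under_pullback C"

definition inflation_quasi_abelian :: "('o, 'm) cat \<Rightarrow> bool" where
  "inflation_quasi_abelian C \<longleftrightarrow> pre_abelian C \<and> kernels_stable_under_pushout C"

definition quasi_abelian :: "('o, 'm) cat \<Rightarrow> bool" where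
  "quasi_abelian C \<longleftrightarrow> deflation_quasi_abelian C \<and> inflation_quasi_abelian C"


subsection \<open>Localization\<close>

text \<open>
  The category of fractions in the sense of Gabriel and Zisman: arrows are classes of zigzags,
  listed in the order in which they are traversed.  \<open>Bwd x y s\<close> is the formal inverse, from \<open>y\<close>
  to \<open>x\<close>, of the arrow \<open>s\<close> from \<open>x\<close> to \<open>y\<close>.
\<close>

datatype ('o, 'm) step = Fwd 'o 'o 'm | Bwd 'o 'o 'm

fun zigzag ::
  "('o, 'm) cat \<Rightarrow> ('o \<Rightarrow> 'o \<Rightarrow> 'm set) \<Rightarrow> 'o \<Rightarrow> 'o \<Rightarrow> ('o, 'm) step list \<Rightarrow> bool" where
  "zigzag C S v w [] \<longleftrightarrow> v = w \<and> v \<in> Obj C"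
| "zigzag C S v w (Fwd x y f # p) \<longleftrightarrow>
     v = x \<and> x \<in> Obj C \<and> y \<in> Obj C \<and> f \<in> Hom C x y \<and> zigzag C S y w p"
| "zigzag C S v w (Bwd x y s # p) \<longleftrightarrow>
     v = y \<and> x \<in> Obj C \<and> y \<in> Obj C \<and> s \<in> S x y \<and> zigzag C S x w p"

inductive zigzag_eq ::
  "('o, 'm) cat \<Rightarrow> ('o \<Rightarrow> 'o \<Rightarrow> 'm set) \<Rightarrow>
   'o \<Rightarrow> 'o \<Rightarrow> ('o, 'm) step list \<Rightarrow> ('o, 'm) step list \<Rightarrow> bool"
  for C S where
  Ident: "x \<in> Obj C \<Longrightarrow> zigzag_eq C S x x [Fwd x x (Ident C x)] []"
| Comp: "\<lbrakk>x \<in> Obj C; y \<in> Obj C; z \<in> Obj C; f \<in> Hom C x y; g \<in> Hom C y z\<rbrakk>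
    \<Longrightarrow> zigzag_eq C S x z [Fwd x y f, Fwd y z g] [Fwd x z (Comp C x y z g f)]"
| Fwd_Bwd: "\<lbrakk>x \<in> Obj C; y \<in> Obj C; s \<in> S x y\<rbrakk> \<Longrightarrow> zigzag_eq C S x x [Fwd x y s, Bwd x y s] []"
| Bwd_Fwd: "\<lbrakk>x \<in> Obj C; y \<in> Obj C; s \<in> S x y\<rbrakk> \<Longrightarrow> zigzag_eq C S y y [Bwd x y s, Fwd x y s] []"
| refl: "zigzag C S x y p \<Longrightarrow> zigzag_eq C S x y p p"
| sym: "zigzag_eq C S x y p q \<Longrightarrow> zigzag_eq C S x y q p"
| trans: "\<lbrakk>zigzag_eq C S x y p q; zigzag_eq C S x y q r\<rbrakk> \<Longrightarrow> zigzag_eq C S x y p r"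
| append: "\<lbrakk>zigzag_eq C S x y p p'; zigzag_eq C S y z q q'\<rbrakk>
    \<Longrightarrow> zigzag_eq C S x z (p @ q) (p' @ q')"

definition localization ::
  "('o, 'm) cat \<Rightarrow> ('o \<Rightarrow> 'o \<Rightarrow> 'm set) \<Rightarrow> ('o, ('o, 'm) step list set) cat" where
  "localization C S =
     \<lparr>Obj = Obj C,
      Hom = (\<lambda>x y. {{q. zigzag_eq C S x y p q} | p. zigzag C S x y p}),
      Ident = (\<lambda>x. {q. zigzag_eq C S x x [] q}),
      Comp = (\<lambda>x y z Q P. {r. \<exists>p\<in>P. \<exists>q\<in>Q. zigzag_eq C S x z (p @ q) r})\<rparr>"


section \<open>Modules over preadditive categories\<close>

text \<open>
  Abelian groups are written multiplicatively, as in \<open>HOL-Algebra\<close>.  Homomorphisms and natural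
  transformations are extensional, so that equality of arrows is equality of functions.
\<close>

definition Ab :: "'u set set \<Rightarrow> ('u monoid, 'u \<Rightarrow> 'u) preadd" where
  "Ab U =
     \<lparr>Obj = {G. comm_group G \<and> carrier G \<in> U},
      Hom = (\<lambda>G H. hom G H \<inter> extensional (carrier G)),
      Ident = (\<lambda>G. \<lambda>a\<in>carrier G. a),
      Comp = (\<lambda>G H K g f. compose (carrier G) g f),
      Plus = (\<lambda>G H f g. \<lambda>a\<in>carrier G. f a \<otimes>\<^bsub>H\<^esub> g a),
      Zero = (\<lambda>G H. \<lambda>a\<in>carrier G. \<one>\<^bsub>H\<^esub>)\<rparr>"

definition additive_functor ::
  "('o, 'm, 'z) preadd_scheme \<Rightarrow> ('p, 'n, 'w) preadd_scheme \<Rightarrow> ('o, 'm, 'p, 'n) func \<Rightarrow> bool" where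
  "additive_functor A B F \<longleftrightarrow>
     is_functor A B F \<and>
     (\<forall>x\<in>Obj A. \<forall>y\<in>Obj A.
        on_hom F x y \<in> hom (hom_group A x y) (hom_group B (on_obj F x) (on_obj F y)))"

definition natural_transformation ::
  "('o, 'm, 'z) cat_scheme \<Rightarrow> ('p, 'n, 'w) cat_scheme \<Rightarrow> ('o, 'm, 'p, 'n) func \<Rightarrow>
   ('o, 'm, 'p, 'n) func \<Rightarrow> ('o \<Rightarrow> 'n) \<Rightarrow> bool" where
  "natural_transformation C D F G t \<longleftrightarrow>
     t \<in> extensional (Obj C) \<and>
     (\<forall>x\<in>Obj C. t x \<in> Hom D (on_obj F x) (on_obj G x)) \<and>
     (\<forall>x\<in>Obj C. \<forall>y\<in>Obj C. \<forall>f\<in>Hom C x y.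
        Comp D (on_obj F x) (on_obj F y) (on_obj G y) (t y) (on_hom F x y f) =
        Comp D (on_obj F x) (on_obj G x) (on_obj G y) (on_hom G x y f) (t x))"

type_synonym ('o, 'm, 'u) amod = "('o, 'm, 'u monoid, 'u \<Rightarrow> 'u) func"

definition Mod_category :: "'u set set \<Rightarrow> ('o, 'm) preadd \<Rightarrow> (('o, 'm, 'u) amod, 'o \<Rightarrow> 'u \<Rightarrow> 'u) cat" where
  "Mod_category U A =
     \<lparr>Obj = {M. additive_functor A (Ab U) M},
      Hom = (\<lambda>M N. {t. natural_transformation A (Ab U) M N t}),
      Ident = (\<lambda>M. \<lambda>x\<in>Obj A. Ident (Ab U) (on_obj M x)),
      Comp = (\<lambda>L M N t s. \<lambda>x\<in>Obj A.
        Comp (Ab U) (on_obj L x) (on_obj M x) (on_obj N x) (t x) (s x))\<rparr>"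


section \<open>Filtered rings, prefragments and gliders\<close>

locale ordered_group = group \<Gamma> for \<Gamma> :: "('g, 'c) monoid_scheme" (structure) +
  fixes leq :: "'g rel"
  assumes partial_order: "partial_order_on (carrier \<Gamma>) leq"
    and mult_mono: "\<lbrakk>(\<alpha>, \<beta>) \<in> leq; (\<gamma>, \<delta>) \<in> leq\<rbrakk> \<Longrightarrow> (\<alpha> \<otimes> \<gamma>, \<beta> \<otimes> \<delta>) \<in> leq"

locale filtered_ring = ordered_group \<Gamma> leq + R: ring R
  for \<Gamma> :: "('g, 'c) monoid_scheme" and leq :: "'g rel" and R :: "('r, 'd) ring_scheme" +
  fixes F :: "'g \<Rightarrow> 'r set"
  assumes additive_subgroup: "\<gamma> \<in> carrier \<Gamma> \<Longrightarrow> additive_subgroup (F \<gamma>) R"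
    and one_in: "\<one>\<^bsub>R\<^esub> \<in> F \<one>\<^bsub>\<Gamma>\<^esub>"
    and mono: "(\<alpha>, \<beta>) \<in> leq \<Longrightarrow> F \<alpha> \<subseteq> F \<beta>"
    and mult_in: "\<lbrakk>\<alpha> \<in> carrier \<Gamma>; \<beta> \<in> carrier \<Gamma>; a \<in> F \<alpha>; b \<in> F \<beta>\<rbrakk>
      \<Longrightarrow> a \<otimes>\<^bsub>R\<^esub> b \<in> F (\<alpha> \<otimes>\<^bsub>\<Gamma>\<^esub> \<beta>)"

definition filtration_category ::
  "('g, 'c) monoid_scheme \<Rightarrow> 'g rel \<Rightarrow> ('r, 'd) ring_scheme \<Rightarrow> ('g \<Rightarrow> 'r set) \<Rightarrow> 'g set \<Rightarrow>
   ('g, 'r) preadd" where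
  "filtration_category \<Gamma> leq R F \<Lambda> =
     \<lparr>Obj = \<Lambda>,
      Hom = (\<lambda>\<alpha> \<beta>. if (\<alpha>, \<beta>) \<in> leq then F (\<beta> \<otimes>\<^bsub>\<Gamma>\<^esub> inv\<^bsub>\<Gamma>\<^esub> \<alpha>) else {\<zero>\<^bsub>R\<^esub>}),
      Ident = (\<lambda>_. \<one>\<^bsub>R\<^esub>),
      Comp = (\<lambda>_ _ _ b a. b \<otimes>\<^bsub>R\<^esub> a),
      Plus = (\<lambda>_ _ a b. a \<oplus>\<^bsub>R\<^esub> b),
      Zero = (\<lambda>_ _. \<zero>\<^bsub>R\<^esub>)\<rparr>"

text \<open>The object \<open>\<infinity>\<close> is \<open>None\<close>.\<close>

definition filtration_category_inf ::
  "('g, 'c) monoid_scheme \<Rightarrow> 'g rel \<Rightarrow> ('r, 'd) ring_scheme \<Rightarrow> ('g \<Rightarrow> 'r set) \<Rightarrow> 'g set \<Rightarrow>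
   ('g option, 'r) preadd" where
  "filtration_category_inf \<Gamma> leq R F \<Lambda> =
     \<lparr>Obj = insert None (Some ` \<Lambda>),
      Hom = (\<lambda>x y. case (x, y) of
          (Some \<alpha>, Some \<beta>) \<Rightarrow> Hom (filtration_category \<Gamma> leq R F \<Lambda>) \<alpha> \<beta>
        | (None, Some _) \<Rightarrow> {\<zero>\<^bsub>R\<^esub>}
        | (_, None) \<Rightarrow> carrier R),
      Ident = (\<lambda>_. \<one>\<^bsub>R\<^esub>),
      Comp = (\<lambda>_ _ _ b a. b \<otimes>\<^bsub>R\<^esub> a),
      Plus = (\<lambda>_ _ a b. a \<oplus>\<^bsub>R\<^esub> b),
      Zero = (\<lambda>_ _. \<zero>\<^bsub>R\<^esub>)\<rparr>"

definition Prefrag ::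
  "'u set set \<Rightarrow> ('g, 'c) monoid_scheme \<Rightarrow> 'g rel \<Rightarrow> ('r, 'd) ring_scheme \<Rightarrow> ('g \<Rightarrow> 'r set) \<Rightarrow>
   'g set \<Rightarrow> (('g, 'r, 'u) amod, 'g \<Rightarrow> 'u \<Rightarrow> 'u) cat" where
  "Prefrag U \<Gamma> leq R F \<Lambda> =
     full_subcategory (Mod_category U (filtration_category \<Gamma> leq R F \<Lambda>))
       (\<lambda>M. \<forall>\<alpha>\<in>\<Lambda>. \<forall>\<beta>\<in>\<Lambda>. (\<alpha>, \<beta>) \<in> leq \<longrightarrow> on_hom M \<alpha> \<beta> \<one>\<^bsub>R\<^esub> \<in> mon (on_obj M \<alpha>) (on_obj M \<beta>))"

definition leq_inf :: "'g rel \<Rightarrow> 'g option \<Rightarrow> 'g option \<Rightarrow> bool" where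
  "leq_inf leq x y \<longleftrightarrow> y = None \<or> (\<exists>\<alpha> \<beta>. x = Some \<alpha> \<and> y = Some \<beta> \<and> (\<alpha>, \<beta>) \<in> leq)"

definition Preglid ::
  "'u set set \<Rightarrow> ('g, 'c) monoid_scheme \<Rightarrow> 'g rel \<Rightarrow> ('r, 'd) ring_scheme \<Rightarrow> ('g \<Rightarrow> 'r set) \<Rightarrow>
   'g set \<Rightarrow> (('g option, 'r, 'u) amod, 'g option \<Rightarrow> 'u \<Rightarrow> 'u) cat" where
  "Preglid U \<Gamma> leq R F \<Lambda> =
     full_subcategory (Mod_category U (filtration_category_inf \<Gamma> leq R F \<Lambda>))
       (\<lambda>M. \<forall>x\<in>insert None (Some ` \<Lambda>). \<forall>y\<in>insert None (Some ` \<Lambda>).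
          leq_inf leq x y \<longrightarrow> on_hom M x y \<one>\<^bsub>R\<^esub> \<in> mon (on_obj M x) (on_obj M y))"

definition glid_weak_equivalences ::
  "'u set set \<Rightarrow> ('g, 'c) monoid_scheme \<Rightarrow> 'g rel \<Rightarrow> ('r, 'd) ring_scheme \<Rightarrow> ('g \<Rightarrow> 'r set) \<Rightarrow>
   'g set \<Rightarrow> ('g option, 'r, 'u) amod \<Rightarrow> ('g option, 'r, 'u) amod \<Rightarrow>
   ('g option \<Rightarrow> 'u \<Rightarrow> 'u) set" where
  "glid_weak_equivalences U \<Gamma> leq R F \<Lambda> M N =
     {f \<in> Hom (Preglid U \<Gamma> leq R F \<Lambda>) M N.
        \<forall>\<alpha>\<in>\<Lambda>. f (Some \<alpha>) \<in> iso (on_obj M (Some \<alpha>)) (on_obj N (Some \<alpha>))}"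

definition Glid ::
  "'u set set \<Rightarrow> ('g, 'c) monoid_scheme \<Rightarrow> 'g rel \<Rightarrow> ('r, 'd) ring_scheme \<Rightarrow> ('g \<Rightarrow> 'r set) \<Rightarrow>
   'g set \<Rightarrow> (('g option, 'r, 'u) amod,
     (('g option, 'r, 'u) amod, 'g option \<Rightarrow> 'u \<Rightarrow> 'u) step list set) cat" where
  "Glid U \<Gamma> leq R F \<Lambda> =
     localization (Preglid U \<Gamma> leq R F \<Lambda>) (glid_weak_equivalences U \<Gamma> leq R F \<Lambda>)"

end

theory Submission
  imports Defs "HOL-Algebra.Product_Groups"
begin

text \<open>
  A full subcategory of a module category that contains every module with enough maps into it is
  complete and cocomplete.  In it the cokernels are the pointwise surjective maps, and these are
  stable under pullback.  Pregliders and prefragments are the modules on which certain arrows act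
  injectively; a map between them is a kernel if and only if it is injective with cokernel, taken
  among all modules, of the same kind, and such maps are stable under pushout since injectivity of
  an arrow passes to extensions.

  Restriction to \<open>\<Lambda>\<close> inverts \<open>\<Sigma>\<close> and identifies the category of gliders with the full
  subcategory of those \<open>\<F>\<^sub>\<Lambda>R\<close>-modules that extend to a preglider.  Fullness: a map \<open>t\<close> from
  \<open>M|\<^sub>\<Lambda>\<close> to \<open>N|\<^sub>\<Lambda>\<close> comes from the fraction \<open>M \<leftarrow> L \<rightarrow> N\<close>, where \<open>L\<close> is \<open>M\<close> on \<open>\<Lambda>\<close> and
  \<open>M(\<infinity>) \<times> N(\<infinity>)\<close> at \<open>\<infinity>\<close>, with \<open>M(\<lambda>)\<close> embedded as the graph of \<open>t\<close>.  Faithfulness: maps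
  that agree on \<open>\<Lambda>\<close> are equalized by an inclusion in \<open>\<Sigma>\<close>.  The extendable modules again
  contain every module with enough maps into them, but need not be closed under extensions.
\<close>

section \<open>Small sets\<close>

text \<open>Size shapes the constructions. \<open>universe\<close> has no power set axiom, so the
  product over all cocones of a diagram, or over all maps from a module into a class, may be too
  large to lie in \<open>U\<close>. Limits, colimits, pullbacks and the preglider extending a given
  module are therefore obtained in one way: form the product as a module relative to
  \<open>UNIV\<close>, on a type of functions, cut out a submodule that is small, and copy it back
  to \<open>'u\<close>. What is retained are its jointly injective projections, and the closure
  condition on the class is stated for exactly such data.

  Kernels, cokernels and products of two objects are special limits and colimits, so being
  pre-abelian reduces to completeness and cocompleteness, for the localization as well. A pullback
  or pushout is given only by its universal property; it is compared with a concrete model by a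
  single map, which already yields the surjectivity or injectivity in question.\<close>

lemma small_lepoll: "small_set U Y \<Longrightarrow> X \<lesssim> Y \<Longrightarrow> small_set U X"
  unfolding small_set_def by (meson lepoll_trans)

lemma small_subset: "small_set U Y \<Longrightarrow> X \<subseteq> Y \<Longrightarrow> small_set U X"
  by (meson small_lepoll subset_imp_lepoll)

lemma small_image: "small_set U X \<Longrightarrow> small_set U (f ` X)"
  by (meson small_lepoll image_lepoll)

lemma small_member: "A \<in> U \<Longrightarrow> small_set U A"
  unfolding small_set_def by blast

context
  fixes U :: "'u set set"
  assumes U: "universe U"
begin

lemma universe_lepoll: "A \<in> U \<Longrightarrow> B \<lesssim> A \<Longrightarrow> B \<in> U"
  using U unfolding universe_def by blast

lemma universe_subset: "A \<in> U \<Longrightarrow> B \<subseteq> A \<Longrightarrow> B \<in> U"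
  by (meson universe_lepoll subset_imp_lepoll)

lemma universe_UN: "A \<in> U \<Longrightarrow> (\<And>a. a \<in> A \<Longrightarrow> X a \<in> U) \<Longrightarrow> (\<Union>a\<in>A. X a) \<in> U"
  using U unfolding universe_def by blast

lemma universe_infinite: obtains A where "A \<in> U" "infinite A"
  using U unfolding universe_def by blast

lemma universe_two: obtains a b :: 'u where "a \<noteq> b"
proof -
  obtain A where "A \<in> U" and A: "infinite A" by (rule universe_infinite)
  then obtain a where "a \<in> A" using infinite_imp_nonempty by blast
  moreover obtain b where "b \<in> A - {a}"
    using A infinite_remove[of A a] infinite_imp_nonempty by blast
  ultimately show thesis using that[of a b] by blast
qed

lemma universe_finite: "finite X \<Longrightarrow> X \<in> U"
  by (meson finite_lepoll_infinite universe_infinite universe_lepoll)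

lemma small_finite: "finite X \<Longrightarrow> small_set U X"
  unfolding small_set_def by (meson finite_lepoll_infinite universe_infinite)

lemma small_nat: "small_set U (UNIV :: nat set)"
  unfolding small_set_def by (metis universe_infinite infinite_le_lepoll)

lemma universe_Un:
  assumes "A \<in> U" "B \<in> U" shows "A \<union> B \<in> U"
proof -
  obtain a b :: 'u where ab: "a \<noteq> b" by (rule universe_two)
  have "(\<Union>c\<in>{a, b}. if c = a then A else B) \<in> U"
    using assms by (intro universe_UN universe_finite[of "{a, b}"]) auto
  then show ?thesis using ab by (auto simp: Un_commute)
qed

lemma small_code:
  assumes "small_set U X"
  obtains f :: "'a \<Rightarrow> 'u" where "inj_on f X" "f ` X \<in> U"
  using assms unfolding small_set_def lepoll_def by (meson universe_subset)

text \<open>Both factors embed into one infinite member \<open>Z\<close> of \<open>U\<close>, and an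
  infinite set absorbs its square.\<close>

lemma small_Times:
  assumes "small_set U X" "small_set U Y"
  shows "small_set U (X \<times> Y)"
proof -
  obtain A B where A: "A \<in> U" "X \<lesssim> A" and B: "B \<in> U" "Y \<lesssim> B"
    using assms unfolding small_set_def by blast
  obtain I where I: "I \<in> U" "infinite I" by (rule universe_infinite)
  define Z where "Z = A \<union> B \<union> I"
  have Z: "Z \<in> U" "infinite Z" unfolding Z_def using A B I universe_Un by auto
  have "X \<times> Y \<lesssim> Z \<times> Z"
    using A(2) B(2) unfolding Z_def
    by (intro times_lepoll_mono) (auto intro: lepoll_trans subset_imp_lepoll)
  moreover have "Z \<times> Z \<lesssim> Z"
    using card_of_Times_same_infinite[OF Z(2)]
    by (metis card_of_ordLeq lepoll_def ordIso_iff_ordLeq)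
  ultimately show ?thesis using Z(1) unfolding small_set_def by (meson lepoll_trans)
qed

text \<open>The union axiom concerns subsets of \<open>'u\<close> indexed by a member of
  \<open>U\<close>, so the index set and each \<open>X i\<close> are first coded in
  \<open>'u\<close>. Codes for different \<open>i\<close> may collide; an element is therefore
  recovered from the pair of its index and its code.\<close>

lemma small_UN:
  assumes I: "small_set U I" and X: "\<And>i. i \<in> I \<Longrightarrow> small_set U (X i)"
  shows "small_set U (\<Union>i\<in>I. X i)"
proof -
  obtain c :: "_ \<Rightarrow> 'u" where c: "inj_on c I" "c ` I \<in> U" using small_code[OF I] by blast
  have "\<exists>f. inj_on f (X i) \<and> f ` X i \<in> U" if "i \<in> I" for i
    using small_code[OF X[OF that]] by metis
  then obtain f :: "_ \<Rightarrow> _ \<Rightarrow> 'u" where f: "\<And>i. i \<in> I \<Longrightarrow> inj_on (f i) (X i) \<and> f i ` X i \<in> U"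
    by metis
  have "(\<Union>a\<in>c ` I. f (inv_into I c a) ` X (inv_into I c a)) \<in> U"
    using c(2) f by (intro universe_UN) (auto simp: inv_into_f_f[OF c(1)])
  then have "(\<Union>i\<in>I. f i ` X i) \<in> U" using c(1) by simp
  then have "small_set U (I \<times> (\<Union>i\<in>I. f i ` X i))"
    by (intro small_Times I small_member)
  moreover have "(\<Union>i\<in>I. X i) \<subseteq> (\<lambda>(i, v). inv_into (X i) (f i) v) ` (I \<times> (\<Union>i\<in>I. f i ` X i))"
  proof
    fix x assume "x \<in> (\<Union>i\<in>I. X i)"
    then obtain i where "i \<in> I" "x \<in> X i" by blast
    then show "x \<in> (\<lambda>(i, v). inv_into (X i) (f i) v) ` (I \<times> (\<Union>i\<in>I. f i ` X i))"
      using f by (intro image_eqI[of _ _ "(i, f i x)"]) auto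
  qed
  ultimately show ?thesis by (meson small_image small_subset)
qed

lemma small_Un:
  assumes "small_set U X" "small_set U Y" shows "small_set U (X \<union> Y)"
proof -
  have "small_set U (\<Union>b\<in>(UNIV :: bool set). if b then X else Y)"
    using assms by (intro small_UN small_finite[of "UNIV :: bool set"]) auto
  then show ?thesis by (simp add: UNIV_bool Un_commute)
qed

text \<open>By induction the function space over \<open>insert i I\<close> is an image of a binary
  product. This makes the finite diagrams for terminal objects, products and kernels admissible in
  \<open>complete_category\<close>.\<close>

lemma index_set_finite: "finite I \<Longrightarrow> index_set U I"
proof (induction I rule: finite_induct)
  case empty
  then show ?case by (simp add: index_set_def small_finite)
next
  case (insert i I)
  show ?case
    unfolding index_set_def
  proof (intro allI impI)
    fix X :: "_ \<Rightarrow> 'u set" assume X: "\<forall>j\<in>insert i I. X j \<in> U"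
    then have "small_set U (Pi\<^sub>E I X)"
      using insert.IH unfolding index_set_def by blast
    then show "small_set U (Pi\<^sub>E (insert i I) X)"
      using X unfolding PiE_insert_eq by (intro small_image small_Times small_member) auto
  qed
qed

text \<open>Sending \<open>i\<close> to its characteristic function embeds \<open>I\<close> into the
  functions to a two-element set, which form a small set because \<open>I\<close> is an index set.
  Colimits use only this weaker consequence: their generators are a union over the objects of the
  diagram.\<close>

lemma index_set_small:
  assumes I: "index_set U I" shows "small_set U I"
proof -
  obtain a b :: 'u where ab: "a \<noteq> b" by (rule universe_two)
  have "small_set U (I \<rightarrow>\<^sub>E {a, b})"
    using I universe_finite[of "{a, b}"] unfolding index_set_def by (auto dest: spec[of _ "\<lambda>_. {a, b}"])
  moreover have "I \<lesssim> I \<rightarrow>\<^sub>E {a, b}"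
    unfolding lepoll_def
  proof (intro exI conjI inj_onI)
    fix i j assume "i \<in> I" and eq: "(\<lambda>k\<in>I. if i = k then a else b) = (\<lambda>k\<in>I. if j = k then a else b)"
    from fun_cong[OF eq, of i] show "i = j"
      using \<open>i \<in> I\<close> ab by (simp split: if_splits)
  qed auto
  ultimately show ?thesis by (rule small_lepoll)
qed

text \<open>\<open>generate\<close> inverts generators only. So inverses enter at stage
  \<open>T 0\<close>, each later stage adds products of two earlier elements, and countably many
  small stages exhaust the generated set.\<close>

lemma small_generate:
  assumes S: "small_set U S"
  shows "small_set U (generate G S)"
proof -
  define T where "T = rec_nat (insert \<one>\<^bsub>G\<^esub> (S \<union> m_inv G ` S)) (\<lambda>_ X. (\<lambda>(a, b). a \<otimes>\<^bsub>G\<^esub> b) ` (X \<times> X) \<union> X)"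
  have T0: "T 0 = insert \<one>\<^bsub>G\<^esub> (S \<union> m_inv G ` S)"
    and TS: "T (Suc n) = (\<lambda>(a, b). a \<otimes>\<^bsub>G\<^esub> b) ` (T n \<times> T n) \<union> T n" for n
    by (simp_all add: T_def)
  have mono: "T m \<subseteq> T n" if "m \<le> n" for m n
    using that by (rule lift_Suc_mono_le[of T, rotated]) (auto simp: TS)
  have "x \<in> (\<Union>n. T n)" if "x \<in> generate G S" for x
    using that
  proof induction
    case (eng a b)
    then obtain m n where "a \<in> T m" "b \<in> T n" by blast
    then have "a \<in> T (max m n)" "b \<in> T (max m n)"
      using mono[of m "max m n"] mono[of n "max m n"] by auto
    then have "a \<otimes>\<^bsub>G\<^esub> b \<in> T (Suc (max m n))" by (auto simp: TS)
    then show ?case by blast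
  qed (use T0 in \<open>auto intro!: exI[of _ 0]\<close>)
  moreover have "small_set U (T n)" for n
  proof (induction n)
    case 0
    have "T 0 = {\<one>\<^bsub>G\<^esub>} \<union> (S \<union> m_inv G ` S)" by (simp add: T0)
    then show ?case using S by (simp only:) (intro small_Un small_image small_finite[of "{_}"], auto)
  next
    case (Suc n)
    then show ?case by (simp only: TS) (intro small_Un small_image small_Times)
  qed
  then have "small_set U (\<Union>n. T n)" by (intro small_UN small_nat)
  ultimately show ?thesis by (meson small_subset subsetI)
qed

end

section \<open>Duality and preadditive structures\<close>

lemma dual_simps [simp]:
  "Obj (dual C) = Obj C" "Hom (dual C) x y = Hom C y x" "Ident (dual C) = Ident C"
  "Comp (dual C) x y z g f = Comp C z y x f g" "dual (dual C) = C"
  by (simp_all add: dual_def)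

lemma category_dual: "category C \<Longrightarrow> category (dual C)"
  unfolding category_def by simp

lemma zero_object_dual [simp]: "zero_object (dual C) = zero_object C"
  by (auto simp: zero_object_def fun_eq_iff)

lemma zero_morphism_dual [simp]: "zero_morphism (dual C) x y = zero_morphism C y x"
  unfolding zero_morphism_def fun_eq_iff by (simp, blast)

text \<open>The first conjunct of \<open>additive_category\<close>: a plain \<open>cat\<close>
  carries no addition, and any choice of one serves, since zero morphisms are defined through zero
  objects.\<close>

definition has_preadditive_structure :: "('o, 'm) cat \<Rightarrow> bool" where
  "has_preadditive_structure C \<longleftrightarrow> (\<exists>A :: ('o, 'm) preadd. preadditive A \<and> cat.truncate A = C)"

lemma truncate_simps [simp]:
  "Obj (cat.truncate A) = Obj A" "Hom (cat.truncate A) = Hom A" "Ident (cat.truncate A) = Ident A"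
  "Comp (cat.truncate A) = Comp A"
  by (simp_all add: cat.truncate_def)

lemma has_preadditive_structure_dual:
  assumes "has_preadditive_structure C" shows "has_preadditive_structure (dual C)"
proof -
  obtain A :: "('a, 'b) preadd" where A: "preadditive A" "cat.truncate A = C"
    using assms unfolding has_preadditive_structure_def by blast
  define B :: "('a, 'b) preadd" where
    "B = \<lparr>Obj = Obj A, Hom = (\<lambda>x y. Hom A y x), Ident = Ident A,
       Comp = (\<lambda>x y z g f. Comp A z y x f g), Plus = (\<lambda>x y. Plus A y x), Zero = (\<lambda>x y. Zero A y x)\<rparr>"
  have B: "Obj B = Obj A" "Hom B = (\<lambda>x y. Hom A y x)" "Ident B = Ident A"
    "Comp B = (\<lambda>x y z g f. Comp A z y x f g)" "hom_group B = (\<lambda>x y. hom_group A y x)"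
    by (simp_all add: B_def hom_group_def fun_eq_iff)
  have "preadditive B"
    using A(1) unfolding preadditive_def preadditive_axioms_def category_def B by simp
  moreover have "cat.truncate B = dual C"
    by (simp add: cat.truncate_def B_def dual_def flip: A(2))
  ultimately show ?thesis unfolding has_preadditive_structure_def by blast
qed

section \<open>Zero objects and zero morphisms in a preadditive category\<close>

context preadditive
begin

lemma Hom_group: "x \<in> Obj A \<Longrightarrow> y \<in> Obj A \<Longrightarrow> group (hom_group A x y)"
  using comm_group_Hom by (simp add: comm_group_def)

lemma Zero_in_Hom: "x \<in> Obj A \<Longrightarrow> y \<in> Obj A \<Longrightarrow> Zero A x y \<in> Hom A x y"
  using Hom_group[THEN group.is_monoid, THEN monoid.one_closed, of x y] by (simp add: hom_group_def)

lemma Comp_Zero_right: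
  "x \<in> Obj A \<Longrightarrow> y \<in> Obj A \<Longrightarrow> z \<in> Obj A \<Longrightarrow> g \<in> Hom A y z \<Longrightarrow>
   Comp A x y z g (Zero A x y) = Zero A x z"
  using hom_one[OF Comp_hom_right Hom_group Hom_group, of x y z g] by (simp add: hom_group_def)

lemma Comp_Zero_left:
  "x \<in> Obj A \<Longrightarrow> y \<in> Obj A \<Longrightarrow> z \<in> Obj A \<Longrightarrow> f \<in> Hom A x y \<Longrightarrow>
   Comp A x y z (Zero A y z) f = Zero A x z"
  using hom_one[OF Comp_hom_left Hom_group Hom_group, of x y z f] by (simp add: hom_group_def)

text \<open>A terminal object has one endomorphism, so its identity is the additive zero;
  precomposing with it turns every map out of \<open>z\<close> into zero.\<close>

lemma zero_object_if_terminal: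
  assumes z: "z \<in> Obj A" and t: "\<And>x. x \<in> Obj A \<Longrightarrow> \<exists>!f. f \<in> Hom A x z"
  shows "zero_object (cat.truncate A) z"
  unfolding zero_object_def truncate_simps
proof (intro conjI ballI z t)
  fix x assume x: "x \<in> Obj A"
  have Id: "Ident A z = Zero A z z"
    using t[OF z] Ident_in_Hom[OF z] Zero_in_Hom[OF z z] by blast
  show "\<exists>!f. f \<in> Hom A z x"
  proof (intro ex1I[of _ "Zero A z x"] Zero_in_Hom z x)
    fix f assume f: "f \<in> Hom A z x"
    then show "f = Zero A z x"
      using Comp_Ident[OF z x f] Comp_Zero_right[OF z z x f] Id by simp
  qed
qed

text \<open>The only map into a zero object is the additive zero, and composition preserves it;
  hence it does not matter through which zero object a map factors.\<close>

lemma zero_morphism_iff: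
  assumes z: "zero_object (cat.truncate A) z" and x: "x \<in> Obj A" and y: "y \<in> Obj A"
  shows "zero_morphism (cat.truncate A) x y f \<longleftrightarrow> f = Zero A x y"
proof
  assume "zero_morphism (cat.truncate A) x y f"
  then obtain w g h where w: "zero_object (cat.truncate A) w"
    and g: "g \<in> Hom A x w" and h: "h \<in> Hom A w y" and f: "f = Comp A x w y h g"
    unfolding zero_morphism_def by auto
  have wO: "w \<in> Obj A" using w unfolding zero_object_def by simp
  have "g = Zero A x w"
    using w g x Zero_in_Hom[OF x wO] unfolding zero_object_def by auto
  then show "f = Zero A x y" using Comp_Zero_right[OF x wO y h] f by simp
next
  assume f: "f = Zero A x y"
  have zO: "z \<in> Obj A" using z unfolding zero_object_def by simp
  show "zero_morphism (cat.truncate A) x y f"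
    unfolding zero_morphism_def
    using z Zero_in_Hom[OF x zO] Zero_in_Hom[OF zO y] Comp_Zero_right[OF x zO y Zero_in_Hom[OF zO y]] f
    by (intro exI[of _ z] exI[of _ "Zero A x z"] exI[of _ "Zero A z y"]) simp
qed

end


section \<open>Kernels and products from limits\<close>

lemma terminal_if_complete:
  assumes U: "universe U" and C: "complete_category U C"
  obtains z where "z \<in> Obj C" "\<And>x. x \<in> Obj C \<Longrightarrow> \<exists>!f. f \<in> Hom C x z"
proof -
  define J :: "('a, 'a) cat" where
    "J = \<lparr>Obj = {}, Hom = (\<lambda>_ _. {}), Ident = undefined, Comp = undefined\<rparr>"
  have J: "Obj J = {}" by (simp add: J_def)
  have "small_index_category U J"
    unfolding small_index_category_def J by (simp add: index_set_finite[OF U] category_def J)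
  moreover have "is_functor J C D" for D unfolding is_functor_def J by simp
  ultimately obtain z c where zc: "is_limit J C (undefined :: ('a, 'a, 'b, 'c) func) z c"
    using C unfolding complete_category_def by blast
  show thesis
  proof (rule that)
    show "z \<in> Obj C" using zc unfolding is_limit_def is_cone_def by simp
    show "\<exists>!f. f \<in> Hom C x z" if "x \<in> Obj C" for x
      using zc that unfolding is_limit_def is_cone_def J by simp
  qed
qed

lemma product_if_complete:
  fixes U :: "'u set set" and C :: "('o, 'm) cat"
  assumes U: "universe U" and C: "complete_category U C" and cat: "category C"
    and x: "x \<in> Obj C" and y: "y \<in> Obj C"
  shows "\<exists>p p1 p2. is_product C x y p p1 p2"
proof -
  interpret category C by (rule cat)
  obtain a b :: 'u where ab: "a \<noteq> b" by (rule universe_two[OF U])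
  \<comment> \<open>The discrete category on two points; \<open>a\<close> also serves as the single
    arrow, the identity, of each hom set.\<close>
  define J :: "('u, 'u) cat" where
    "J = \<lparr>Obj = {a, b}, Hom = (\<lambda>i j. if i = j then {a} else {}), Ident = (\<lambda>_. a), Comp = (\<lambda>_ _ _ _ _. a)\<rparr>"
  define D :: "('u, 'u, 'o, 'm) func" where
    "D = \<lparr>on_obj = (\<lambda>i. if i = a then x else y), on_hom = (\<lambda>i _ _. Ident C (if i = a then x else y))\<rparr>"
  have "small_index_category U J"
    unfolding small_index_category_def category_def
    by (auto simp: J_def intro!: index_set_finite[OF U])
  moreover have "is_functor J C D"
    using x y ab unfolding is_functor_def J_def D_def by (auto intro: Ident_in_Hom simp: Ident_Comp Ident_in_Hom)
  ultimately obtain p c where pc: "is_limit J C D p c"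
    using C unfolding complete_category_def by blast
  have cone: "is_cone J C D w d \<longleftrightarrow> w \<in> Obj C \<and> d a \<in> Hom C w x \<and> d b \<in> Hom C w y" for w d
    using ab x y unfolding is_cone_def J_def D_def by (auto simp: Ident_Comp)
  have all: "(\<forall>i\<in>Obj J. Q i) \<longleftrightarrow> Q a \<and> Q b" for Q by (simp add: J_def)
  have D: "on_obj D a = x" "on_obj D b = y" using ab by (simp_all add: D_def)
  have "is_product C x y p (c a) (c b)"
    unfolding is_product_def
  proof (intro conjI ballI)
    show "p \<in> Obj C" "c a \<in> Hom C p x" "c b \<in> Hom C p y"
      using pc unfolding is_limit_def cone by auto
    fix w q1 q2 assume w: "w \<in> Obj C" "q1 \<in> Hom C w x" "q2 \<in> Hom C w y"
    have "is_cone J C D w (\<lambda>i. if i = a then q1 else q2)" using w ab unfolding cone by simp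
    from pc[unfolded is_limit_def, THEN conjunct2, rule_format, OF this]
    show "\<exists>!u. u \<in> Hom C w p \<and> Comp C w p x (c a) u = q1 \<and> Comp C w p y (c b) u = q2"
      using ab by (simp add: all D)
  qed
  then show ?thesis by blast
qed

lemma (in preadditive) kernel_if_complete:
  fixes U :: "'u set set"
  assumes U: "universe U" and C: "complete_category U (cat.truncate A)"
    and z: "zero_object (cat.truncate A) z"
    and x: "x \<in> Obj A" and y: "y \<in> Obj A" and f: "f \<in> Hom A x y"
  shows "\<exists>k i. is_kernel (cat.truncate A) x y f k i"
proof -
  obtain a b :: 'u where ab: "a \<noteq> b" by (rule universe_two[OF U])
  \<comment> \<open>The parallel pair: the arrow \<open>a\<close> from \<open>a\<close> to
    \<open>b\<close> will act as \<open>f\<close> and the arrow \<open>b\<close> as zero, so a limit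
    is the equalizer of \<open>f\<close> and 0. In a composite one factor is always an identity, and
    \<open>Comp\<close> returns the other one.\<close>
  define J :: "('u, 'u) cat" where
    "J = \<lparr>Obj = {a, b}, Hom = (\<lambda>i j. if i = j then {a} else if i = a then {a, b} else {}),
      Ident = (\<lambda>_. a), Comp = (\<lambda>i j _ m n. if i = j then m else n)\<rparr>"
  define D :: "('u, 'u, 'o, 'm) func" where
    "D = \<lparr>on_obj = (\<lambda>i. if i = a then x else y),
      on_hom = (\<lambda>i j m. if i = j then Ident A (if i = a then x else y) else if m = a then f else Zero A x y)\<rparr>"
  have "small_index_category U J"
    unfolding small_index_category_def category_def
    by (auto simp: J_def intro!: index_set_finite[OF U] split: if_splits)
  moreover have "is_functor J (cat.truncate A) D"
    using x y ab f unfolding is_functor_def J_def D_def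
    by (auto intro: Ident_in_Hom Zero_in_Hom simp: Ident_Comp Comp_Ident Ident_in_Hom Zero_in_Hom split: if_splits)
  ultimately obtain k c where kc: "is_limit J (cat.truncate A) D k c"
    using C unfolding complete_category_def by blast
  have cone: "is_cone J (cat.truncate A) D w d \<longleftrightarrow>
    w \<in> Obj A \<and> d a \<in> Hom A w x \<and> d b = Zero A w y \<and> Comp A w x y f (d a) = Zero A w y" for w d
    using ab x y unfolding is_cone_def J_def D_def
    by (auto simp: Ident_Comp Comp_Zero_left Zero_in_Hom)
  have all: "(\<forall>i\<in>Obj J. Q i) \<longleftrightarrow> Q a \<and> Q b" for Q by (simp add: J_def)
  have D: "on_obj D a = x" "on_obj D b = y" using ab by (simp_all add: D_def)
  have k: "k \<in> Obj A" "c a \<in> Hom A k x" "Comp A k x y f (c a) = Zero A k y" "c b = Zero A k y"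
    using kc unfolding is_limit_def cone by auto
  have "is_kernel (cat.truncate A) x y f k (c a)"
    unfolding is_kernel_def truncate_simps
  proof (intro conjI ballI impI)
    show "k \<in> Obj A" "c a \<in> Hom A k x" by (rule k)+
    show "zero_morphism (cat.truncate A) k y (Comp A k x y f (c a))"
      using k zero_morphism_iff[OF z k(1) y] by simp
    fix w h assume w: "w \<in> Obj A" "h \<in> Hom A w x" "zero_morphism (cat.truncate A) w y (Comp A w x y f h)"
    then have "is_cone J (cat.truncate A) D w (\<lambda>i. if i = a then h else Zero A w y)"
      using ab unfolding cone zero_morphism_iff[OF z w(1) y] by simp
    from kc[unfolded is_limit_def, THEN conjunct2, rule_format, OF this]
    have "\<exists>!u. u \<in> Hom A w k \<and> Comp A w k x (c a) u = h \<and> Comp A w k y (c b) u = Zero A w y"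
      using ab by (simp add: all D)
    \<comment> \<open>The leg at \<open>b\<close> is zero, so the condition on \<open>u\<close> at
      \<open>b\<close> holds for every \<open>u\<close>.\<close>
    then show "\<exists>!u. u \<in> Hom A w k \<and> Comp A w k x (c a) u = h"
      using Comp_Zero_left[OF w(1) k(1) y] k(4) by metis
  qed
  then show ?thesis by blast
qed

lemma kernels_if_complete:
  assumes U: "universe U" and pre: "has_preadditive_structure C" and C: "complete_category U C"
  shows "\<exists>z. zero_object C z"
    and "\<lbrakk>x \<in> Obj C; y \<in> Obj C; f \<in> Hom C x y\<rbrakk> \<Longrightarrow> \<exists>k i. is_kernel C x y f k i"
proof -
  obtain A :: "('b, 'c) preadd" where A: "preadditive A" and AC: "cat.truncate A = C"
    using pre unfolding has_preadditive_structure_def by blast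
  interpret preadditive A by (rule A)
  show z: "\<exists>z. zero_object C z"
  proof -
    obtain z where "z \<in> Obj C" "\<And>x. x \<in> Obj C \<Longrightarrow> \<exists>!f. f \<in> Hom C x z"
      using terminal_if_complete[OF U C] by blast
    then have "zero_object (cat.truncate A) z"
      by (intro zero_object_if_terminal) (simp_all flip: AC)
    then show ?thesis using AC by blast
  qed
  then obtain z where "zero_object C z" by blast
  then show "\<exists>k i. is_kernel C x y f k i" if "x \<in> Obj C" "y \<in> Obj C" "f \<in> Hom C x y"
    using kernel_if_complete[OF U, of z x y f] C that unfolding AC[symmetric] by simp
qed

lemma category_if_preadditive: "has_preadditive_structure C \<Longrightarrow> category C"
  unfolding has_preadditive_structure_def preadditive_def category_def by auto

text \<open>Cokernels are kernels in the dual category, which is again preadditive and complete.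
  This is applied to module classes and once more to the localization.\<close>

lemma pre_abelian_if_complete:
  assumes U: "universe U" and pre: "has_preadditive_structure C"
    and C: "complete_category U C" and C': "cocomplete_category U C"
  shows "pre_abelian C"
proof -
  have cok: "\<exists>c q. is_cokernel C x y f c q" if "x \<in> Obj C" "y \<in> Obj C" "f \<in> Hom C x y" for x y f
    using kernels_if_complete(2)[OF U has_preadditive_structure_dual[OF pre], of y x f] C' that
    unfolding cocomplete_category_def is_cokernel_def by simp
  show ?thesis
    unfolding pre_abelian_def additive_category_def has_preadditive_structure_def[symmetric]
    using pre kernels_if_complete[OF U pre C] cok product_if_complete[OF U C category_if_preadditive[OF pre]]
    by blast
qed

section \<open>Transport along an equivalence\<close>

text \<open>A fully faithful functor onto \<open>D\<close>, literally surjective on objects, so that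
  limits and cokernels lift without choosing isomorphisms. Of \<open>C\<close> only closure of
  identities and composites is assumed; the category axioms are derived, which spares their
  verification for classes of zigzags.\<close>

locale surjective_equivalence = D: category D
  for C :: "('o, 'm) cat" and D :: "('p, 'n) cat" and obj :: "'o \<Rightarrow> 'p" and arr :: "'o \<Rightarrow> 'o \<Rightarrow> 'm \<Rightarrow> 'n" +
  assumes obj: "obj ` Obj C = Obj D"
    and arr: "\<lbrakk>x \<in> Obj C; y \<in> Obj C\<rbrakk> \<Longrightarrow> bij_betw (arr x y) (Hom C x y) (Hom D (obj x) (obj y))"
    and Ident_closed: "x \<in> Obj C \<Longrightarrow> Ident C x \<in> Hom C x x"
    and Comp_closed: "\<lbrakk>x \<in> Obj C; y \<in> Obj C; z \<in> Obj C; f \<in> Hom C x y; g \<in> Hom C y z\<rbrakk>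
      \<Longrightarrow> Comp C x y z g f \<in> Hom C x z"
    and arr_Ident: "x \<in> Obj C \<Longrightarrow> arr x x (Ident C x) = Ident D (obj x)"
    and arr_Comp: "\<lbrakk>x \<in> Obj C; y \<in> Obj C; z \<in> Obj C; f \<in> Hom C x y; g \<in> Hom C y z\<rbrakk>
      \<Longrightarrow> arr x z (Comp C x y z g f) = Comp D (obj x) (obj y) (obj z) (arr y z g) (arr x y f)"
begin

lemma dual_equivalence: "surjective_equivalence (dual C) (dual D) obj (\<lambda>x y. arr y x)"
  by (intro surjective_equivalence.intro surjective_equivalence_axioms.intro category_dual D.category_axioms)
    (simp_all add: obj arr Ident_closed Comp_closed arr_Ident arr_Comp)

lemma obj_in: "x \<in> Obj C \<Longrightarrow> obj x \<in> Obj D"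
  using obj by blast

lemma arr_in: "x \<in> Obj C \<Longrightarrow> y \<in> Obj C \<Longrightarrow> f \<in> Hom C x y \<Longrightarrow> arr x y f \<in> Hom D (obj x) (obj y)"
  using arr bij_betwE by blast

lemma arr_eq_iff:
  "\<lbrakk>x \<in> Obj C; y \<in> Obj C; f \<in> Hom C x y; g \<in> Hom C x y\<rbrakk> \<Longrightarrow> arr x y f = arr x y g \<longleftrightarrow> f = g"
  using arr[of x y] unfolding bij_betw_def inj_on_def by blast

lemma Hom_image: "x \<in> Obj C \<Longrightarrow> y \<in> Obj C \<Longrightarrow> Hom D (obj x) (obj y) = arr x y ` Hom C x y"
  using arr[of x y] unfolding bij_betw_def by simp

text \<open>The bijection on hom sets carries unique solutions to unique solutions. Every universal
  property below is transported through this equivalence.\<close>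

lemma ex1_arr:
  assumes "x \<in> Obj C" "y \<in> Obj C"
    and "\<And>f. f \<in> Hom C x y \<Longrightarrow> P f \<longleftrightarrow> Q (arr x y f)"
  shows "(\<exists>!f. f \<in> Hom C x y \<and> P f) \<longleftrightarrow> (\<exists>!g. g \<in> Hom D (obj x) (obj y) \<and> Q g)"
proof
  assume "\<exists>!f. f \<in> Hom C x y \<and> P f"
  then obtain f where f: "f \<in> Hom C x y" "P f" and uniq: "\<And>f'. f' \<in> Hom C x y \<Longrightarrow> P f' \<Longrightarrow> f' = f"
    by (elim ex1E) blast
  show "\<exists>!g. g \<in> Hom D (obj x) (obj y) \<and> Q g"
  proof (rule ex1I)
    show "arr x y f \<in> Hom D (obj x) (obj y) \<and> Q (arr x y f)"
      using f arr_in assms by simp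
    fix g assume g: "g \<in> Hom D (obj x) (obj y) \<and> Q g"
    then obtain f' where "f' \<in> Hom C x y" "g = arr x y f'"
      unfolding Hom_image[OF assms(1,2)] by blast
    then show "g = arr x y f" using g uniq assms(3) by simp
  qed
next
  assume "\<exists>!g. g \<in> Hom D (obj x) (obj y) \<and> Q g"
  then obtain g where g: "g \<in> Hom D (obj x) (obj y)" "Q g"
    and uniq: "\<And>g'. g' \<in> Hom D (obj x) (obj y) \<Longrightarrow> Q g' \<Longrightarrow> g' = g"
    by (elim ex1E) blast
  then obtain f where f: "f \<in> Hom C x y" "g = arr x y f"
    unfolding Hom_image[OF assms(1,2)] by blast
  show "\<exists>!f. f \<in> Hom C x y \<and> P f"
  proof (rule ex1I)
    show "f \<in> Hom C x y \<and> P f" using f g assms(3) by simp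
    fix f' assume f': "f' \<in> Hom C x y \<and> P f'"
    then have "arr x y f' = g" using uniq[of "arr x y f'"] arr_in[OF assms(1,2)] assms(3)[of f'] by auto
    then show "f' = f" using f f' arr_eq_iff[OF assms(1,2)] by simp
  qed
qed

lemma zero_object_iff:
  assumes "x \<in> Obj C" shows "zero_object C x \<longleftrightarrow> zero_object D (obj x)"
  using assms ex1_arr[of _ _ "\<lambda>_. True" "\<lambda>_. True"]
  unfolding zero_object_def obj[symmetric] by auto

lemma zero_morphism_iff:
  assumes "x \<in> Obj C" "y \<in> Obj C" "f \<in> Hom C x y"
  shows "zero_morphism C x y f \<longleftrightarrow> zero_morphism D (obj x) (obj y) (arr x y f)"
proof
  assume "zero_morphism C x y f"
  then obtain z g h where z: "zero_object C z" "g \<in> Hom C x z" "h \<in> Hom C z y" "f = Comp C x z y h g"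
    unfolding zero_morphism_def by blast
  then have zC: "z \<in> Obj C" unfolding zero_object_def by blast
  show "zero_morphism D (obj x) (obj y) (arr x y f)"
    unfolding zero_morphism_def
    using z zC assms zero_object_iff[OF zC] arr_in arr_Comp
    by (intro exI[of _ "obj z"] exI[of _ "arr x z g"] exI[of _ "arr z y h"]) simp
next
  assume "zero_morphism D (obj x) (obj y) (arr x y f)"
  then obtain Z g' h' where z': "zero_object D Z" "g' \<in> Hom D (obj x) Z" "h' \<in> Hom D Z (obj y)"
    "arr x y f = Comp D (obj x) Z (obj y) h' g'"
    unfolding zero_morphism_def by blast
  then obtain z where zC: "z \<in> Obj C" "Z = obj z" unfolding zero_object_def obj[symmetric] by blast
  then obtain g h where gh: "g \<in> Hom C x z" "h \<in> Hom C z y" "g' = arr x z g" "h' = arr z y h"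
    using z' assms Hom_image by auto
  then have "f = Comp C x z y h g"
    using z'(4) zC assms arr_Comp[of x z y g h] arr_eq_iff[of x y f "Comp C x z y h g"] Comp_closed by simp
  then show "zero_morphism C x y f"
    unfolding zero_morphism_def using zC gh z'(1) zero_object_iff by blast
qed

lemma is_kernel_iff:
  assumes "x \<in> Obj C" "y \<in> Obj C" "f \<in> Hom C x y" "k \<in> Obj C" "i \<in> Hom C k x"
  shows "is_kernel C x y f k i \<longleftrightarrow> is_kernel D (obj x) (obj y) (arr x y f) (obj k) (arr k x i)"
proof -
  have "(\<exists>!u. u \<in> Hom C w k \<and> Comp C w k x i u = h) \<longleftrightarrow>
      (\<exists>!u. u \<in> Hom D (obj w) (obj k) \<and> Comp D (obj w) (obj k) (obj x) (arr k x i) u = arr w x h)"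
    if "w \<in> Obj C" "h \<in> Hom C w x" for w h
    using that assms by (intro ex1_arr) (auto simp: arr_eq_iff Comp_closed simp flip: arr_Comp)
  moreover have "zero_morphism C w y (Comp C w x y f h) \<longleftrightarrow>
      zero_morphism D (obj w) (obj y) (Comp D (obj w) (obj x) (obj y) (arr x y f) (arr w x h))"
    if "w \<in> Obj C" "h \<in> Hom C w x" for w h
    using that assms zero_morphism_iff[of w y "Comp C w x y f h"] by (simp add: arr_Comp Comp_closed)
  ultimately show ?thesis
    using assms arr_in obj_in
    unfolding is_kernel_def obj[symmetric] ball_simps by (simp add: Hom_image cong: ball_cong)
qed

lemma is_cokernel_iff:
  assumes "x \<in> Obj C" "y \<in> Obj C" "f \<in> Hom C x y" "c \<in> Obj C" "q \<in> Hom C y c"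
  shows "is_cokernel C x y f c q \<longleftrightarrow> is_cokernel D (obj x) (obj y) (arr x y f) (obj c) (arr y c q)"
  using surjective_equivalence.is_kernel_iff[OF dual_equivalence, of y x f c q] assms
  unfolding is_cokernel_def by simp

text \<open>A test object and its two maps in \<open>D\<close> lift to \<open>C\<close>, by
  surjectivity on objects and fullness; faithfulness lifts the commuting square.\<close>

lemma is_pullback_image:
  assumes pb: "is_pullback C x y z f g p p1 p2"
    and xyz: "x \<in> Obj C" "y \<in> Obj C" "z \<in> Obj C" "f \<in> Hom C x z" "g \<in> Hom C y z"
  shows "is_pullback D (obj x) (obj y) (obj z) (arr x z f) (arr y z g) (obj p) (arr p x p1) (arr p y p2)"
proof -
  have p: "p \<in> Obj C" "p1 \<in> Hom C p x" "p2 \<in> Hom C p y" "Comp C p x z f p1 = Comp C p y z g p2"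
    and univ: "\<And>w q1 q2. \<lbrakk>w \<in> Obj C; q1 \<in> Hom C w x; q2 \<in> Hom C w y; Comp C w x z f q1 = Comp C w y z g q2\<rbrakk> \<Longrightarrow>
        \<exists>!u. u \<in> Hom C w p \<and> Comp C w p x p1 u = q1 \<and> Comp C w p y p2 u = q2"
    using pb unfolding is_pullback_def by auto
  show ?thesis
    unfolding is_pullback_def
  proof (intro conjI ballI impI)
    show "Comp D (obj p) (obj x) (obj z) (arr x z f) (arr p x p1) = Comp D (obj p) (obj y) (obj z) (arr y z g) (arr p y p2)"
      using p xyz arr_Comp[of p x z p1 f] arr_Comp[of p y z p2 g] by simp
    fix W Q1 Q2
    assume "W \<in> Obj D" "Q1 \<in> Hom D W (obj x)" "Q2 \<in> Hom D W (obj y)"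
      and eq: "Comp D W (obj x) (obj z) (arr x z f) Q1 = Comp D W (obj y) (obj z) (arr y z g) Q2"
    then obtain w q1 q2 where w: "w \<in> Obj C" "W = obj w" and q: "q1 \<in> Hom C w x" "q2 \<in> Hom C w y"
      and Q: "Q1 = arr w x q1" "Q2 = arr w y q2"
      using xyz unfolding obj[symmetric] by (auto simp: Hom_image)
    have "arr w z (Comp C w x z f q1) = arr w z (Comp C w y z g q2)"
      using eq w q xyz by (simp add: arr_Comp Q)
    then have "Comp C w x z f q1 = Comp C w y z g q2"
      using w q xyz by (simp add: arr_eq_iff Comp_closed)
    from univ[OF w(1) q this]
    show "\<exists>!u. u \<in> Hom D W (obj p) \<and> Comp D W (obj p) (obj x) (arr p x p1) u = Q1 \<and>
        Comp D W (obj p) (obj y) (arr p y p2) u = Q2"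
      unfolding w(2) Q using w p q xyz
      by (subst (asm) ex1_arr) (auto simp: arr_eq_iff Comp_closed simp flip: arr_Comp)
  qed (use p xyz arr_in obj_in in auto)
qed

lemma cokernels_stable_under_pullback:
  assumes D: "cokernels_stable_under_pullback D"
  shows "cokernels_stable_under_pullback C"
  unfolding cokernels_stable_under_pullback_def
proof (intro ballI allI impI, elim conjE bexE)
  fix x y z f g p p1 p2 w h
  assume xyz: "x \<in> Obj C" "y \<in> Obj C" "z \<in> Obj C" "f \<in> Hom C x z" "g \<in> Hom C y z"
    and pb: "is_pullback C x y z f g p p1 p2"
    and w: "w \<in> Obj C" "h \<in> Hom C w x" "is_cokernel C w x h z f"
  have p: "p \<in> Obj C" "p2 \<in> Hom C p y" using pb unfolding is_pullback_def by auto
  have "is_cokernel D (obj w) (obj x) (arr w x h) (obj z) (arr x z f)"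
    using is_cokernel_iff w xyz by blast
  then have "\<exists>w\<in>Obj D. \<exists>h\<in>Hom D w (obj p). is_cokernel D w (obj p) h (obj y) (arr p y p2)"
    using D[unfolded cokernels_stable_under_pullback_def, rule_format, of "obj x" "obj y" "obj z" "arr x z f" "arr y z g"]
      is_pullback_image[OF pb xyz] xyz w obj_in arr_in by blast
  then obtain v k where vk: "v \<in> Obj C" "k \<in> Hom C v p"
    "is_cokernel D (obj v) (obj p) (arr v p k) (obj y) (arr p y p2)"
    using p by (auto simp: obj[symmetric] Hom_image)
  then have "is_cokernel C v p k y p2" using is_cokernel_iff p xyz by blast
  then show "\<exists>w\<in>Obj C. \<exists>h\<in>Hom C w p. is_cokernel C w p h y p2" using vk by blast
qed

text \<open>The diagram is pushed forward to \<open>D\<close> and its limit there is lifted: the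
  vertex by surjectivity on objects, the legs by fullness.\<close>

lemma complete:
  fixes U :: "'u set set"
  assumes D: "complete_category U D"
  shows "complete_category U C"
  unfolding complete_category_def
proof (intro allI impI, elim conjE)
  fix J :: "('u, 'u) cat" and G :: "('u, 'u, 'o, 'm) func"
  assume J: "small_index_category U J" and G: "is_functor J C G"
  have GO: "\<And>i. i \<in> Obj J \<Longrightarrow> on_obj G i \<in> Obj C"
    and GH: "\<And>i j a. \<lbrakk>i \<in> Obj J; j \<in> Obj J; a \<in> Hom J i j\<rbrakk> \<Longrightarrow> on_hom G i j a \<in> Hom C (on_obj G i) (on_obj G j)"
    using G unfolding is_functor_def by auto
  define H where "H = \<lparr>on_obj = (\<lambda>i. obj (on_obj G i)),
    on_hom = (\<lambda>i j a. arr (on_obj G i) (on_obj G j) (on_hom G i j a))\<rparr>"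
  have H: "on_obj H i = obj (on_obj G i)" "on_hom H i j a = arr (on_obj G i) (on_obj G j) (on_hom G i j a)" for i j a
    by (simp_all add: H_def)
  have "is_functor J D H"
    using G unfolding is_functor_def H by (auto simp: obj_in arr_in arr_Ident arr_Comp)
  then obtain X C' where X: "is_limit J D H X C'"
    using D J unfolding complete_category_def by blast
  then have XD: "X \<in> Obj D" "\<And>i. i \<in> Obj J \<Longrightarrow> C' i \<in> Hom D X (obj (on_obj G i))"
    unfolding is_limit_def is_cone_def H by auto
  then obtain x where x: "x \<in> Obj C" "X = obj x" unfolding obj[symmetric] by blast
  have "\<forall>i\<in>Obj J. \<exists>c. c \<in> Hom C x (on_obj G i) \<and> C' i = arr x (on_obj G i) c"
    using XD(2) x GO Hom_image by blast
  then obtain c where c: "\<And>i. i \<in> Obj J \<Longrightarrow> c i \<in> Hom C x (on_obj G i) \<and> C' i = arr x (on_obj G i) (c i)"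
    by metis
  \<comment> \<open>The second conjunct is required because \<open>arr\<close> is unconstrained off
    the hom sets of \<open>C\<close> and could send a non-arrow to a leg of a cone.\<close>
  have cone: "is_cone J C G y d \<longleftrightarrow>
      is_cone J D H (obj y) (\<lambda>i. arr y (on_obj G i) (d i)) \<and> (\<forall>i\<in>Obj J. d i \<in> Hom C y (on_obj G i))"
    if y: "y \<in> Obj C" for y d
  proof -
    have "Comp C y (on_obj G i) (on_obj G j) (on_hom G i j a) (d i) = d j \<longleftrightarrow>
        Comp D (obj y) (on_obj H i) (on_obj H j) (on_hom H i j a) (arr y (on_obj G i) (d i)) = arr y (on_obj G j) (d j)"
      if "\<forall>i\<in>Obj J. d i \<in> Hom C y (on_obj G i)" "i \<in> Obj J" "j \<in> Obj J" "a \<in> Hom J i j" for i j a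
      using that y GO GH by (simp add: H arr_eq_iff Comp_closed flip: arr_Comp)
    then show ?thesis
      unfolding is_cone_def H using y GO obj_in arr_in by (auto simp: H)
  qed
  have cone_cong: "is_cone J D H Y d \<longleftrightarrow> is_cone J D H Y e" if "\<And>i. i \<in> Obj J \<Longrightarrow> d i = e i" for Y d e
    using that unfolding is_cone_def by simp
  have "is_limit J C G x c"
    unfolding is_limit_def
  proof (intro conjI allI impI)
    have "is_cone J D H X C'" using X unfolding is_limit_def by blast
    then show "is_cone J C G x c"
      unfolding cone[OF x(1)] using c cone_cong[of C' "\<lambda>i. arr x (on_obj G i) (c i)"] x(2) by auto
    fix y d assume yd: "is_cone J C G y d"
    then have y: "y \<in> Obj C" unfolding is_cone_def by blast
    have d: "\<And>i. i \<in> Obj J \<Longrightarrow> d i \<in> Hom C y (on_obj G i)" using yd unfolding is_cone_def by blast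
    have "is_cone J D H (obj y) (\<lambda>i. arr y (on_obj G i) (d i))"
      using yd cone[OF y] by blast
    then have "\<exists>!u. u \<in> Hom D (obj y) X \<and>
        (\<forall>i\<in>Obj J. Comp D (obj y) X (on_obj H i) (C' i) u = arr y (on_obj G i) (d i))"
      using X[unfolded is_limit_def, THEN conjunct2, rule_format] by blast
    then show "\<exists>!u. u \<in> Hom C y x \<and> (\<forall>i\<in>Obj J. Comp C y x (on_obj G i) (c i) u = d i)"
      unfolding x(2) using x y c d GO
      by (subst ex1_arr) (auto simp: arr_eq_iff Comp_closed H simp flip: arr_Comp)
  qed
  then show "\<exists>x c. is_limit J C G x c" by blast
qed

lemma cocomplete: "cocomplete_category U D \<Longrightarrow> cocomplete_category U C"
  unfolding cocomplete_category_def by (rule surjective_equivalence.complete[OF dual_equivalence])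

text \<open>Each axiom is an equation between arrows of \<open>C\<close>, so by injectivity of
  \<open>arr\<close> it may be checked in \<open>D\<close>.\<close>

lemma category: "category C"
proof
  fix w x y z f g h
  assume "w \<in> Obj C" "x \<in> Obj C" "y \<in> Obj C" "z \<in> Obj C" "f \<in> Hom C w x" "g \<in> Hom C x y" "h \<in> Hom C y z"
  then show "Comp C w x z (Comp C x y z h g) f = Comp C w y z h (Comp C w x y g f)"
    by (subst arr_eq_iff[symmetric, of w z])
      (simp_all add: Comp_closed arr_Comp, metis D.Comp_assoc arr_in obj_in)
next
  fix x y f assume "x \<in> Obj C" "y \<in> Obj C" "f \<in> Hom C x y"
  then show "Comp C x x y f (Ident C x) = f" "Comp C x y y (Ident C y) f = f"
    by (subst arr_eq_iff[symmetric, of x y];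
      simp add: Comp_closed Ident_closed arr_Comp arr_Ident D.Comp_Ident D.Ident_Comp arr_in obj_in)+
qed (use Ident_closed Comp_closed in auto)

text \<open>Addition on a hom set of \<open>C\<close> is that of \<open>D\<close> carried back along
  the bijection \<open>arr\<close>; bilinearity of composition follows from
  \<open>arr_Comp\<close>.\<close>

lemma preadditive_structure:
  assumes "has_preadditive_structure D" shows "has_preadditive_structure C"
proof -
  obtain B :: "('p, 'n) preadd" where B: "preadditive B" and BD: "cat.truncate B = D"
    using assms unfolding has_preadditive_structure_def by blast
  interpret B: preadditive B by (rule B)
  have D_simps: "Obj B = Obj D" "Hom B = Hom D" "Ident B = Ident D" "Comp B = Comp D"
    by (simp_all flip: BD)
  define inva where "inva x y = inv_into (Hom C x y) (arr x y)" for x y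
  define A :: "('o, 'm) preadd" where
    "A = \<lparr>Obj = Obj C, Hom = Hom C, Ident = Ident C, Comp = Comp C,
      Plus = (\<lambda>x y f g. inva x y (Plus B (obj x) (obj y) (arr x y f) (arr x y g))),
      Zero = (\<lambda>x y. inva x y (Zero B (obj x) (obj y)))\<rparr>"
  have A: "Obj A = Obj C" "Hom A = Hom C" "Ident A = Ident C" "Comp A = Comp C" by (simp_all add: A_def)
  have AC: "cat.truncate A = C" by (simp add: A_def cat.truncate_def)
  have HG: "hom_group A x y = \<lparr>carrier = inva x y ` Hom D (obj x) (obj y),
      mult = (\<lambda>f g. inva x y (Plus B (obj x) (obj y) (arr x y f) (arr x y g))),
      one = inva x y (Zero B (obj x) (obj y))\<rparr>" if "x \<in> Obj C" "y \<in> Obj C" for x y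
  proof -
    have "inva x y ` Hom D (obj x) (obj y) = Hom C x y"
      using bij_betw_inv_into[OF arr[OF that]] unfolding bij_betw_def inva_def by simp
    then show ?thesis by (simp add: hom_group_def A_def)
  qed
  have hg: "carrier (hom_group A x y) = Hom C x y"
    "f \<otimes>\<^bsub>hom_group A x y\<^esub> g = inva x y (Plus B (obj x) (obj y) (arr x y f) (arr x y g))" for x y f g
    by (simp_all add: hom_group_def A_def)
  have hgB: "carrier (hom_group B X Y) = Hom D X Y" "f \<otimes>\<^bsub>hom_group B X Y\<^esub> g = Plus B X Y f g" for X Y f g
    by (simp_all add: hom_group_def D_simps)
  have inva_in: "inva x y f \<in> Hom C x y" and arr_inva: "arr x y (inva x y f) = f"
    if "x \<in> Obj C" "y \<in> Obj C" "f \<in> Hom D (obj x) (obj y)" for x y f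
    using that by (auto simp: Hom_image inva_def inv_into_into f_inv_into_f)
  have inva_arr: "inva x y (arr x y f) = f" if "x \<in> Obj C" "y \<in> Obj C" "f \<in> Hom C x y" for x y f
    using arr[OF that(1,2)] that(3) unfolding inva_def bij_betw_def by simp
  have Plus_in: "Plus B (obj x) (obj y) f g \<in> Hom D (obj x) (obj y)"
    if "x \<in> Obj C" "y \<in> Obj C" "f \<in> Hom D (obj x) (obj y)" "g \<in> Hom D (obj x) (obj y)" for x y f g
    using monoid.m_closed[OF group.is_monoid[OF B.Hom_group[of "obj x" "obj y"]], of f g] that obj_in
    by (simp add: hgB D_simps)
  have "preadditive A"
  proof (intro preadditive.intro preadditive_axioms.intro)
    show "category A" using category unfolding category_def A .
    fix x y assume xy: "x \<in> Obj A" "y \<in> Obj A"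
    then have xy': "x \<in> Obj C" "y \<in> Obj C" by (simp_all add: A)
    interpret G: comm_group "hom_group B (obj x) (obj y)"
      using B.comm_group_Hom obj_in xy' by (simp add: D_simps)
    \<comment> \<open>The hom group is obtained as the homomorphic image of the one in
      \<open>D\<close>. The image construction replaces the unit of \<open>?H\<close>, so any value
      will do there.\<close>
    let ?H = "\<lparr>carrier = Hom C x y,
      mult = (\<lambda>f g. inva x y (Plus B (obj x) (obj y) (arr x y f) (arr x y g))), one = undefined\<rparr>"
    have "inva x y \<in> hom (hom_group B (obj x) (obj y)) ?H"
      using xy' by (auto simp: hom_def hgB inva_in arr_inva)
    from G.hom_imp_img_comm_group[OF this]
    show "comm_group (hom_group A x y)"
      using xy' by (simp add: HG hgB) (simp add: hom_group_def)
  next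
    fix x y z g assume "x \<in> Obj A" "y \<in> Obj A" "z \<in> Obj A" "g \<in> Hom A y z"
    then have xyz: "x \<in> Obj C" "y \<in> Obj C" "z \<in> Obj C" "g \<in> Hom C y z" by (simp_all add: A)
    show "(\<lambda>f. Comp A x y z g f) \<in> hom (hom_group A x y) (hom_group A x z)"
    proof (rule homI; unfold hg A)
      fix f f' assume f: "f \<in> Hom C x y" "f' \<in> Hom C x y"
      show "Comp C x y z g f \<in> Hom C x z" using xyz f Comp_closed by blast
      have "Comp B (obj x) (obj y) (obj z) (arr y z g) (Plus B (obj x) (obj y) (arr x y f) (arr x y f')) =
        Plus B (obj x) (obj z) (Comp B (obj x) (obj y) (obj z) (arr y z g) (arr x y f))
          (Comp B (obj x) (obj y) (obj z) (arr y z g) (arr x y f'))"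
        using hom_mult[OF B.Comp_hom_right[of "obj x" "obj y" "obj z" "arr y z g"], of "arr x y f" "arr x y f'"]
          xyz f obj_in arr_in by (simp add: hgB D_simps)
      then have "arr x z (Comp C x y z g (inva x y (Plus B (obj x) (obj y) (arr x y f) (arr x y f')))) =
          Plus B (obj x) (obj z) (arr x z (Comp C x y z g f)) (arr x z (Comp C x y z g f'))"
        using xyz f arr_in by (simp add: arr_Comp arr_inva inva_in Plus_in D_simps)
      then show "Comp C x y z g (inva x y (Plus B (obj x) (obj y) (arr x y f) (arr x y f'))) =
          inva x z (Plus B (obj x) (obj z) (arr x z (Comp C x y z g f)) (arr x z (Comp C x y z g f')))"
        using xyz f arr_in by (metis Comp_closed Plus_in inva_arr inva_in)
    qed
  next
    fix x y z f assume "x \<in> Obj A" "y \<in> Obj A" "z \<in> Obj A" "f \<in> Hom A x y"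
    then have xyz: "x \<in> Obj C" "y \<in> Obj C" "z \<in> Obj C" "f \<in> Hom C x y" by (simp_all add: A)
    show "(\<lambda>g. Comp A x y z g f) \<in> hom (hom_group A y z) (hom_group A x z)"
    proof (rule homI; unfold hg A)
      fix g g' assume g: "g \<in> Hom C y z" "g' \<in> Hom C y z"
      show "Comp C x y z g f \<in> Hom C x z" using xyz g Comp_closed by blast
      have "Comp B (obj x) (obj y) (obj z) (Plus B (obj y) (obj z) (arr y z g) (arr y z g')) (arr x y f) =
        Plus B (obj x) (obj z) (Comp B (obj x) (obj y) (obj z) (arr y z g) (arr x y f))
          (Comp B (obj x) (obj y) (obj z) (arr y z g') (arr x y f))"
        using hom_mult[OF B.Comp_hom_left[of "obj x" "obj y" "obj z" "arr x y f"], of "arr y z g" "arr y z g'"]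
          xyz g obj_in arr_in by (simp add: hgB D_simps)
      then have "arr x z (Comp C x y z (inva y z (Plus B (obj y) (obj z) (arr y z g) (arr y z g'))) f) =
          Plus B (obj x) (obj z) (arr x z (Comp C x y z g f)) (arr x z (Comp C x y z g' f))"
        using xyz g arr_in by (simp add: arr_Comp arr_inva inva_in Plus_in D_simps)
      then show "Comp C x y z (inva y z (Plus B (obj y) (obj z) (arr y z g) (arr y z g'))) f =
          inva x z (Plus B (obj x) (obj z) (arr x z (Comp C x y z g f)) (arr x z (Comp C x y z g' f)))"
        using xyz g arr_in by (metis Comp_closed Plus_in inva_arr inva_in)
    qed
  qed
  then show ?thesis using AC unfolding has_preadditive_structure_def by blast
qed

end

section \<open>Localizations as full subcategories\<close>

text \<open>Criterion for \<open>D\<close> to be the localization of \<open>C\<close> at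
  \<open>S\<close>. \<open>equalized\<close> and \<open>lifted\<close> compare \<open>C\<close> with
  \<open>D\<close> directly, in place of the Ore conditions: equality in \<open>D\<close> and arrows
  of \<open>D\<close> are realized in \<open>C\<close> after precomposition with an element of
  \<open>S\<close>.\<close>

locale fraction_functor = C: category C + D: category D
  for C :: "('o, 'm) cat" and D :: "('p, 'n) cat" and obj :: "'o \<Rightarrow> 'p" and arr :: "'o \<Rightarrow> 'o \<Rightarrow> 'm \<Rightarrow> 'n"
    and S :: "'o \<Rightarrow> 'o \<Rightarrow> 'm set" +
  assumes obj: "obj ` Obj C = Obj D"
    and arr_in: "\<lbrakk>x \<in> Obj C; y \<in> Obj C; f \<in> Hom C x y\<rbrakk> \<Longrightarrow> arr x y f \<in> Hom D (obj x) (obj y)"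
    and arr_Ident: "x \<in> Obj C \<Longrightarrow> arr x x (Ident C x) = Ident D (obj x)"
    and arr_Comp: "\<lbrakk>x \<in> Obj C; y \<in> Obj C; z \<in> Obj C; f \<in> Hom C x y; g \<in> Hom C y z\<rbrakk>
      \<Longrightarrow> arr x z (Comp C x y z g f) = Comp D (obj x) (obj y) (obj z) (arr y z g) (arr x y f)"
    and S_Hom: "\<lbrakk>x \<in> Obj C; y \<in> Obj C; s \<in> S x y\<rbrakk> \<Longrightarrow> s \<in> Hom C x y"
    and S_invertible: "\<lbrakk>x \<in> Obj C; y \<in> Obj C; s \<in> S x y\<rbrakk> \<Longrightarrow> \<exists>t\<in>Hom D (obj y) (obj x).
      Comp D (obj x) (obj y) (obj x) t (arr x y s) = Ident D (obj x) \<and>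
      Comp D (obj y) (obj x) (obj y) (arr x y s) t = Ident D (obj y)"
    and equalized: "\<lbrakk>x \<in> Obj C; y \<in> Obj C; f \<in> Hom C x y; g \<in> Hom C x y; arr x y f = arr x y g\<rbrakk> \<Longrightarrow>
      \<exists>w\<in>Obj C. \<exists>k\<in>S w x. Comp C w x y f k = Comp C w x y g k"
    and lifted: "\<lbrakk>x \<in> Obj C; y \<in> Obj C; t \<in> Hom D (obj x) (obj y)\<rbrakk> \<Longrightarrow>
      \<exists>w\<in>Obj C. \<exists>k\<in>S w x. \<exists>g\<in>Hom C w y. arr w y g = Comp D (obj w) (obj x) (obj y) t (arr w x k)"
begin

abbreviation "zeq \<equiv> zigzag_eq C S"

lemma obj_in: "x \<in> Obj C \<Longrightarrow> obj x \<in> Obj D"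
  using obj by blast

section \<open>Interpretation of zigzags in the target category\<close>

definition inverse_arr :: "'o \<Rightarrow> 'o \<Rightarrow> 'm \<Rightarrow> 'n" where
  "inverse_arr x y s = (SOME t. t \<in> Hom D (obj y) (obj x) \<and>
      Comp D (obj x) (obj y) (obj x) t (arr x y s) = Ident D (obj x) \<and>
      Comp D (obj y) (obj x) (obj y) (arr x y s) t = Ident D (obj y))"

lemma inverse_arr:
  assumes "x \<in> Obj C" "y \<in> Obj C" "s \<in> S x y"
  shows "inverse_arr x y s \<in> Hom D (obj y) (obj x)"
    and "Comp D (obj x) (obj y) (obj x) (inverse_arr x y s) (arr x y s) = Ident D (obj x)"
    and "Comp D (obj y) (obj x) (obj y) (arr x y s) (inverse_arr x y s) = Ident D (obj y)"
proof -
  have "inverse_arr x y s \<in> Hom D (obj y) (obj x) \<and>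
      Comp D (obj x) (obj y) (obj x) (inverse_arr x y s) (arr x y s) = Ident D (obj x) \<and>
      Comp D (obj y) (obj x) (obj y) (arr x y s) (inverse_arr x y s) = Ident D (obj y)"
    unfolding inverse_arr_def by (rule someI_ex) (use S_invertible[OF assms] in blast)
  then show "inverse_arr x y s \<in> Hom D (obj y) (obj x)"
    "Comp D (obj x) (obj y) (obj x) (inverse_arr x y s) (arr x y s) = Ident D (obj x)"
    "Comp D (obj y) (obj x) (obj y) (arr x y s) (inverse_arr x y s) = Ident D (obj y)"
    by auto
qed

text \<open>Steps are listed in the order of traversal, so the head is the innermost factor. The
  parameter \<open>w\<close> is the end of the zigzag, which \<open>Comp\<close> requires as an
  object and the empty list does not record.\<close>

fun interp :: "'o \<Rightarrow> ('o, 'm) step list \<Rightarrow> 'n" where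
  "interp w [] = Ident D (obj w)"
| "interp w (Fwd x y f # p) = Comp D (obj x) (obj y) (obj w) (interp w p) (arr x y f)"
| "interp w (Bwd x y s # p) = Comp D (obj y) (obj x) (obj w) (interp w p) (inverse_arr x y s)"

lemma zigzag_objects: "zigzag C S x y p \<Longrightarrow> x \<in> Obj C \<and> y \<in> Obj C"
  by (induction C S x y p rule: zigzag.induct) auto

lemma interp_in: "zigzag C S x y p \<Longrightarrow> interp y p \<in> Hom D (obj x) (obj y)"
proof (induction y p arbitrary: x rule: interp.induct)
  case (2 w a b f p)
  then show ?case using zigzag_objects[of b w p] by (auto intro!: D.Comp_in_Hom obj_in arr_in)
next
  case (3 w a b s p)
  then show ?case using zigzag_objects[of a w p] by (auto intro!: D.Comp_in_Hom obj_in inverse_arr)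
qed (auto intro: D.Ident_in_Hom obj_in)

lemma zigzag_append: "zigzag C S x y p \<Longrightarrow> zigzag C S y z q \<Longrightarrow> zigzag C S x z (p @ q)"
  by (induction C S x y p rule: zigzag.induct) auto

lemma interp_append:
  "zigzag C S x y p \<Longrightarrow> zigzag C S y z q \<Longrightarrow>
   interp z (p @ q) = Comp D (obj x) (obj y) (obj z) (interp z q) (interp y p)"
proof (induction y p arbitrary: x rule: interp.induct)
  case (1 w)
  then show ?case using zigzag_objects[of w z q] by (simp add: D.Comp_Ident obj_in interp_in)
next
  case (2 w a b f p)
  then show ?case
    using zigzag_objects[of w z q] by (auto simp: D.Comp_assoc obj_in interp_in arr_in)
next
  case (3 w a b s p)
  then show ?case
    using zigzag_objects[of w z q] by (auto simp: D.Comp_assoc obj_in interp_in inverse_arr)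
qed

text \<open>Each generating relation becomes an identity in \<open>D\<close>, where \<open>S\<close>
  is invertible, and \<open>append\<close> becomes compatibility with composition. Well-formedness
  of both sides is carried along because \<open>zigzag_eq\<close> does not demand it
  explicitly.\<close>

lemma zigzag_eq_sound: "zeq x y p q \<Longrightarrow> zigzag C S x y p \<and> zigzag C S x y q \<and> interp y p = interp y q"
proof (induction rule: zigzag_eq.induct)
  case (Comp x y z f g)
  then show ?case by (simp add: C.Comp_in_Hom arr_Comp D.Ident_Comp D.Comp_in_Hom obj_in arr_in)
next
  case (append x y p p' z q q')
  then show ?case
    using zigzag_append[of x y p z q] zigzag_append[of x y p' z q'] interp_append[of x y p z q]
      interp_append[of x y p' z q'] by simp
qed (auto simp: C.Ident_in_Hom arr_Ident D.Comp_Ident D.Ident_Comp obj_in D.Ident_in_Hom S_Hom inverse_arr arr_in)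

lemmas [trans] = zigzag_eq.trans

section \<open>Calculation with zigzags modulo the relations\<close>

lemma zeq_Cons:
  "zigzag C S x y [a] \<Longrightarrow> zeq y z p q \<Longrightarrow> zeq x z (a # p) (a # q)"
  using zigzag_eq.append[OF zigzag_eq.refl[of C S x y "[a]"], of z p q] by simp

lemma zeq_prefix: "zeq x y p p' \<Longrightarrow> zigzag C S y z q \<Longrightarrow> zeq x z (p @ q) (p' @ q)"
  by (intro zigzag_eq.append zigzag_eq.refl)

lemma zeq_insert:
  assumes "w \<in> Obj C" "x \<in> Obj C" "k \<in> S w x" "zigzag C S x y p"
  shows "zeq x y (Bwd w x k # Fwd w x k # p) p"
  using zeq_prefix[OF zigzag_eq.Bwd_Fwd[where C = C and S = S, OF assms(1-3)] assms(4)] by simp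

lemma zeq_Comp:
  assumes "x \<in> Obj C" "y \<in> Obj C" "z \<in> Obj C" "f \<in> Hom C x y" "g \<in> Hom C y z" "zigzag C S z w p"
  shows "zeq x w (Fwd x y f # Fwd y z g # p) (Fwd x z (Comp C x y z g f) # p)"
  using zeq_prefix[OF zigzag_eq.Comp[where C = C and S = S, OF assms(1-5)] assms(6)] by simp

text \<open>Going back along \<open>k\<close> and forward along \<open>f\<close> after
  \<open>k\<close> amounts to \<open>f\<close>: split the composite and cancel \<open>k\<close>.
  Read from right to left, it moves the start of a zigzag to an object where \<open>f\<close> can be
  compared with other maps.\<close>

lemma zeq_fraction:
  assumes "w \<in> Obj C" "x \<in> Obj C" "y \<in> Obj C" "k \<in> S w x" "f \<in> Hom C x y" "zigzag C S y z p"
  shows "zeq x z (Bwd w x k # Fwd w y (Comp C w x y f k) # p) (Fwd x y f # p)"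
proof -
  have "zeq x z (Bwd w x k # Fwd w y (Comp C w x y f k) # p) (Bwd w x k # Fwd w x k # Fwd x y f # p)"
    using assms S_Hom[of w x k]
    by (intro zeq_Cons[of _ w] zigzag_eq.sym[OF zeq_Comp]) simp_all
  also have "zeq x z \<dots> (Fwd x y f # p)"
    using assms by (intro zeq_insert) simp_all
  finally show ?thesis .
qed

text \<open>Maps equal in \<open>D\<close> agree after some \<open>k\<close> in \<open>S\<close>, so
  both are the same fraction: back along \<open>k\<close>, then along the common composite.\<close>

lemma zeq_parallel:
  assumes xy: "x \<in> Obj C" "y \<in> Obj C" and fg: "f \<in> Hom C x y" "g \<in> Hom C x y" "arr x y f = arr x y g"
    and p: "zigzag C S y z p"
  shows "zeq x z (Fwd x y f # p) (Fwd x y g # p)"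
proof -
  obtain w k where "w \<in> Obj C" "k \<in> S w x" "Comp C w x y f k = Comp C w x y g k"
    using equalized[OF xy fg] by blast
  then show ?thesis
    using zeq_fraction[of w x y k f z p] zeq_fraction[of w x y k g z p] xy fg p
    by (metis zigzag_eq.sym zigzag_eq.trans)
qed

text \<open>
  A zigzag is determined by its interpretation: after precomposition with any arrow along which its
  interpretation lifts, it is a single forward step.
\<close>

lemma zeq_Fwd:
  assumes "zigzag C S v y p" "x \<in> Obj C" "h \<in> Hom C x v" "g \<in> Hom C x y"
    and "arr x y g = Comp D (obj x) (obj v) (obj y) (interp y p) (arr x v h)"
  shows "zeq x y (Fwd x v h # p) [Fwd x y g]"
  using assms
proof (induction y p arbitrary: v x h g rule: interp.induct)
  case (1 w)
  then have v: "v = w" "w \<in> Obj C" by auto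
  have "zeq x w [Fwd x w h] [Fwd x w g]"
    using 1 v by (intro zeq_parallel) (auto simp: D.Ident_Comp obj_in arr_in)
  then show ?case using v by simp
next
  case (2 w a b f p)
  then have v: "v = a" "a \<in> Obj C" "b \<in> Obj C" "f \<in> Hom C a b" "zigzag C S b w p" by auto
  then have w: "w \<in> Obj C" using zigzag_objects by blast
  have "zeq x w (Fwd x a h # Fwd a b f # p) (Fwd x b (Comp C x a b f h) # p)"
    using 2 v by (intro zeq_Comp) simp_all
  also have "zeq x w \<dots> [Fwd x w g]"
    using 2 v w by (intro "2.IH") (simp_all add: C.Comp_in_Hom arr_Comp D.Comp_assoc obj_in arr_in interp_in)
  finally show ?case using v by simp
next
  case (3 w a b s p)
  then have v: "v = b" "a \<in> Obj C" "b \<in> Obj C" "s \<in> S a b" "zigzag C S a w p" by auto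
  then have w: "w \<in> Obj C" and s: "s \<in> Hom C a b" using zigzag_objects S_Hom by blast+
  have x: "x \<in> Obj C" "h \<in> Hom C x b" "g \<in> Hom C x w" using 3 v by auto
  \<comment> \<open>The interpretation of \<open>h\<close> followed by the formal inverse of
    \<open>s\<close>. It is an arrow of \<open>D\<close> that need not come from \<open>C\<close>;
    \<open>lifted\<close> gives \<open>k\<close> in \<open>S\<close> along which it becomes the
    image of a map \<open>m\<close>.\<close>
  define t where "t = Comp D (obj x) (obj b) (obj a) (inverse_arr a b s) (arr x b h)"
  have t: "t \<in> Hom D (obj x) (obj a)"
    unfolding t_def using v x by (intro D.Comp_in_Hom obj_in arr_in inverse_arr)
  then obtain u k m where u: "u \<in> Obj C" "k \<in> S u x" "m \<in> Hom C u a"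
    and m: "arr u a m = Comp D (obj u) (obj x) (obj a) t (arr u x k)"
    using lifted v x by meson
  have k: "k \<in> Hom C u x" using S_Hom u x by blast
  have "Comp D (obj x) (obj a) (obj b) (arr a b s) t = arr x b h"
    unfolding t_def using v x s
    by (simp add: D.Comp_assoc[symmetric] obj_in arr_in inverse_arr D.Ident_Comp)
  then have par: "arr u b (Comp C u a b s m) = arr u b (Comp C u x b h k)"
    using u v x s k t by (simp add: arr_Comp m obj_in arr_in flip: D.Comp_assoc)
  have "arr u w (Comp C u x w g k) = Comp D (obj u) (obj a) (obj w) (interp w p) (arr u a m)"
  proof -
    have "arr x w g = Comp D (obj x) (obj a) (obj w) (interp w p) t"
      unfolding t_def using 3(6) v x w by (simp add: D.Comp_assoc obj_in arr_in inverse_arr interp_in)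
    then show ?thesis
      using u v x w k t by (simp add: arr_Comp m D.Comp_assoc obj_in arr_in interp_in)
  qed
  then have IH: "zeq u w (Fwd u a m # p) [Fwd u w (Comp C u x w g k)]"
    using "3.IH"[of a u m "Comp C u x w g k"] u v x w k by (simp add: C.Comp_in_Hom)
  have zk: "zigzag C S x u [Bwd u x k]" and zm: "zigzag C S u a [Fwd u a m]"
    and zs: "zigzag C S b w (Bwd a b s # p)" using u v x by simp_all
  \<comment> \<open>With primes for formal inverses and steps in order of traversal, the chain is
    \<open>h s' p\<close>, \<open>k' (h k) s' p\<close>, \<open>k' (s m) s' p\<close>,
    \<open>k' m s s' p\<close>, \<open>k' m p\<close>, \<open>k' (g k)\<close>, \<open>g\<close>.
    The second equality replaces a map by one with the same image in \<open>D\<close>, the fifth is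
    the induction hypothesis for the shorter zigzag.\<close>
  have "zeq x w (Fwd x b h # Bwd a b s # p) (Bwd u x k # Fwd u b (Comp C u x b h k) # Bwd a b s # p)"
    using u v x by (intro zigzag_eq.sym[OF zeq_fraction] zs)
  also have "zeq x w \<dots> (Bwd u x k # Fwd u b (Comp C u a b s m) # Bwd a b s # p)"
    using u v x s k by (intro zeq_Cons[OF zk] zeq_parallel[OF _ _ _ _ par[symmetric]] zs C.Comp_in_Hom)
  also have "zeq x w \<dots> (Bwd u x k # Fwd u a m # Fwd a b s # Bwd a b s # p)"
    using u v x s by (intro zeq_Cons[OF zk] zigzag_eq.sym[OF zeq_Comp] zs)
  also have "zeq x w \<dots> (Bwd u x k # Fwd u a m # p)"
    using zeq_prefix[OF zigzag_eq.Fwd_Bwd[where C = C and S = S, OF v(2-4)] v(5)] by (intro zeq_Cons[OF zk] zeq_Cons[OF zm]) simp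
  also have "zeq x w \<dots> [Bwd u x k, Fwd u w (Comp C u x w g k)]"
    by (intro zeq_Cons[OF zk] IH)
  also have "zeq x w \<dots> [Fwd x w g]"
    using u x w by (intro zeq_fraction) simp_all
  finally show ?case using v by simp
qed

text \<open>Lift the common interpretation along some \<open>k\<close> in \<open>S\<close> to an
  arrow \<open>g\<close>. Preceded by \<open>k\<close>, both zigzags reduce to \<open>g\<close>, and
  prefixing the inverse of \<open>k\<close> removes \<open>k\<close> again.\<close>

lemma zigzag_eq_complete:
  assumes p: "zigzag C S x y p" and q: "zigzag C S x y q" and eq: "interp y p = interp y q"
  shows "zeq x y p q"
proof -
  have xy: "x \<in> Obj C" "y \<in> Obj C" using zigzag_objects[OF p] by auto
  obtain w k g where w: "w \<in> Obj C" "k \<in> S w x" "g \<in> Hom C w y"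
    and g: "arr w y g = Comp D (obj w) (obj x) (obj y) (interp y p) (arr w x k)"
    using lifted[OF xy interp_in[OF p]] by blast
  have k: "k \<in> Hom C w x" and zk: "zigzag C S x w [Bwd w x k]" using S_Hom w xy by simp_all
  have "zeq w y (Fwd w x k # p) (Fwd w x k # q)"
    using zeq_Fwd[OF p w(1) k w(3)] zeq_Fwd[OF q w(1) k w(3)] g eq
    by (metis zigzag_eq.sym zigzag_eq.trans)
  from zeq_Cons[OF zk this] show ?thesis
    using zeq_insert[OF w(1) xy(1) w(2) p] zeq_insert[OF w(1) xy(1) w(2) q]
    by (metis zigzag_eq.sym zigzag_eq.trans)
qed

section \<open>The localization and its equivalence with the target\<close>

definition zigzag_class :: "'o \<Rightarrow> 'o \<Rightarrow> ('o, 'm) step list \<Rightarrow> ('o, 'm) step list set" where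
  "zigzag_class x y p = {q. zeq x y p q}"

definition zigzag_arr :: "'o \<Rightarrow> 'o \<Rightarrow> ('o, 'm) step list set \<Rightarrow> 'n" where
  "zigzag_arr x y P = interp y (SOME p. p \<in> P)"

lemma zigzag_arr:
  assumes "zigzag C S x y p" shows "zigzag_arr x y (zigzag_class x y p) = interp y p"
proof -
  have "p \<in> zigzag_class x y p" unfolding zigzag_class_def using assms by (simp add: zigzag_eq.refl)
  then have "(SOME q. q \<in> zigzag_class x y p) \<in> zigzag_class x y p" by (rule someI)
  then show ?thesis unfolding zigzag_arr_def zigzag_class_def using zigzag_eq_sound by auto
qed

lemma zigzag_class_eq_iff:
  assumes "zigzag C S x y p" "zigzag C S x y q"
  shows "zigzag_class x y p = zigzag_class x y q \<longleftrightarrow> interp y p = interp y q"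
proof
  assume "interp y p = interp y q"
  then have "zeq x y p q" using assms zigzag_eq_complete by blast
  then show "zigzag_class x y p = zigzag_class x y q"
    unfolding zigzag_class_def by (blast intro: zigzag_eq.sym zigzag_eq.trans)
qed (metis assms zigzag_arr)

lemma localization_simps:
  "Obj (localization C S) = Obj C"
  "Hom (localization C S) x y = {zigzag_class x y p | p. zigzag C S x y p}"
  "Ident (localization C S) x = zigzag_class x x []"
  by (simp_all add: localization_def zigzag_class_def)

lemma localization_Comp:
  assumes "zigzag C S x y p" "zigzag C S y z q"
  shows "Comp (localization C S) x y z (zigzag_class y z q) (zigzag_class x y p) = zigzag_class x z (p @ q)"
proof -
  have "zeq x z (p @ q) r \<longleftrightarrow> (\<exists>p'\<in>zigzag_class x y p. \<exists>q'\<in>zigzag_class y z q. zeq x z (p' @ q') r)" for r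
  proof
    have "p \<in> zigzag_class x y p" "q \<in> zigzag_class y z q"
      unfolding zigzag_class_def using assms by (simp_all add: zigzag_eq.refl)
    then show "\<exists>p'\<in>zigzag_class x y p. \<exists>q'\<in>zigzag_class y z q. zeq x z (p' @ q') r" if "zeq x z (p @ q) r"
      using that by blast
  next
    assume "\<exists>p'\<in>zigzag_class x y p. \<exists>q'\<in>zigzag_class y z q. zeq x z (p' @ q') r"
    then obtain p' q' where "zeq x y p p'" "zeq y z q q'" "zeq x z (p' @ q') r"
      unfolding zigzag_class_def by blast
    then show "zeq x z (p @ q) r" using zigzag_eq.append zigzag_eq.trans by metis
  qed
  then show ?thesis by (simp add: localization_def zigzag_class_def[of x z])
qed

text \<open>Soundness makes the interpretation of a class well defined, completeness makes it
  injective. It is surjective because an arrow \<open>t\<close> that lifts along \<open>k\<close> to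
  \<open>g\<close> is the interpretation of the fraction: back along \<open>k\<close>, then along
  \<open>g\<close>.\<close>

lemma localization_equivalence: "surjective_equivalence (localization C S) D obj zigzag_arr"
proof
  show "obj ` Obj (localization C S) = Obj D" using obj by (simp add: localization_simps)
next
  fix x y assume "x \<in> Obj (localization C S)" "y \<in> Obj (localization C S)"
  then have xy: "x \<in> Obj C" "y \<in> Obj C" by (simp_all add: localization_simps)
  show "bij_betw (zigzag_arr x y) (Hom (localization C S) x y) (Hom D (obj x) (obj y))"
    unfolding bij_betw_def localization_simps
  proof (intro conjI)
    show "inj_on (zigzag_arr x y) {zigzag_class x y p |p. zigzag C S x y p}"
    proof (rule inj_onI)
      fix P Q assume "P \<in> {zigzag_class x y p |p. zigzag C S x y p}" "Q \<in> {zigzag_class x y p |p. zigzag C S x y p}"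
        and eq: "zigzag_arr x y P = zigzag_arr x y Q"
      then obtain p q where p: "zigzag C S x y p" "P = zigzag_class x y p"
        and q: "zigzag C S x y q" "Q = zigzag_class x y q" by blast
      then show "P = Q" using eq zigzag_class_eq_iff[OF p(1) q(1)] by (simp add: zigzag_arr)
    qed
    show "zigzag_arr x y ` {zigzag_class x y p |p. zigzag C S x y p} = Hom D (obj x) (obj y)"
    proof (intro equalityI subsetI)
      fix t assume "t \<in> zigzag_arr x y ` {zigzag_class x y p |p. zigzag C S x y p}"
      then show "t \<in> Hom D (obj x) (obj y)" by (auto simp: zigzag_arr interp_in)
    next
      fix t assume t: "t \<in> Hom D (obj x) (obj y)"
      obtain w k g where w: "w \<in> Obj C" "k \<in> S w x" "g \<in> Hom C w y"
        and g: "arr w y g = Comp D (obj w) (obj x) (obj y) t (arr w x k)"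
        using lifted[OF xy t] by blast
      have k: "k \<in> Hom C w x" using S_Hom w xy by blast
      have z: "zigzag C S x y [Bwd w x k, Fwd w y g]" using w xy by simp
      have "interp y [Bwd w x k, Fwd w y g] = t"
        using w xy g t k by (simp add: D.Comp_assoc D.Ident_Comp D.Comp_Ident inverse_arr obj_in arr_in D.Comp_in_Hom)
      then show "t \<in> zigzag_arr x y ` {zigzag_class x y p |p. zigzag C S x y p}"
        using zigzag_arr[OF z] z by (intro image_eqI[of _ _ "zigzag_class x y [Bwd w x k, Fwd w y g]"]) auto
    qed
  qed
next
  fix x assume "x \<in> Obj (localization C S)"
  then have z: "zigzag C S x x []" by (simp add: localization_simps)
  then show "Ident (localization C S) x \<in> Hom (localization C S) x x"
    "zigzag_arr x x (Ident (localization C S) x) = Ident D (obj x)"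
    using zigzag_arr[OF z] unfolding localization_simps by auto
next
  fix x y z P Q
  assume "P \<in> Hom (localization C S) x y" "Q \<in> Hom (localization C S) y z"
  then obtain p q where p: "zigzag C S x y p" "P = zigzag_class x y p" and q: "zigzag C S y z q" "Q = zigzag_class y z q"
    unfolding localization_simps by blast
  note pq = zigzag_append[OF p(1) q(1)]
  show "Comp (localization C S) x y z Q P \<in> Hom (localization C S) x z"
    "zigzag_arr x z (Comp (localization C S) x y z Q P) =
      Comp D (obj x) (obj y) (obj z) (zigzag_arr y z Q) (zigzag_arr x y P)"
    unfolding p(2) q(2) localization_Comp[OF p(1) q(1)] zigzag_arr[OF pq] zigzag_arr[OF p(1)] zigzag_arr[OF q(1)]
      interp_append[OF p(1) q(1)] using pq unfolding localization_simps by auto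
qed

end

section \<open>Modules over a preadditive category\<close>

abbreviation carr :: "('o, 'm, 'u) amod \<Rightarrow> 'o \<Rightarrow> 'u set" where
  "carr M x \<equiv> carrier (on_obj M x)"

text \<open>With \<open>U = UNIV\<close> this makes sense for values in groups on any type.\<close>

definition is_module :: "'u set set \<Rightarrow> ('o, 'm) preadd \<Rightarrow> ('o, 'm, 'u) amod \<Rightarrow> bool" where
  "is_module U A M \<longleftrightarrow>
     (\<forall>x\<in>Obj A. comm_group (on_obj M x) \<and> carr M x \<in> U) \<and>
     (\<forall>x\<in>Obj A. \<forall>y\<in>Obj A. \<forall>f\<in>Hom A x y.
        on_hom M x y f \<in> hom (on_obj M x) (on_obj M y) \<inter> extensional (carr M x)) \<and>
     (\<forall>x\<in>Obj A. on_hom M x x (Ident A x) = (\<lambda>a\<in>carr M x. a)) \<and>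
     (\<forall>x\<in>Obj A. \<forall>y\<in>Obj A. \<forall>z\<in>Obj A. \<forall>f\<in>Hom A x y. \<forall>g\<in>Hom A y z.
        on_hom M x z (Comp A x y z g f) = (\<lambda>a\<in>carr M x. on_hom M y z g (on_hom M x y f a))) \<and>
     (\<forall>x\<in>Obj A. \<forall>y\<in>Obj A. \<forall>f\<in>Hom A x y. \<forall>g\<in>Hom A x y.
        on_hom M x y (Plus A x y f g) = (\<lambda>a\<in>carr M x. on_hom M x y f a \<otimes>\<^bsub>on_obj M y\<^esub> on_hom M x y g a))"

definition nat_trans :: "('o, 'm) preadd \<Rightarrow> ('o, 'm, 'u) amod \<Rightarrow> ('o, 'm, 'u) amod \<Rightarrow> ('o \<Rightarrow> 'u \<Rightarrow> 'u) \<Rightarrow> bool" where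
  "nat_trans A M N t \<longleftrightarrow>
     t \<in> extensional (Obj A) \<and>
     (\<forall>x\<in>Obj A. t x \<in> hom (on_obj M x) (on_obj N x) \<inter> extensional (carr M x)) \<and>
     (\<forall>x\<in>Obj A. \<forall>y\<in>Obj A. \<forall>f\<in>Hom A x y. \<forall>a\<in>carr M x.
        t y (on_hom M x y f a) = on_hom N x y f (t x a))"

lemma additive_functor_iff: "additive_functor A (Ab U) M \<longleftrightarrow> is_module U A M"
proof -
  have mult: "on_hom M x y \<in> hom (hom_group A x y) (hom_group (Ab U) (on_obj M x) (on_obj M y)) \<longleftrightarrow>
      (\<forall>f\<in>Hom A x y. on_hom M x y f \<in> hom (on_obj M x) (on_obj M y) \<inter> extensional (carr M x)) \<and>
      (\<forall>f\<in>Hom A x y. \<forall>g\<in>Hom A x y. on_hom M x y (Plus A x y f g) =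
        (\<lambda>a\<in>carr M x. on_hom M x y f a \<otimes>\<^bsub>on_obj M y\<^esub> on_hom M x y g a))" for x y
    unfolding hom_def[of "hom_group A x y"] by (auto simp: hom_group_def Ab_def)
  show ?thesis
    unfolding additive_functor_def is_functor_def is_module_def mult
    by (simp add: Ab_def compose_def) blast
qed

lemma natural_transformation_iff:
  fixes M N :: "('o, 'm, 'u) amod"
  shows "natural_transformation A (Ab U) M N t \<longleftrightarrow> nat_trans A M N t"
proof -
  have "compose X g f = compose X g' f' \<longleftrightarrow> (\<forall>a\<in>X. g (f a) = g' (f' a))" for X :: "'u set" and g f g' f' :: "'u \<Rightarrow> 'u"
    by (auto simp: compose_def restrict_def fun_eq_iff)
  then show ?thesis
    unfolding natural_transformation_def nat_trans_def by (simp add: Ab_def)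
qed

lemma Mod_category_simps:
  "Obj (Mod_category U A) = {M. is_module U A M}"
  "Hom (Mod_category U A) M N = {t. nat_trans A M N t}"
  "Ident (Mod_category U A) M = (\<lambda>x\<in>Obj A. \<lambda>a\<in>carr M x. a)"
  "Comp (Mod_category U A) L M N t s = (\<lambda>x\<in>Obj A. \<lambda>a\<in>carr L x. t x (s x a))"
  by (simp_all add: Mod_category_def additive_functor_iff natural_transformation_iff, simp_all add: Ab_def compose_def)

subsection \<open>Elementwise access\<close>

lemma module_group: "is_module U A M \<Longrightarrow> x \<in> Obj A \<Longrightarrow> comm_group (on_obj M x)"
  unfolding is_module_def by blast

lemma module_group': "is_module U A M \<Longrightarrow> x \<in> Obj A \<Longrightarrow> group (on_obj M x)"
  by (rule comm_group.axioms(2)[OF module_group])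

lemma module_carrier: "is_module U A M \<Longrightarrow> x \<in> Obj A \<Longrightarrow> carr M x \<in> U"
  unfolding is_module_def by blast

context
  fixes A :: "('o, 'm) preadd" and M :: "('o, 'm, 'u) amod" and U and x
  assumes M: "is_module U A M" and x: "x \<in> Obj A"
begin

interpretation comm_group "on_obj M x" using M x by (rule module_group)

lemma module_one: "\<one>\<^bsub>on_obj M x\<^esub> \<in> carr M x"
  by simp

lemma module_mult: "a \<in> carr M x \<Longrightarrow> b \<in> carr M x \<Longrightarrow> a \<otimes>\<^bsub>on_obj M x\<^esub> b \<in> carr M x"
  by simp

lemma module_inv: "a \<in> carr M x \<Longrightarrow> inv\<^bsub>on_obj M x\<^esub> a \<in> carr M x"
  by simp

lemma module_eq_iff: "a \<in> carr M x \<Longrightarrow> b \<in> carr M x \<Longrightarrow>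
    a \<otimes>\<^bsub>on_obj M x\<^esub> inv\<^bsub>on_obj M x\<^esub> b = \<one>\<^bsub>on_obj M x\<^esub> \<longleftrightarrow> a = b"
  by (metis inv_closed inv_inv inv_equality r_inv)

lemma module_Ident: "a \<in> carr M x \<Longrightarrow> on_hom M x x (Ident A x) a = a"
  using M x unfolding is_module_def by simp

end

context
  fixes A :: "('o, 'm) preadd" and M :: "('o, 'm, 'u) amod" and U and x y
  assumes M: "is_module U A M" and x: "x \<in> Obj A" and y: "y \<in> Obj A"
begin

lemma module_hom: "f \<in> Hom A x y \<Longrightarrow> on_hom M x y f \<in> hom (on_obj M x) (on_obj M y)"
  using M x y unfolding is_module_def by blast

lemma module_closed: "f \<in> Hom A x y \<Longrightarrow> a \<in> carr M x \<Longrightarrow> on_hom M x y f a \<in> carr M y"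
  using module_hom unfolding hom_def by blast

lemma module_hom_mult: "\<lbrakk>f \<in> Hom A x y; a \<in> carr M x; b \<in> carr M x\<rbrakk> \<Longrightarrow>
    on_hom M x y f (a \<otimes>\<^bsub>on_obj M x\<^esub> b) = on_hom M x y f a \<otimes>\<^bsub>on_obj M y\<^esub> on_hom M x y f b"
  using module_hom unfolding hom_def by blast

lemma module_hom_one: "f \<in> Hom A x y \<Longrightarrow> on_hom M x y f \<one>\<^bsub>on_obj M x\<^esub> = \<one>\<^bsub>on_obj M y\<^esub>"
  by (rule hom_one[OF module_hom module_group'[OF M x] module_group'[OF M y]])

lemma module_hom_inv: "\<lbrakk>f \<in> Hom A x y; a \<in> carr M x\<rbrakk> \<Longrightarrow>
    on_hom M x y f (inv\<^bsub>on_obj M x\<^esub> a) = inv\<^bsub>on_obj M y\<^esub> on_hom M x y f a"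
  by (rule group_hom.hom_inv[OF group_hom.intro[OF module_group'[OF M x] module_group'[OF M y]
        group_hom_axioms.intro[OF module_hom]]])

lemma module_Comp: "\<lbrakk>z \<in> Obj A; f \<in> Hom A x y; g \<in> Hom A y z; a \<in> carr M x\<rbrakk> \<Longrightarrow>
    on_hom M x z (Comp A x y z g f) a = on_hom M y z g (on_hom M x y f a)"
  using M x y unfolding is_module_def by simp

lemma module_Plus: "\<lbrakk>f \<in> Hom A x y; g \<in> Hom A x y; a \<in> carr M x\<rbrakk> \<Longrightarrow>
    on_hom M x y (Plus A x y f g) a = on_hom M x y f a \<otimes>\<^bsub>on_obj M y\<^esub> on_hom M x y g a"
  using M x y unfolding is_module_def by simp

end

context
  fixes A :: "('o, 'm) preadd" and M N :: "('o, 'm, 'u) amod" and t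
  assumes t: "nat_trans A M N t"
begin

lemma nat_trans_hom: "x \<in> Obj A \<Longrightarrow> t x \<in> hom (on_obj M x) (on_obj N x)"
  using t unfolding nat_trans_def by blast

lemma nat_trans_closed: "x \<in> Obj A \<Longrightarrow> a \<in> carr M x \<Longrightarrow> t x a \<in> carr N x"
  using nat_trans_hom unfolding hom_def by blast

lemma nat_trans_mult: "\<lbrakk>x \<in> Obj A; a \<in> carr M x; b \<in> carr M x\<rbrakk> \<Longrightarrow>
    t x (a \<otimes>\<^bsub>on_obj M x\<^esub> b) = t x a \<otimes>\<^bsub>on_obj N x\<^esub> t x b"
  using nat_trans_hom unfolding hom_def by blast

lemma nat_trans_one: "\<lbrakk>is_module U A M; is_module V A N; x \<in> Obj A\<rbrakk> \<Longrightarrow>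
    t x \<one>\<^bsub>on_obj M x\<^esub> = \<one>\<^bsub>on_obj N x\<^esub>"
  by (rule hom_one[OF nat_trans_hom module_group' module_group'])

lemma nat_trans_inv: "\<lbrakk>is_module U A M; is_module V A N; x \<in> Obj A; a \<in> carr M x\<rbrakk> \<Longrightarrow>
    t x (inv\<^bsub>on_obj M x\<^esub> a) = inv\<^bsub>on_obj N x\<^esub> t x a"
  by (rule group_hom.hom_inv[OF group_hom.intro[OF module_group' module_group'
        group_hom_axioms.intro[OF nat_trans_hom]]])

lemma nat_trans_natural: "\<lbrakk>x \<in> Obj A; y \<in> Obj A; f \<in> Hom A x y; a \<in> carr M x\<rbrakk> \<Longrightarrow>
    t y (on_hom M x y f a) = on_hom N x y f (t x a)"
  using t unfolding nat_trans_def by blast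

end

lemma nat_trans_eqI:
  assumes t: "nat_trans A M N t" and s: "nat_trans A M N' s"
    and eq: "\<And>x a. x \<in> Obj A \<Longrightarrow> a \<in> carr M x \<Longrightarrow> t x a = s x a"
  shows "t = s"
proof (rule extensionalityI)
  show "t \<in> extensional (Obj A)" "s \<in> extensional (Obj A)" using t s unfolding nat_trans_def by auto
  fix x assume x: "x \<in> Obj A"
  show "t x = s x"
    by (rule extensionalityI[of _ "carr M x"]) (use t s x eq in \<open>auto simp: nat_trans_def\<close>)
qed

lemma nat_transI:
  assumes M: "is_module U A M"
    and closed: "\<And>x a. \<lbrakk>x \<in> Obj A; a \<in> carr M x\<rbrakk> \<Longrightarrow> t x a \<in> carr N x"
    and mult: "\<And>x a b. \<lbrakk>x \<in> Obj A; a \<in> carr M x; b \<in> carr M x\<rbrakk> \<Longrightarrow>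
      t x (a \<otimes>\<^bsub>on_obj M x\<^esub> b) = t x a \<otimes>\<^bsub>on_obj N x\<^esub> t x b"
    and natural: "\<And>x y f a. \<lbrakk>x \<in> Obj A; y \<in> Obj A; f \<in> Hom A x y; a \<in> carr M x\<rbrakk> \<Longrightarrow>
      t y (on_hom M x y f a) = on_hom N x y f (t x a)"
  shows "nat_trans A M N (\<lambda>x\<in>Obj A. \<lambda>a\<in>carr M x. t x a)"
  unfolding nat_trans_def
proof (intro conjI ballI)
  fix x assume x: "x \<in> Obj A"
  show "(\<lambda>x\<in>Obj A. \<lambda>a\<in>carr M x. t x a) x \<in> hom (on_obj M x) (on_obj N x) \<inter> extensional (carr M x)"
    using x closed mult module_mult[OF M x] by (auto simp: hom_def)
  fix y f a assume "y \<in> Obj A" "f \<in> Hom A x y" "a \<in> carr M x"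
  then show "(\<lambda>x\<in>Obj A. \<lambda>a\<in>carr M x. t x a) y (on_hom M x y f a) =
      on_hom N x y f ((\<lambda>x\<in>Obj A. \<lambda>a\<in>carr M x. t x a) x a)"
    using x natural module_closed[OF M x] by simp
qed simp

lemma nat_trans_Ident: "is_module U A M \<Longrightarrow> nat_trans A M M (\<lambda>x\<in>Obj A. \<lambda>a\<in>carr M x. a)"
  by (rule nat_transI) simp_all

lemma nat_trans_Comp:
  assumes L: "is_module U A L" and s: "nat_trans A L M s" and t: "nat_trans A M N t"
  shows "nat_trans A L N (\<lambda>x\<in>Obj A. \<lambda>a\<in>carr L x. t x (s x a))"
  by (rule nat_transI[OF L])
    (use nat_trans_closed[OF s] nat_trans_closed[OF t] nat_trans_mult[OF s] nat_trans_mult[OF t]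
      nat_trans_natural[OF s] nat_trans_natural[OF t] in simp_all)

lemma nat_trans_injI:
  assumes t: "nat_trans A M N t" and M: "is_module U A M" and N: "is_module V A N" and x: "x \<in> Obj A"
    and triv: "\<And>a. a \<in> carr M x \<Longrightarrow> t x a = \<one>\<^bsub>on_obj N x\<^esub> \<Longrightarrow> a = \<one>\<^bsub>on_obj M x\<^esub>"
  shows "inj_on (t x) (carr M x)"
proof (rule inj_onI)
  fix a b assume ab: "a \<in> carr M x" "b \<in> carr M x" "t x a = t x b"
  then have "t x (a \<otimes>\<^bsub>on_obj M x\<^esub> inv\<^bsub>on_obj M x\<^esub> b) = \<one>\<^bsub>on_obj N x\<^esub>"
    using nat_trans_mult[OF t x] nat_trans_inv[OF t M N x] nat_trans_closed[OF t x] module_inv[OF M x]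
      module_eq_iff[OF N x] by simp
  then show "a = b"
    using triv[of "a \<otimes>\<^bsub>on_obj M x\<^esub> inv\<^bsub>on_obj M x\<^esub> b"] ab module_mult[OF M x] module_inv[OF M x]
      module_eq_iff[OF M x] by simp
qed

subsection \<open>Images, submodules and products\<close>

text \<open>Products and quotients live on types of functions or cosets; objects of
  \<open>Ab U\<close> must be carried by members of \<open>U\<close>, hence by sets of elements of
  \<open>'u\<close>.\<close>

lemma small_group_copy:
  fixes G :: "'v monoid" and U :: "'u set set"
  assumes U: "universe U" and G: "comm_group G" and small: "small_set U (carrier G)"
  shows "\<exists>(H :: 'u monoid) \<phi>. comm_group H \<and> carrier H \<in> U \<and> \<phi> \<in> iso G H"
proof -
  interpret comm_group G by (rule G)
  obtain c :: "'v \<Rightarrow> 'u" where c: "inj_on c (carrier G)" "c ` carrier G \<in> U"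
    using small_code[OF U small] by blast
  let ?i = "inv_into (carrier G) c"
  let ?H = "\<lparr>carrier = c ` carrier G, mult = (\<lambda>a b. c (?i a \<otimes>\<^bsub>G\<^esub> ?i b)), one = c \<one>\<^bsub>G\<^esub>\<rparr>"
  have h: "c \<in> hom G ?H" using c(1) by (auto simp: hom_def)
  have "comm_group ?H" using hom_imp_img_comm_group[OF h] by simp
  moreover have "c \<in> iso G ?H" using h c(1) by (simp add: iso_def bij_betw_def)
  ultimately show ?thesis using c(2) by (intro exI[of _ ?H] exI[of _ c]) simp
qed

text \<open>Surjections \<open>r x\<close> of groups carry the module structure over as soon as
  their kernels are stable. With bijective \<open>r\<close> this makes isomorphic copies, with the
  quotient maps of \<open>quotient_group_copy\<close> it makes quotients.\<close>

lemma module_image: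
  assumes N: "is_module V A N"
    and G: "\<And>x. x \<in> Obj A \<Longrightarrow> comm_group (G x) \<and> carrier (G x) \<in> U"
    and r: "\<And>x. x \<in> Obj A \<Longrightarrow> r x \<in> hom (on_obj N x) (G x) \<and> r x ` carr N x = carrier (G x)"
    and ker: "\<And>x y f a. \<lbrakk>x \<in> Obj A; y \<in> Obj A; f \<in> Hom A x y; a \<in> carr N x; r x a = \<one>\<^bsub>G x\<^esub>\<rbrakk> \<Longrightarrow>
      r y (on_hom N x y f a) = \<one>\<^bsub>G y\<^esub>"
  obtains M where "is_module U A M" "on_obj M = G"
    "\<And>x y f a. \<lbrakk>x \<in> Obj A; y \<in> Obj A; f \<in> Hom A x y; a \<in> carr N x\<rbrakk> \<Longrightarrow>
      on_hom M x y f (r x a) = r y (on_hom N x y f a)"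
proof -
  define i where "i x b = inv_into (carr N x) (r x) b" for x b
  define M where "M = \<lparr>on_obj = G, on_hom = (\<lambda>x y f. \<lambda>b\<in>carrier (G x). r y (on_hom N x y f (i x b)))\<rparr>"
  have M: "on_obj M = G" "on_hom M x y f = (\<lambda>b\<in>carrier (G x). r y (on_hom N x y f (i x b)))" for x y f
    by (simp_all add: M_def)
  have i: "i x b \<in> carr N x" "r x (i x b) = b" if "x \<in> Obj A" "b \<in> carrier (G x)" for x b
    using r[OF that(1)] that(2) unfolding i_def by (metis inv_into_into, metis f_inv_into_f)
  have r_in: "r x a \<in> carrier (G x)" if "x \<in> Obj A" "a \<in> carr N x" for x a
    using r that by blast
  have r_mult: "r x (a \<otimes>\<^bsub>on_obj N x\<^esub> b) = r x a \<otimes>\<^bsub>G x\<^esub> r x b"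
    if "x \<in> Obj A" "a \<in> carr N x" "b \<in> carr N x" for x a b
    using r that unfolding hom_def by blast
  have key: "on_hom M x y f (r x a) = r y (on_hom N x y f a)"
    if xy: "x \<in> Obj A" "y \<in> Obj A" "f \<in> Hom A x y" and a: "a \<in> carr N x" for x y f a
  proof -
    let ?b = "i x (r x a)"
    have b: "?b \<in> carr N x" "r x ?b = r x a" using i[OF xy(1)] r_in xy a by auto
    interpret rx: group_hom "on_obj N x" "G x" "r x"
      using module_group'[OF N xy(1)] G[OF xy(1)] r[OF xy(1)] comm_group.axioms(2)
      by (intro group_hom.intro group_hom_axioms.intro) auto
    interpret ry: group_hom "on_obj N y" "G y" "r y"
      using module_group'[OF N xy(2)] G[OF xy(2)] r[OF xy(2)] comm_group.axioms(2)
      by (intro group_hom.intro group_hom_axioms.intro) auto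
    \<comment> \<open>The difference between the chosen preimage and \<open>a\<close>; it lies in
      the kernel, so the action computed through the chosen preimage does not depend on the
      choice.\<close>
    let ?c = "?b \<otimes>\<^bsub>on_obj N x\<^esub> inv\<^bsub>on_obj N x\<^esub> a"
    have "r x ?c = \<one>\<^bsub>G x\<^esub>" using a b by simp
    moreover have c: "?c \<in> carr N x" using a b by simp
    ultimately have "r y (on_hom N x y f ?c) = \<one>\<^bsub>G y\<^esub>" using ker xy by blast
    moreover have "on_hom N x y f ?b = on_hom N x y f ?c \<otimes>\<^bsub>on_obj N y\<^esub> on_hom N x y f a"
      using module_hom_mult[OF N xy c a] a b by (simp add: rx.G.m_assoc)
    ultimately have "r y (on_hom N x y f ?b) = r y (on_hom N x y f a)"
      using module_closed[OF N xy] a c by simp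
    then show ?thesis using r_in[OF xy(1) a] by (simp add: M)
  qed
  have "is_module U A M"
    unfolding is_module_def
  proof (intro conjI ballI)
    fix x assume x: "x \<in> Obj A"
    show "comm_group (on_obj M x)" "carr M x \<in> U" using G x by (simp_all add: M)
    show "on_hom M x x (Ident A x) = (\<lambda>a\<in>carr M x. a)"
      unfolding M by (rule restrict_ext) (simp add: i module_Ident[OF N x] x)
    fix y assume y: "y \<in> Obj A"
    show "on_hom M x y f \<in> hom (on_obj M x) (on_obj M y) \<inter> extensional (carr M x)" if f: "f \<in> Hom A x y" for f
    proof (intro IntI homI)
      fix a b assume ab: "a \<in> carr M x" "b \<in> carr M x"
      then have ab': "i x a \<in> carr N x" "i x b \<in> carr N x" "r x (i x a) = a" "r x (i x b) = b"
        using i x by (simp_all add: M)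
      show "on_hom M x y f a \<in> carr M y"
        using key[OF x y f ab'(1)] ab' r_in[OF y module_closed[OF N x y f]] by (simp add: M(1))
      have "on_hom M x y f (a \<otimes>\<^bsub>on_obj M x\<^esub> b) = on_hom M x y f (r x (i x a \<otimes>\<^bsub>on_obj N x\<^esub> i x b))"
        using r_mult[OF x] ab' by (simp add: M(1))
      also have "\<dots> = r y (on_hom N x y f (i x a)) \<otimes>\<^bsub>G y\<^esub> r y (on_hom N x y f (i x b))"
        using key[OF x y f] ab' module_mult[OF N x] module_hom_mult[OF N x y f] module_closed[OF N x y f] r_mult[OF y]
        by simp
      also have "\<dots> = on_hom M x y f a \<otimes>\<^bsub>on_obj M y\<^esub> on_hom M x y f b"
        using key[OF x y f ab'(1)] key[OF x y f ab'(2)] ab' by (simp add: M(1))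
      finally show "on_hom M x y f (a \<otimes>\<^bsub>on_obj M x\<^esub> b) = on_hom M x y f a \<otimes>\<^bsub>on_obj M y\<^esub> on_hom M x y f b" .
    qed (simp add: M)
    show "on_hom M x y (Plus A x y f g) = (\<lambda>a\<in>carr M x. on_hom M x y f a \<otimes>\<^bsub>on_obj M y\<^esub> on_hom M x y g a)"
      if "f \<in> Hom A x y" "g \<in> Hom A x y" for f g
      unfolding M by (rule restrict_ext) (use that x y in \<open>simp add: i module_Plus[OF N] r_mult module_closed[OF N]\<close>)
    show "on_hom M x z (Comp A x y z g f) = (\<lambda>a\<in>carr M x. on_hom M y z g (on_hom M x y f a))"
      if z: "z \<in> Obj A" and fg: "f \<in> Hom A x y" "g \<in> Hom A y z" for z f g
    proof -
      have "r z (on_hom N x z (Comp A x y z g f) (i x b)) = on_hom M y z g (on_hom M x y f b)"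
        if b: "b \<in> carrier (G x)" for b
        using key[OF y z fg(2), of "on_hom N x y f (i x b)"] b i[OF x b] module_closed[OF N x y fg(1)]
          module_Comp[OF N x y z fg] by (simp add: M(2)[of x])
      then show ?thesis unfolding M(2)[of x z] M(1) by (rule restrict_ext)
    qed
  qed
  then show thesis using that key M(1) by blast
qed

lemma comm_group_subgroup:
  assumes G: "comm_group G" and H: "subgroup H G" shows "comm_group (G\<lparr>carrier := H\<rparr>)"
proof (rule group.group_comm_groupI)
  show "group (G\<lparr>carrier := H\<rparr>)"
    by (rule subgroup.subgroup_is_group[OF H comm_group.axioms(2)[OF G]])
qed (use comm_groupE(4)[OF G] subgroup.mem_carrier[OF H] in auto)

definition submodule :: "('o, 'm, 'u) amod \<Rightarrow> ('o \<Rightarrow> 'u set) \<Rightarrow> ('o, 'm, 'u) amod" where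
  "submodule N T = \<lparr>on_obj = (\<lambda>x. (on_obj N x)\<lparr>carrier := T x\<rparr>),
     on_hom = (\<lambda>x y f. \<lambda>a\<in>T x. on_hom N x y f a)\<rparr>"

lemma submodule_simps [simp]:
  "on_obj (submodule N T) x = (on_obj N x)\<lparr>carrier := T x\<rparr>"
  "on_hom (submodule N T) x y f = (\<lambda>a\<in>T x. on_hom N x y f a)"
  by (simp_all add: submodule_def)

lemma is_module_submodule:
  assumes N: "is_module U A N"
    and T: "\<And>x. x \<in> Obj A \<Longrightarrow> subgroup (T x) (on_obj N x)" "\<And>x. x \<in> Obj A \<Longrightarrow> T x \<in> U"
    and stable: "\<And>x y f a. \<lbrakk>x \<in> Obj A; y \<in> Obj A; f \<in> Hom A x y; a \<in> T x\<rbrakk> \<Longrightarrow> on_hom N x y f a \<in> T y"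
  shows "is_module U A (submodule N T)"
proof -
  have sub: "a \<in> carr N x" if "x \<in> Obj A" "a \<in> T x" for x a
    by (rule subgroup.mem_carrier[OF T(1)[OF that(1)] that(2)])
  have cg: "comm_group ((on_obj N x)\<lparr>carrier := T x\<rparr>)" if "x \<in> Obj A" for x
    by (rule comm_group_subgroup[OF module_group[OF N that] T(1)[OF that]])
  show ?thesis
    unfolding is_module_def submodule_simps
    by (auto simp: cg T(2) hom_def stable sub module_hom_mult[OF N] module_Ident[OF N] module_Comp[OF N]
        module_Plus[OF N] subgroup.m_closed[OF T(1)] intro!: restrict_ext)
qed

section \<open>Products over arbitrary index sets and their small submodules\<close>

definition product_module :: "'k set \<Rightarrow> ('k \<Rightarrow> ('o, 'm, 'u) amod) \<Rightarrow> ('o, 'm, 'k \<Rightarrow> 'u) amod" where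
  "product_module K Y = \<lparr>on_obj = (\<lambda>x. product_group K (\<lambda>k. on_obj (Y k) x)),
     on_hom = (\<lambda>x y f. \<lambda>s\<in>(\<Pi>\<^sub>E k\<in>K. carr (Y k) x). \<lambda>k\<in>K. on_hom (Y k) x y f (s k))\<rparr>"

lemma product_module_simps [simp]:
  "on_obj (product_module K Y) x = product_group K (\<lambda>k. on_obj (Y k) x)"
  "on_hom (product_module K Y) x y f = (\<lambda>s\<in>(\<Pi>\<^sub>E k\<in>K. carr (Y k) x). \<lambda>k\<in>K. on_hom (Y k) x y f (s k))"
  by (simp_all add: product_module_def)

lemma comm_product_group:
  assumes "\<And>k. k \<in> K \<Longrightarrow> comm_group (G k)" shows "comm_group (product_group K G)"
proof (rule group.group_comm_groupI)
  show "group (product_group K G)" by (intro product_group comm_group.axioms(2) assms)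
  fix a b assume "a \<in> carrier (product_group K G)" "b \<in> carrier (product_group K G)"
  then show "a \<otimes>\<^bsub>product_group K G\<^esub> b = b \<otimes>\<^bsub>product_group K G\<^esub> a"
    by (auto intro!: restrict_ext comm_groupE(4)[OF assms])
qed

text \<open>Relative to \<open>UNIV\<close> only: \<open>K\<close> may be a set of all cocones or of
  all maps into a class, and then the product need not be small.\<close>

lemma is_module_product:
  assumes Y: "\<And>k. k \<in> K \<Longrightarrow> is_module U A (Y k)"
  shows "is_module UNIV A (product_module K Y)"
proof -
  have cg: "comm_group (product_group K (\<lambda>k. on_obj (Y k) x))" if "x \<in> Obj A" for x
    using module_group[OF Y that] by (rule comm_product_group)
  show ?thesis
    unfolding is_module_def
  proof (intro conjI ballI)
    fix x assume x: "x \<in> Obj A"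
    show "comm_group (on_obj (product_module K Y) x)" using cg x by simp
    show "on_hom (product_module K Y) x x (Ident A x) = (\<lambda>a\<in>carr (product_module K Y) x. a)"
      using module_Ident[OF Y x]
      by (auto intro!: restrict_ext simp: PiE_iff extensional_def restrict_def fun_eq_iff)
    fix y assume y: "y \<in> Obj A"
    show "on_hom (product_module K Y) x y f
        \<in> hom (on_obj (product_module K Y) x) (on_obj (product_module K Y) y) \<inter> extensional (carr (product_module K Y) x)"
      if f: "f \<in> Hom A x y" for f
    proof (intro IntI homI)
      fix s t assume "s \<in> carr (product_module K Y) x" "t \<in> carr (product_module K Y) x"
      then show "on_hom (product_module K Y) x y f s \<in> carr (product_module K Y) y"
        "on_hom (product_module K Y) x y f (s \<otimes>\<^bsub>on_obj (product_module K Y) x\<^esub> t) =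
          on_hom (product_module K Y) x y f s \<otimes>\<^bsub>on_obj (product_module K Y) y\<^esub> on_hom (product_module K Y) x y f t"
        using module_closed[OF Y x y f] module_hom_mult[OF Y x y f] module_mult[OF Y x]
        by (auto simp: PiE_iff intro!: restrict_ext)
    qed simp
    show "on_hom (product_module K Y) x y (Plus A x y f g) = (\<lambda>a\<in>carr (product_module K Y) x.
        on_hom (product_module K Y) x y f a \<otimes>\<^bsub>on_obj (product_module K Y) y\<^esub> on_hom (product_module K Y) x y g a)"
      if "f \<in> Hom A x y" "g \<in> Hom A x y" for f g
      using module_Plus[OF Y x y that] by (auto intro!: restrict_ext simp: PiE_iff)
    show "on_hom (product_module K Y) x z (Comp A x y z g f) =
        (\<lambda>a\<in>carr (product_module K Y) x. on_hom (product_module K Y) y z g (on_hom (product_module K Y) x y f a))"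
      if "z \<in> Obj A" "f \<in> Hom A x y" "g \<in> Hom A y z" for z f g
      using module_Comp[OF Y x y that] module_closed[OF Y x y that(2)]
      by (auto intro!: restrict_ext simp: PiE_iff)
  qed simp
qed

text \<open>A copy of the submodule \<open>S\<close> of the product of the \<open>Y k\<close>,
  remembered through its projections alone: they are jointly injective and their joint values are
  exactly the elements of \<open>S\<close>. The product itself, which lives on another type, no
  longer occurs.\<close>

definition subproduct ::
  "('o, 'm) preadd \<Rightarrow> 'k set \<Rightarrow> ('k \<Rightarrow> ('o, 'm, 'u) amod) \<Rightarrow> ('o \<Rightarrow> ('k \<Rightarrow> 'u) set) \<Rightarrow>
   ('o, 'm, 'u) amod \<Rightarrow> ('k \<Rightarrow> 'o \<Rightarrow> 'u \<Rightarrow> 'u) \<Rightarrow> bool" where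
  "subproduct A K Y S M p \<longleftrightarrow>
     (\<forall>k\<in>K. nat_trans A M (Y k) (p k)) \<and>
     (\<forall>x\<in>Obj A. bij_betw (\<lambda>m. \<lambda>k\<in>K. p k x m) (carr M x) (S x))"

text \<open>Only \<open>S\<close> has to be small, not the product around it. \<open>S\<close> is
  cut out of the large product, each value is copied to \<open>'u\<close>, and the action is carried
  over by \<open>module_image\<close>.\<close>

lemma subproduct_exists:
  fixes U :: "'u set set" and K :: "'k set" and Y :: "'k \<Rightarrow> ('o, 'm, 'u) amod"
  assumes U: "universe U" and Y: "\<And>k. k \<in> K \<Longrightarrow> is_module U A (Y k)"
    and S: "\<And>x. x \<in> Obj A \<Longrightarrow> subgroup (S x) (product_group K (\<lambda>k. on_obj (Y k) x))"
      "\<And>x. x \<in> Obj A \<Longrightarrow> small_set U (S x)"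
    and stable: "\<And>x y f s. \<lbrakk>x \<in> Obj A; y \<in> Obj A; f \<in> Hom A x y; s \<in> S x\<rbrakk> \<Longrightarrow>
      (\<lambda>k\<in>K. on_hom (Y k) x y f (s k)) \<in> S y"
  obtains M p where "is_module U A M" "subproduct A K Y S M p"
proof -
  define N where "N = submodule (product_module K Y) S"
  have sub: "S x \<subseteq> (\<Pi>\<^sub>E k\<in>K. carr (Y k) x)" if "x \<in> Obj A" for x
    using subgroup.subset[OF S(1)[OF that]] by simp
  have N: "is_module UNIV A N"
    unfolding N_def
    by (rule is_module_submodule[OF is_module_product[OF Y]]) (use S stable sub in \<open>simp_all add: subset_iff\<close>)
  have carrN: "carr N x = S x" for x by (simp add: N_def)
  have "\<exists>(H :: 'u monoid) \<phi>. comm_group H \<and> carrier H \<in> U \<and> \<phi> \<in> iso (on_obj N x) H" if "x \<in> Obj A" for x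
    by (rule small_group_copy[OF U]) (use that S in \<open>simp_all add: module_group[OF N] carrN\<close>)
  then obtain G :: "'o \<Rightarrow> 'u monoid" and \<phi> where
    G: "\<And>x. x \<in> Obj A \<Longrightarrow> comm_group (G x) \<and> carrier (G x) \<in> U" and
    \<phi>: "\<And>x. x \<in> Obj A \<Longrightarrow> \<phi> x \<in> iso (on_obj N x) (G x)" by metis
  have bij: "bij_betw (\<phi> x) (S x) (carrier (G x))" if "x \<in> Obj A" for x
    using \<phi>[OF that] by (simp add: iso_def carrN)
  have hom: "\<phi> x \<in> hom (on_obj N x) (G x)" if "x \<in> Obj A" for x using \<phi>[OF that] by (simp add: iso_def)
  obtain M where M: "is_module U A M" "on_obj M = G" and
    M_hom: "\<And>x y f a. \<lbrakk>x \<in> Obj A; y \<in> Obj A; f \<in> Hom A x y; a \<in> carr N x\<rbrakk> \<Longrightarrow>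
      on_hom M x y f (\<phi> x a) = \<phi> y (on_hom N x y f a)"
  proof (rule module_image[OF N G])
    show "\<phi> x \<in> hom (on_obj N x) (G x) \<and> \<phi> x ` carr N x = carrier (G x)" if "x \<in> Obj A" for x
      using hom[OF that] bij[OF that] by (simp add: carrN bij_betw_def)
    show "\<phi> y (on_hom N x y f a) = \<one>\<^bsub>G y\<^esub>"
      if xy: "x \<in> Obj A" "y \<in> Obj A" "f \<in> Hom A x y" and a: "a \<in> carr N x" "\<phi> x a = \<one>\<^bsub>G x\<^esub>" for x y f a
    proof -
      have one: "\<phi> z \<one>\<^bsub>on_obj N z\<^esub> = \<one>\<^bsub>G z\<^esub>" if "z \<in> Obj A" for z
        using hom_one[OF hom[OF that] module_group'[OF N that]] G[OF that] comm_group.axioms(2) by auto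
      have "a = \<one>\<^bsub>on_obj N x\<^esub>"
        using bij[OF xy(1)] a one[OF xy(1)] module_one[OF N xy(1)] unfolding bij_betw_def inj_on_def carrN by metis
      then show ?thesis using module_hom_one[OF N xy] one[OF xy(2)] by simp
    qed
  qed auto
  \<comment> \<open>The projections are the coordinates of the element of \<open>S\<close> that
    corresponds to \<open>m\<close>.\<close>
  define p where "p k = (\<lambda>x\<in>Obj A. \<lambda>m\<in>carr M x. inv_into (S x) (\<phi> x) m k)" for k
  have p: "p k x (\<phi> x s) = s k" if "x \<in> Obj A" "s \<in> S x" for k x s
    using that bij[OF that(1)] M(2) unfolding p_def bij_betw_def by auto
  have surj: "\<exists>s\<in>S x. m = \<phi> x s" if "x \<in> Obj A" "m \<in> carr M x" for x m
    using that bij[OF that(1)] M(2) unfolding bij_betw_def by auto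
  have \<phi>_mult: "\<phi> x s \<otimes>\<^bsub>on_obj M x\<^esub> \<phi> x t = \<phi> x (\<lambda>k\<in>K. s k \<otimes>\<^bsub>on_obj (Y k) x\<^esub> t k)"
    and mult_S: "(\<lambda>k\<in>K. s k \<otimes>\<^bsub>on_obj (Y k) x\<^esub> t k) \<in> S x"
    if "x \<in> Obj A" "s \<in> S x" "t \<in> S x" for x s t
    using hom_mult[OF hom[OF that(1)], of s t] that subgroup.m_closed[OF S(1)[OF that(1)], of s t]
    by (simp_all add: M(2) carrN, simp_all add: N_def)
  have \<phi>_hom: "on_hom M x y f (\<phi> x s) = \<phi> y (\<lambda>k\<in>K. on_hom (Y k) x y f (s k))"
    if "x \<in> Obj A" "y \<in> Obj A" "f \<in> Hom A x y" "s \<in> S x" for x y f s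
    using M_hom[OF that(1-3), of s] that(4) sub[OF that(1)] by (auto simp: carrN, simp add: N_def subset_iff)
  have "subproduct A K Y S M p"
    unfolding subproduct_def
  proof (intro conjI ballI)
    fix k assume k: "k \<in> K"
    show "nat_trans A M (Y k) (p k)"
      unfolding p_def
    proof (rule nat_transI[OF M(1)], goal_cases)
      case (1 x a)
      then show ?case using surj sub k p unfolding p_def by (smt (verit) PiE_mem restrict_apply' subsetD)
    next
      case (2 x a b)
      then obtain s t where st: "s \<in> S x" "t \<in> S x" "a = \<phi> x s" "b = \<phi> x t" using surj by metis
      then show ?case
        using p[OF 2(1) st(1), of k] p[OF 2(1) st(2), of k] p[OF 2(1) mult_S[OF 2(1) st(1,2)], of k]
          \<phi>_mult[OF 2(1) st(1,2)] 2 k module_mult[OF M(1) 2] unfolding p_def by simp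
    next
      case (3 x y f a)
      then obtain s where s: "s \<in> S x" "a = \<phi> x s" using surj by metis
      then show ?case
        using p[OF 3(1) s(1), of k] p[OF 3(2) stable[OF 3(1-3) s(1)], of k] \<phi>_hom[OF 3(1-3) s(1)] 3 k
          module_closed[OF M(1) 3] unfolding p_def by simp
    qed
  next
    fix x assume x: "x \<in> Obj A"
    have ext: "(\<lambda>k\<in>K. s k) = s" if "s \<in> S x" for s
      using that sub[OF x] by (meson PiE_restrict subsetD)
    have "(\<lambda>m. \<lambda>k\<in>K. p k x m) ` carr M x = S x"
    proof -
      have "(\<lambda>m. \<lambda>k\<in>K. p k x m) ` carr M x = (\<lambda>m. \<lambda>k\<in>K. p k x m) ` \<phi> x ` S x"
        using bij[OF x] M(2) by (simp add: bij_betw_def)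
      also have "\<dots> = (\<lambda>s. s) ` S x"
        unfolding image_image by (rule image_cong) (simp_all add: p[OF x] ext)
      finally show ?thesis by simp
    qed
    moreover have "inj_on (\<lambda>m. \<lambda>k\<in>K. p k x m) (carr M x)"
    proof (rule inj_onI)
      fix m n assume mn: "m \<in> carr M x" "n \<in> carr M x" "(\<lambda>k\<in>K. p k x m) = (\<lambda>k\<in>K. p k x n)"
      then obtain s t where st: "s \<in> S x" "t \<in> S x" "m = \<phi> x s" "n = \<phi> x t" using surj x by metis
      then show "m = n" using mn(3) by (simp add: p[OF x] ext)
    qed
    ultimately show "bij_betw (\<lambda>m. \<lambda>k\<in>K. p k x m) (carr M x) (S x)" by (simp add: bij_betw_def)
  qed
  then show thesis using that M(1) by blast
qed

context
  fixes A :: "('o, 'm) preadd" and K Y S M p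
  assumes sp: "subproduct A K Y S M p"
begin

lemma subproduct_nat_trans: "k \<in> K \<Longrightarrow> nat_trans A M (Y k) (p k)"
  using sp unfolding subproduct_def by blast

lemma subproduct_in: "x \<in> Obj A \<Longrightarrow> m \<in> carr M x \<Longrightarrow> (\<lambda>k\<in>K. p k x m) \<in> S x"
  using sp unfolding subproduct_def bij_betw_def by blast

lemma subproduct_eqI:
  assumes "x \<in> Obj A" "m \<in> carr M x" "n \<in> carr M x" "\<And>k. k \<in> K \<Longrightarrow> p k x m = p k x n"
  shows "m = n"
proof -
  have "(\<lambda>k\<in>K. p k x m) = (\<lambda>k\<in>K. p k x n)" using assms(4) by (rule restrict_ext)
  then show ?thesis using sp assms(1-3) unfolding subproduct_def bij_betw_def inj_on_def by blast
qed

lemma subproduct_element: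
  assumes "x \<in> Obj A" "(\<lambda>k\<in>K. s k) \<in> S x"
  obtains m where "m \<in> carr M x" "\<And>k. k \<in> K \<Longrightarrow> p k x m = s k"
proof -
  have "(\<lambda>k\<in>K. s k) \<in> (\<lambda>m. \<lambda>k\<in>K. p k x m) ` carr M x"
    using sp assms unfolding subproduct_def bij_betw_def by blast
  then obtain m where "m \<in> carr M x" "(\<lambda>k\<in>K. s k) = (\<lambda>k\<in>K. p k x m)" by blast
  then show thesis using that by (metis restrict_apply')
qed

text \<open>The values of \<open>u\<close> are forced by joint injectivity, and the same injectivity
  gives additivity and naturality coordinate by coordinate.\<close>

lemma subproduct_universal:
  assumes M: "is_module U A M" and Y: "\<And>k. k \<in> K \<Longrightarrow> is_module U A (Y k)" and W: "is_module U A W"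
    and q: "\<And>k. k \<in> K \<Longrightarrow> nat_trans A W (Y k) (q k)"
    and S: "\<And>x a. x \<in> Obj A \<Longrightarrow> a \<in> carr W x \<Longrightarrow> (\<lambda>k\<in>K. q k x a) \<in> S x"
  obtains u where "nat_trans A W M u"
    "\<And>k x a. \<lbrakk>k \<in> K; x \<in> Obj A; a \<in> carr W x\<rbrakk> \<Longrightarrow> p k x (u x a) = q k x a"
proof -
  have "\<exists>m. m \<in> carr M x \<and> (\<forall>k\<in>K. p k x m = q k x a)" if "x \<in> Obj A" "a \<in> carr W x" for x a
    by (rule subproduct_element[OF that(1) S[OF that]]) blast
  then obtain u where u: "\<And>x a. \<lbrakk>x \<in> Obj A; a \<in> carr W x\<rbrakk> \<Longrightarrow> u x a \<in> carr M x"
    and pu: "\<And>k x a. \<lbrakk>k \<in> K; x \<in> Obj A; a \<in> carr W x\<rbrakk> \<Longrightarrow> p k x (u x a) = q k x a" by metis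
  let ?u = "\<lambda>x\<in>Obj A. \<lambda>a\<in>carr W x. u x a"
  have "nat_trans A W M ?u"
  proof (rule nat_transI[OF W])
    show "u x a \<in> carr M x" if "x \<in> Obj A" "a \<in> carr W x" for x a using u that .
    show "u x (a \<otimes>\<^bsub>on_obj W x\<^esub> b) = u x a \<otimes>\<^bsub>on_obj M x\<^esub> u x b"
      if x: "x \<in> Obj A" and ab: "a \<in> carr W x" "b \<in> carr W x" for x a b
    proof (rule subproduct_eqI[OF x])
      show "u x (a \<otimes>\<^bsub>on_obj W x\<^esub> b) \<in> carr M x" "u x a \<otimes>\<^bsub>on_obj M x\<^esub> u x b \<in> carr M x"
        using u[OF x] ab module_mult[OF W x ab] module_mult[OF M x] by blast+
      fix k assume k: "k \<in> K"
      show "p k x (u x (a \<otimes>\<^bsub>on_obj W x\<^esub> b)) = p k x (u x a \<otimes>\<^bsub>on_obj M x\<^esub> u x b)"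
        using nat_trans_mult[OF q[OF k] x ab] nat_trans_mult[OF subproduct_nat_trans[OF k] x u[OF x ab(1)] u[OF x ab(2)]]
          pu[OF k x ab(1)] pu[OF k x ab(2)] pu[OF k x module_mult[OF W x ab]] by simp
    qed
    show "u y (on_hom W x y f a) = on_hom M x y f (u x a)"
      if xy: "x \<in> Obj A" "y \<in> Obj A" "f \<in> Hom A x y" and a: "a \<in> carr W x" for x y f a
    proof (rule subproduct_eqI[OF xy(2)])
      show "u y (on_hom W x y f a) \<in> carr M y" "on_hom M x y f (u x a) \<in> carr M y"
        using u xy a module_closed[OF W xy a] module_closed[OF M xy] by blast+
      fix k assume k: "k \<in> K"
      show "p k y (u y (on_hom W x y f a)) = p k y (on_hom M x y f (u x a))"
        using nat_trans_natural[OF q[OF k] xy a] nat_trans_natural[OF subproduct_nat_trans[OF k] xy u[OF xy(1) a]]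
          pu[OF k xy(1) a] pu[OF k xy(2) module_closed[OF W xy a]] by simp
    qed
  qed
  then show thesis using that[of ?u] pu by simp
qed

end

section \<open>Classes of modules closed under subobjects of products\<close>

text \<open>
  The product of all maps from \<open>M\<close> to modules in \<open>P\<close> need not exist for reasons of size; only the
  joint injectivity of these maps is required.
\<close>

locale cogenerated_class =
  fixes U :: "'u set set" and A :: "('o, 'm) preadd" and P :: "('o, 'm, 'u) amod \<Rightarrow> bool"
  assumes U: "universe U"
    and cogenerated: "\<lbrakk>is_module U A M;
      \<And>x a. \<lbrakk>x \<in> Obj A; a \<in> carr M x; a \<noteq> \<one>\<^bsub>on_obj M x\<^esub>\<rbrakk> \<Longrightarrow>
        \<exists>Y t. is_module U A Y \<and> P Y \<and> nat_trans A M Y t \<and> t x a \<noteq> \<one>\<^bsub>on_obj Y x\<^esub>\<rbrakk> \<Longrightarrow> P M"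
begin

abbreviation "\<C> \<equiv> full_subcategory (Mod_category U A) P"

lemma C_simps [simp]:
  "M \<in> Obj \<C> \<longleftrightarrow> is_module U A M \<and> P M"
  "t \<in> Hom \<C> M N \<longleftrightarrow> nat_trans A M N t"
  "Ident \<C> M = (\<lambda>x\<in>Obj A. \<lambda>a\<in>carr M x. a)"
  by (simp_all add: full_subcategory_def Mod_category_simps)

lemma Comp_C: "Comp \<C> L M N t s = (\<lambda>x\<in>Obj A. \<lambda>a\<in>carr L x. t x (s x a))"
  by (simp add: full_subcategory_def Mod_category_simps)

lemma Comp_apply [simp]: "x \<in> Obj A \<Longrightarrow> a \<in> carr L x \<Longrightarrow> Comp \<C> L M N t s x a = t x (s x a)"
  by (simp add: Comp_C)

lemma nat_trans_Comp_C:
  "\<lbrakk>is_module U A L; nat_trans A L M s; nat_trans A M N t\<rbrakk> \<Longrightarrow> nat_trans A L N (Comp \<C> L M N t s)"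
  unfolding Comp_C by (rule nat_trans_Comp)

lemma Comp_eq_iff:
  assumes "nat_trans A L N r"
  shows "Comp \<C> L M N t s = r \<longleftrightarrow> (\<forall>x\<in>Obj A. \<forall>a\<in>carr L x. t x (s x a) = r x a)"
proof
  assume eq: "\<forall>x\<in>Obj A. \<forall>a\<in>carr L x. t x (s x a) = r x a"
  show "Comp \<C> L M N t s = r"
  proof (rule extensionalityI)
    show "r \<in> extensional (Obj A)" using assms unfolding nat_trans_def by blast
    fix x assume x: "x \<in> Obj A"
    then show "Comp \<C> L M N t s x = r x"
      using assms eq unfolding nat_trans_def Comp_C by (auto intro!: extensionalityI[of _ "carr L x"])
  qed (simp add: Comp_C)
qed auto

lemma Comp_eq_Comp_iff:
  "Comp \<C> L M N t s = Comp \<C> L M' N' t' s' \<longleftrightarrow> (\<forall>x\<in>Obj A. \<forall>a\<in>carr L x. t x (s x a) = t' x (s' x a))"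
proof
  assume eq: "Comp \<C> L M N t s = Comp \<C> L M' N' t' s'"
  show "\<forall>x\<in>Obj A. \<forall>a\<in>carr L x. t x (s x a) = t' x (s' x a)"
    using eq Comp_apply by metis
qed (auto simp: Comp_C intro!: restrict_ext)

lemma category: "category \<C>"
  by unfold_locales
    (simp_all add: nat_trans_Ident[of U] Comp_eq_iff Comp_eq_Comp_iff nat_trans_closed nat_trans_Comp_C)

text \<open>A nontrivial element differs from the unit in some coordinate, so the projections are
  the maps that the closure condition asks for.\<close>

lemma cogenerated_subproduct:
  assumes M: "is_module U A M" and sp: "subproduct A K Y S M p"
    and Y: "\<And>k. k \<in> K \<Longrightarrow> is_module U A (Y k) \<and> P (Y k)"
  shows "P M"
proof (rule cogenerated[OF M])
  fix x a assume x: "x \<in> Obj A" and a: "a \<in> carr M x" "a \<noteq> \<one>\<^bsub>on_obj M x\<^esub>"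
  then obtain k where k: "k \<in> K" "p k x a \<noteq> p k x \<one>\<^bsub>on_obj M x\<^esub>"
    using subproduct_eqI[OF sp x a(1) module_one[OF M x]] by blast
  have "p k x \<one>\<^bsub>on_obj M x\<^esub> = \<one>\<^bsub>on_obj (Y k) x\<^esub>"
    using Y k(1) M x by (intro nat_trans_one[OF subproduct_nat_trans[OF sp]]) auto
  then show "\<exists>Y t. is_module U A Y \<and> P Y \<and> nat_trans A M Y t \<and> t x a \<noteq> \<one>\<^bsub>on_obj Y x\<^esub>"
    using Y k subproduct_nat_trans[OF sp k(1)] by (intro exI[of _ "Y k"] exI[of _ "p k"]) simp
qed

text \<open>The inclusion alone detects all nontrivial elements.\<close>

lemma submodule_in:
  assumes N: "is_module U A N" "P N"
    and T: "\<And>x. x \<in> Obj A \<Longrightarrow> subgroup (T x) (on_obj N x)"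
    and stable: "\<And>x y f a. \<lbrakk>x \<in> Obj A; y \<in> Obj A; f \<in> Hom A x y; a \<in> T x\<rbrakk> \<Longrightarrow> on_hom N x y f a \<in> T y"
  shows "is_module U A (submodule N T)" "P (submodule N T)"
    "nat_trans A (submodule N T) N (\<lambda>x\<in>Obj A. \<lambda>a\<in>T x. a)"
proof -
  have sub: "T x \<subseteq> carr N x" if "x \<in> Obj A" for x using subgroup.subset[OF T[OF that]] .
  show M: "is_module U A (submodule N T)"
    by (rule is_module_submodule[OF N(1) T _ stable])
      (use sub module_carrier[OF N(1)] universe_subset[OF U] in blast)+
  have "nat_trans A (submodule N T) N (\<lambda>x\<in>Obj A. \<lambda>a\<in>carr (submodule N T) x. a)"
    by (rule nat_transI[OF M]) (use sub in auto)
  then show t: "nat_trans A (submodule N T) N (\<lambda>x\<in>Obj A. \<lambda>a\<in>T x. a)" by simp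
  show "P (submodule N T)"
    by (rule cogenerated[OF M]) (use N t in \<open>auto intro!: exI[of _ N] exI[of _ "\<lambda>x\<in>Obj A. \<lambda>a\<in>T x. a"]\<close>)
qed

lemma nat_trans_image_subgroup:
  assumes t: "nat_trans A M N t" and M: "is_module U A M" and N: "is_module U A N" and x: "x \<in> Obj A"
  shows "subgroup (t x ` carr M x) (on_obj N x)"
  by (rule group_hom.img_is_subgroup, rule group_hom.intro[OF module_group'[OF M x] module_group'[OF N x]],
      rule group_hom_axioms.intro[OF nat_trans_hom[OF t x]])

lemma nat_trans_kernel_subgroup:
  assumes t: "nat_trans A M N t" and M: "is_module U A M" and N: "is_module U A N" and x: "x \<in> Obj A"
  shows "subgroup {a \<in> carr M x. t x a = \<one>\<^bsub>on_obj N x\<^esub>} (on_obj M x)"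
  using group_hom.subgroup_kernel[OF group_hom.intro[OF module_group'[OF M x] module_group'[OF N x]
        group_hom_axioms.intro[OF nat_trans_hom[OF t x]]]]
  unfolding kernel_def .

subsection \<open>Preadditive structure\<close>

definition pre_C :: "(('o, 'm, 'u) amod, 'o \<Rightarrow> 'u \<Rightarrow> 'u) preadd" where
  "pre_C = \<lparr>Obj = Obj \<C>, Hom = Hom \<C>, Ident = Ident \<C>, Comp = Comp \<C>,
     Plus = (\<lambda>M N t s. \<lambda>x\<in>Obj A. \<lambda>a\<in>carr M x. t x a \<otimes>\<^bsub>on_obj N x\<^esub> s x a),
     Zero = (\<lambda>M N. \<lambda>x\<in>Obj A. \<lambda>a\<in>carr M x. \<one>\<^bsub>on_obj N x\<^esub>)\<rparr>"

lemma pre_C_simps: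
  "Obj pre_C = Obj \<C>" "Hom pre_C = Hom \<C>" "Ident pre_C = Ident \<C>" "Comp pre_C = Comp \<C>"
  "Zero pre_C M N = (\<lambda>x\<in>Obj A. \<lambda>a\<in>carr M x. \<one>\<^bsub>on_obj N x\<^esub>)"
  by (simp_all add: pre_C_def)

lemma hom_group_pre_C:
  "hom_group pre_C M N = \<lparr>carrier = {t. nat_trans A M N t},
     mult = (\<lambda>t s. \<lambda>x\<in>Obj A. \<lambda>a\<in>carr M x. t x a \<otimes>\<^bsub>on_obj N x\<^esub> s x a),
     one = (\<lambda>x\<in>Obj A. \<lambda>a\<in>carr M x. \<one>\<^bsub>on_obj N x\<^esub>)\<rparr>"
proof -
  have "Hom \<C> M N = {t. nat_trans A M N t}" by (auto simp del: C_simps(2) simp: C_simps(2)[abs_def])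
  then show ?thesis by (simp add: hom_group_def pre_C_def)
qed

lemma truncate_pre_C: "cat.truncate pre_C = \<C>"
  by (simp add: pre_C_def cat.truncate_def)

lemma nat_trans_mult_trans:
  assumes M: "is_module U A M" and N: "is_module U A N" and t: "nat_trans A M N t" and s: "nat_trans A M N s"
  shows "nat_trans A M N (\<lambda>x\<in>Obj A. \<lambda>a\<in>carr M x. t x a \<otimes>\<^bsub>on_obj N x\<^esub> s x a)"
proof (rule nat_transI[OF M])
  fix x assume x: "x \<in> Obj A"
  interpret comm_group "on_obj N x" by (rule module_group[OF N x])
  note cl = nat_trans_closed[OF t x] nat_trans_closed[OF s x]
  show "t x a \<otimes>\<^bsub>on_obj N x\<^esub> s x a \<in> carr N x" if "a \<in> carr M x" for a using that cl by simp
  show "t x (a \<otimes>\<^bsub>on_obj M x\<^esub> b) \<otimes>\<^bsub>on_obj N x\<^esub> s x (a \<otimes>\<^bsub>on_obj M x\<^esub> b) =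
      t x a \<otimes>\<^bsub>on_obj N x\<^esub> s x a \<otimes>\<^bsub>on_obj N x\<^esub> (t x b \<otimes>\<^bsub>on_obj N x\<^esub> s x b)"
    if "a \<in> carr M x" "b \<in> carr M x" for a b
    using that cl nat_trans_mult[OF t x that] nat_trans_mult[OF s x that] by (simp add: m_ac)
  show "t y (on_hom M x y f a) \<otimes>\<^bsub>on_obj N y\<^esub> s y (on_hom M x y f a) =
      on_hom N x y f (t x a \<otimes>\<^bsub>on_obj N x\<^esub> s x a)"
    if "y \<in> Obj A" "f \<in> Hom A x y" "a \<in> carr M x" for y f a
    using that cl x nat_trans_natural[OF t x that] nat_trans_natural[OF s x that] module_hom_mult[OF N x that(1,2)] by simp
qed

lemma nat_trans_one_trans:
  assumes M: "is_module U A M" and N: "is_module U A N"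
  shows "nat_trans A M N (\<lambda>x\<in>Obj A. \<lambda>a\<in>carr M x. \<one>\<^bsub>on_obj N x\<^esub>)"
  by (rule nat_transI[OF M])
    (simp_all add: module_one[OF N] module_hom_one[OF N] monoid.l_one[OF group.is_monoid[OF module_group'[OF N]]])

lemma nat_trans_inv_trans:
  assumes M: "is_module U A M" and N: "is_module U A N" and t: "nat_trans A M N t"
  shows "nat_trans A M N (\<lambda>x\<in>Obj A. \<lambda>a\<in>carr M x. inv\<^bsub>on_obj N x\<^esub> t x a)"
proof (rule nat_transI[OF M])
  fix x assume x: "x \<in> Obj A"
  interpret comm_group "on_obj N x" by (rule module_group[OF N x])
  note cl = nat_trans_closed[OF t x]
  show "inv\<^bsub>on_obj N x\<^esub> t x a \<in> carr N x" if "a \<in> carr M x" for a using that cl by simp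
  show "inv\<^bsub>on_obj N x\<^esub> t x (a \<otimes>\<^bsub>on_obj M x\<^esub> b) = inv\<^bsub>on_obj N x\<^esub> t x a \<otimes>\<^bsub>on_obj N x\<^esub> inv\<^bsub>on_obj N x\<^esub> t x b"
    if "a \<in> carr M x" "b \<in> carr M x" for a b
    using that cl nat_trans_mult[OF t x that] by (simp add: inv_mult)
  show "inv\<^bsub>on_obj N y\<^esub> t y (on_hom M x y f a) = on_hom N x y f (inv\<^bsub>on_obj N x\<^esub> t x a)"
    if "y \<in> Obj A" "f \<in> Hom A x y" "a \<in> carr M x" for y f a
    using that cl x nat_trans_natural[OF t x that] module_hom_inv[OF N x that(1,2)] by simp
qed

lemma preadditive_pre_C: "preadditive pre_C"
proof (intro preadditive.intro preadditive_axioms.intro)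
  show "category pre_C" using category unfolding category_def pre_C_simps .
next
  fix M N assume "M \<in> Obj pre_C" "N \<in> Obj pre_C"
  then have M: "is_module U A M" and N: "is_module U A N" by (simp_all add: pre_C_simps)
  note G = monoid.m_assoc[OF group.is_monoid[OF module_group'[OF N]]]
    monoid.l_one[OF group.is_monoid[OF module_group'[OF N]]] group.l_inv[OF module_group'[OF N]]
    module_mult[OF N] nat_trans_closed
  show "comm_group (hom_group pre_C M N)"
    unfolding hom_group_pre_C
  proof (rule comm_groupI, goal_cases)
    case (3 t s r)
    then show ?case by (auto simp: G intro!: restrict_ext)
  next
    case (4 t s)
    then show ?case by (auto intro!: restrict_ext comm_groupE(4)[OF module_group[OF N]] simp: nat_trans_closed)
  next
    case (5 t)
    then have t: "nat_trans A M N t" by simp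
    then have "(\<lambda>x\<in>Obj A. \<lambda>a\<in>carr M x. (\<lambda>x\<in>Obj A. \<lambda>a\<in>carr M x. \<one>\<^bsub>on_obj N x\<^esub>) x a \<otimes>\<^bsub>on_obj N x\<^esub> t x a) = t"
      by (intro nat_trans_eqI[OF nat_trans_mult_trans[OF M N nat_trans_one_trans[OF M N] t] t]) (simp add: G)
    then show ?case by simp
  next
    case (6 t)
    then have t: "nat_trans A M N t" by simp
    then have "(\<lambda>x\<in>Obj A. \<lambda>a\<in>carr M x. (\<lambda>x\<in>Obj A. \<lambda>a\<in>carr M x. inv\<^bsub>on_obj N x\<^esub> t x a) x a \<otimes>\<^bsub>on_obj N x\<^esub> t x a) =
        (\<lambda>x\<in>Obj A. \<lambda>a\<in>carr M x. \<one>\<^bsub>on_obj N x\<^esub>)"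
      by (auto simp: G intro!: restrict_ext)
    then show ?case using nat_trans_inv_trans[OF M N t]
      by (intro bexI[of _ "\<lambda>x\<in>Obj A. \<lambda>a\<in>carr M x. inv\<^bsub>on_obj N x\<^esub> t x a"]) simp_all
  qed (simp_all add: nat_trans_mult_trans[OF M N] nat_trans_one_trans[OF M N])
next
  fix L M N t assume "L \<in> Obj pre_C" "M \<in> Obj pre_C" "N \<in> Obj pre_C" "t \<in> Hom pre_C M N"
  then show "(\<lambda>s. Comp pre_C L M N t s) \<in> hom (hom_group pre_C L M) (hom_group pre_C L N)"
    using nat_trans_Comp_C[of L M _ N t]
    by (intro homI) (auto simp: pre_C_simps hom_group_pre_C,
        auto simp: Comp_C nat_trans_closed nat_trans_mult intro!: restrict_ext)
next
  fix L M N s assume "L \<in> Obj pre_C" "M \<in> Obj pre_C" "N \<in> Obj pre_C" "s \<in> Hom pre_C L M"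
  then show "(\<lambda>t. Comp pre_C L M N t s) \<in> hom (hom_group pre_C M N) (hom_group pre_C L N)"
    using nat_trans_Comp_C[of L M s N]
    by (intro homI) (auto simp: pre_C_simps hom_group_pre_C,
        auto simp: Comp_C nat_trans_closed intro!: restrict_ext)
qed

lemma has_preadditive_structure: "has_preadditive_structure \<C>"
  unfolding has_preadditive_structure_def using preadditive_pre_C truncate_pre_C by blast

subsection \<open>Limits and colimits\<close>

text \<open>Limits are formed objectwise as compatible families. These lie in a product over the
  objects of \<open>J\<close>, which is small by the definition of \<open>index_set\<close>.\<close>

lemma complete: "complete_category U \<C>"
  unfolding complete_category_def
proof (intro allI impI, elim conjE)
  fix J :: "('u, 'u) cat" and D :: "('u, 'u, ('o, 'm, 'u) amod, 'o \<Rightarrow> 'u \<Rightarrow> 'u) func"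
  assume J: "small_index_category U J" and D: "is_functor J \<C> D"
  let ?K = "Obj J" and ?Y = "on_obj D"
  have Y: "is_module U A (?Y i) \<and> P (?Y i)" if "i \<in> Obj J" for i
    using D that unfolding is_functor_def by simp
  have Dhom: "nat_trans A (?Y i) (?Y j) (on_hom D i j a)" if "i \<in> Obj J" "j \<in> Obj J" "a \<in> Hom J i j" for i j a
    using D that unfolding is_functor_def by simp
  define S where "S x = {s \<in> \<Pi>\<^sub>E i\<in>?K. carr (?Y i) x.
      \<forall>i\<in>?K. \<forall>j\<in>?K. \<forall>a\<in>Hom J i j. on_hom D i j a x (s i) = s j}" for x
  have S_small: "small_set U (S x)" if x: "x \<in> Obj A" for x
  proof -
    have "small_set U (\<Pi>\<^sub>E i\<in>?K. carr (?Y i) x)"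
      using J Y module_carrier[OF _ x] unfolding small_index_category_def index_set_def
      by (auto dest!: spec[of _ "\<lambda>i. carr (on_obj D i) x"])
    then show ?thesis by (rule small_subset) (auto simp: S_def)
  qed
  have S_sub: "subgroup (S x) (product_group ?K (\<lambda>i. on_obj (?Y i) x))" if x: "x \<in> Obj A" for x
  proof
    note YM = Y[THEN conjunct1]
    note G = module_group'[OF YM x]
    have inv: "inv\<^bsub>product_group ?K (\<lambda>i. on_obj (?Y i) x)\<^esub> s = (\<lambda>i\<in>?K. inv\<^bsub>on_obj (?Y i) x\<^esub> s i)" if "s \<in> S x" for s
      using that by (intro inv_product_group G) (simp_all add: S_def)
    show "\<one>\<^bsub>product_group ?K (\<lambda>i. on_obj (?Y i) x)\<^esub> \<in> S x"
      using nat_trans_one[OF Dhom YM YM x] module_one[OF YM x] by (simp add: S_def)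
    fix s t assume st: "s \<in> S x" "t \<in> S x"
    then show "s \<otimes>\<^bsub>product_group ?K (\<lambda>i. on_obj (?Y i) x)\<^esub> t \<in> S x"
      using nat_trans_mult[OF Dhom x] module_mult[OF YM x] by (auto simp: S_def PiE_iff)
    show "inv\<^bsub>product_group ?K (\<lambda>i. on_obj (?Y i) x)\<^esub> s \<in> S x"
      unfolding inv[OF st(1)] using st(1) nat_trans_inv[OF Dhom YM YM x] module_inv[OF YM x]
      by (auto simp: S_def PiE_iff)
  qed (auto simp: S_def)
  have S_stable: "(\<lambda>i\<in>?K. on_hom (?Y i) x y f (s i)) \<in> S y"
    if xy: "x \<in> Obj A" "y \<in> Obj A" "f \<in> Hom A x y" and s: "s \<in> S x" for x y f s
    using s nat_trans_natural[OF Dhom xy] module_closed[OF Y[THEN conjunct1] xy] by (auto simp: S_def PiE_iff)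
  obtain M p where M: "is_module U A M" and sp: "subproduct A ?K ?Y S M p"
    by (rule subproduct_exists[where A = A and K = ?K and Y = ?Y, OF U _ S_sub S_small S_stable]) (use Y in auto)
  have PM: "P M" by (rule cogenerated_subproduct[OF M sp Y])
  have cone: "is_cone J \<C> D W d \<longleftrightarrow> is_module U A W \<and> P W \<and> (\<forall>i\<in>?K. nat_trans A W (?Y i) (d i)) \<and>
      (\<forall>x\<in>Obj A. \<forall>w\<in>carr W x. (\<lambda>i\<in>?K. d i x w) \<in> S x)" for W d
  proof -
    have "(\<forall>i\<in>?K. \<forall>j\<in>?K. \<forall>a\<in>Hom J i j. Comp \<C> W (?Y i) (?Y j) (on_hom D i j a) (d i) = d j) \<longleftrightarrow>
        (\<forall>x\<in>Obj A. \<forall>w\<in>carr W x. (\<lambda>i\<in>?K. d i x w) \<in> S x)"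
      if d: "\<forall>i\<in>?K. nat_trans A W (?Y i) (d i)"
      using d nat_trans_closed[OF d[rule_format]] unfolding C_simps
      by (auto simp: S_def Comp_eq_iff)
    then show ?thesis unfolding is_cone_def by auto
  qed
  have "is_limit J \<C> D M p"
    unfolding is_limit_def
  proof (intro conjI allI impI)
    show "is_cone J \<C> D M p"
      unfolding cone using M PM subproduct_nat_trans[OF sp] subproduct_in[OF sp] by auto
    fix W d assume Wd: "is_cone J \<C> D W d"
    obtain u where u: "nat_trans A W M u" and pu: "\<And>i x a. \<lbrakk>i \<in> ?K; x \<in> Obj A; a \<in> carr W x\<rbrakk> \<Longrightarrow> p i x (u x a) = d i x a"
      by (rule subproduct_universal[OF sp M _ , of W d]) (use Y Wd in \<open>auto simp: cone\<close>)
    show "\<exists>!u. u \<in> Hom \<C> W M \<and> (\<forall>i\<in>?K. Comp \<C> W M (?Y i) (p i) u = d i)"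
    proof (rule ex1I)
      show "u \<in> Hom \<C> W M \<and> (\<forall>i\<in>?K. Comp \<C> W M (?Y i) (p i) u = d i)"
        using u pu Wd by (auto simp: cone Comp_eq_iff)
      fix v assume v: "v \<in> Hom \<C> W M \<and> (\<forall>i\<in>?K. Comp \<C> W M (?Y i) (p i) v = d i)"
      then have pv: "p i x (v x a) = d i x a" if "i \<in> ?K" "x \<in> Obj A" "a \<in> carr W x" for i x a
        using that Wd by (auto simp: cone Comp_eq_iff)
      have v: "nat_trans A W M v" using v by simp
      show "v = u"
      proof (rule nat_trans_eqI[OF v u])
        fix x a assume x: "x \<in> Obj A" and a: "a \<in> carr W x"
        show "v x a = u x a"
          using pu[OF _ x a] pv[OF _ x a]
          by (intro subproduct_eqI[OF sp x nat_trans_closed[OF v x a] nat_trans_closed[OF u x a]]) simp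
      qed
    qed
  qed
  then show "\<exists>x c. is_limit J \<C> D x c" by blast
qed

text \<open>
  The colimit is the submodule generated by the diagram in the product of all cocones.  It is small,
  although this product is not, and belongs to \<open>P\<close> because the projections are jointly injective.
\<close>

lemma cocomplete: "cocomplete_category U \<C>"
  unfolding cocomplete_category_def complete_category_def
proof (intro allI impI, elim conjE)
  fix J :: "('u, 'u) cat" and D :: "('u, 'u, ('o, 'm, 'u) amod, 'o \<Rightarrow> 'u \<Rightarrow> 'u) func"
  assume J: "small_index_category U J" and D: "is_functor J (dual \<C>) D"
  \<comment> \<open>All cocones under the diagram, each a pair of a vertex and its legs. They form a
    set in HOL, but usually not a small one.\<close>
  define K where "K = {k. is_cone J (dual \<C>) D (fst k) (snd k)}"
  have D_mod: "is_module U A (on_obj D i)" "P (on_obj D i)" if "i \<in> Obj J" for i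
    using D that unfolding is_functor_def by auto
  \<comment> \<open>\<open>D\<close> takes values in the dual category, so an arrow from
    \<open>i\<close> to \<open>j\<close> acts from the value at \<open>j\<close> to the value at
    \<open>i\<close>.\<close>
  have Dhom: "nat_trans A (on_obj D j) (on_obj D i) (on_hom D i j a)" if "i \<in> Obj J" "j \<in> Obj J" "a \<in> Hom J i j" for i j a
    using D that unfolding is_functor_def by simp
  have cone: "is_cone J (dual \<C>) D W d \<longleftrightarrow> is_module U A W \<and> P W \<and>
      (\<forall>i\<in>Obj J. nat_trans A (on_obj D i) W (d i)) \<and>
      (\<forall>i\<in>Obj J. \<forall>j\<in>Obj J. \<forall>a\<in>Hom J i j. \<forall>x\<in>Obj A. \<forall>m\<in>carr (on_obj D j) x.
        d i x (on_hom D i j a x m) = d j x m)" for W d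
    unfolding is_cone_def by (auto simp: Comp_eq_iff)
  have K: "k \<in> K \<longleftrightarrow> is_cone J (dual \<C>) D (fst k) (snd k)" for k by (simp add: K_def)
  have Y: "is_module U A (fst k) \<and> P (fst k)" if "k \<in> K" for k
    using that by (simp add: K cone)
  have K_hom: "nat_trans A (on_obj D i) (fst k) (snd k i)" if "k \<in> K" "i \<in> Obj J" for k i
    using that by (simp add: K cone)
  define B where "B x = product_group K (\<lambda>k. on_obj (fst k) x)" for x
  \<comment> \<open>Each element of a module in the diagram gives one generator: the family of its
    images under all cocones.\<close>
  define T where "T x = (\<Union>i\<in>Obj J. (\<lambda>m. \<lambda>k\<in>K. snd k i x m) ` carr (on_obj D i) x)" for x
  have T_sub: "T x \<subseteq> carrier (B x)" if "x \<in> Obj A" for x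
    using that nat_trans_closed[OF K_hom] by (auto simp: T_def B_def)
  have B_group: "group (B x)" if "x \<in> Obj A" for x
    unfolding B_def by (intro product_group module_group'[OF Y[THEN conjunct1] that])
  have T_small: "small_set U (T x)" if x: "x \<in> Obj A" for x
    unfolding T_def
  proof (rule small_UN[OF U])
    show "small_set U (Obj J)" using J index_set_small[OF U] unfolding small_index_category_def by blast
    show "small_set U ((\<lambda>m. \<lambda>k\<in>K. snd k i x m) ` carr (on_obj D i) x)" if "i \<in> Obj J" for i
      by (intro small_image small_member module_carrier[OF D_mod(1)[OF that] x])
  qed
  have stable: "(\<lambda>k\<in>K. on_hom (fst k) x y f (s k)) \<in> generate (B y) (T y)"
    if xy: "x \<in> Obj A" "y \<in> Obj A" "f \<in> Hom A x y" and s: "s \<in> generate (B x) (T x)" for x y f s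
  proof -
    let ?h = "\<lambda>s. \<lambda>k\<in>K. on_hom (fst k) x y f (s k)"
    have h: "group_hom (B x) (B y) ?h"
    proof (intro group_hom.intro group_hom_axioms.intro homI B_group xy)
      fix s t assume "s \<in> carrier (B x)" "t \<in> carrier (B x)"
      then have st: "s k \<in> carr (fst k) x" "t k \<in> carr (fst k) x" if "k \<in> K" for k
        using that by (auto simp: B_def)
      show "?h s \<in> carrier (B y)"
        unfolding B_def carrier_product_group
        by (intro restrict_PiE_iff[THEN iffD2] ballI module_closed[OF Y[THEN conjunct1] xy] st)
      show "?h (s \<otimes>\<^bsub>B x\<^esub> t) = ?h s \<otimes>\<^bsub>B y\<^esub> ?h t"
        unfolding B_def mult_product_group
        using module_hom_mult[OF Y[THEN conjunct1] xy st(1) st(2)]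
        by (intro restrict_ext) simp
    qed
    have "?h ` T x \<subseteq> T y"
    proof
      fix s assume "s \<in> ?h ` T x"
      then obtain i m where i: "i \<in> Obj J" "m \<in> carr (on_obj D i) x" "s = ?h (\<lambda>k\<in>K. snd k i x m)"
        by (auto simp: T_def)
      have "s = (\<lambda>k\<in>K. snd k i y (on_hom (on_obj D i) x y f m))"
        unfolding i(3) using nat_trans_natural[OF K_hom xy i(2)] i(1) by (intro restrict_ext) simp
      then show "s \<in> T y"
        unfolding T_def using i module_closed[OF D_mod(1) xy] by blast
    qed
    then have "generate (B y) (?h ` T x) \<subseteq> generate (B y) (T y)"
      using group.mono_generate B_group xy by blast
    then show ?thesis
      using group_hom.generate_img[OF h T_sub[OF xy(1)]] s by blast
  qed
  obtain M p where M: "is_module U A M" and sp: "subproduct A K fst (\<lambda>x. generate (B x) (T x)) M p"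
  proof (rule subproduct_exists[where A = A and K = K and Y = fst and S = "\<lambda>x. generate (B x) (T x)", OF U])
    show "subgroup (generate (B x) (T x)) (product_group K (\<lambda>k. on_obj (fst k) x))" if "x \<in> Obj A" for x
      using group.generate_is_subgroup[OF B_group T_sub] that unfolding B_def by blast
    show "small_set U (generate (B x) (T x))" if "x \<in> Obj A" for x
      by (rule small_generate[OF U T_small[OF that]])
  qed (use Y stable in auto)
  have PM: "P M" by (rule cogenerated_subproduct[OF M sp Y])
  have "\<exists>c. nat_trans A (on_obj D i) M c \<and>
      (\<forall>k\<in>K. \<forall>x\<in>Obj A. \<forall>a\<in>carr (on_obj D i) x. p k x (c x a) = snd k i x a)" if i: "i \<in> Obj J" for i
  proof (rule subproduct_universal[OF sp M _ D_mod(1)[OF i], of "\<lambda>k. snd k i"])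
    show "(\<lambda>k\<in>K. snd k i x a) \<in> generate (B x) (T x)" if "x \<in> Obj A" "a \<in> carr (on_obj D i) x" for x a
      by (rule generate.incl) (use i that in \<open>auto simp: T_def\<close>)
  qed (use Y K_hom i in auto)
  then obtain c where c: "\<And>i. i \<in> Obj J \<Longrightarrow> nat_trans A (on_obj D i) M (c i)"
    and pc: "\<And>i k x a. \<lbrakk>i \<in> Obj J; k \<in> K; x \<in> Obj A; a \<in> carr (on_obj D i) x\<rbrakk> \<Longrightarrow> p k x (c i x a) = snd k i x a"
    by metis
  have "is_limit J (dual \<C>) D M c"
    unfolding is_limit_def
  proof (intro conjI allI impI)
    have "c i x (on_hom D i j a x m) = c j x m"
      if ij: "i \<in> Obj J" "j \<in> Obj J" "a \<in> Hom J i j" and x: "x \<in> Obj A" and m: "m \<in> carr (on_obj D j) x" for i j a x m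
    proof (rule subproduct_eqI[OF sp x])
      note Dm = nat_trans_closed[OF Dhom[OF ij] x m]
      show "c i x (on_hom D i j a x m) \<in> carr M x" "c j x m \<in> carr M x"
        using nat_trans_closed[OF c] ij x m Dm by blast+
      fix k assume k: "k \<in> K"
      then show "p k x (c i x (on_hom D i j a x m)) = p k x (c j x m)"
        using pc[OF ij(1) k x Dm] pc[OF ij(2) k x m] ij x m by (simp add: K cone)
    qed
    then show "is_cone J (dual \<C>) D M c"
      unfolding cone using M PM c by blast
    fix W d assume Wd: "is_cone J (dual \<C>) D W d"
    then have k: "(W, d) \<in> K" by (simp add: K)
    \<comment> \<open>The cocone is itself one of the indices, so the projection to its factor is
      the mediating map.\<close>
    have u: "nat_trans A M W (p (W, d))" using subproduct_nat_trans[OF sp k] by simp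
    have d: "nat_trans A (on_obj D i) W (d i)" if "i \<in> Obj J" for i using Wd that by (auto simp: cone)
    show "\<exists>!u. u \<in> Hom (dual \<C>) W M \<and> (\<forall>i\<in>Obj J. Comp (dual \<C>) W M (on_obj D i) (c i) u = d i)"
    proof (rule ex1I[of _ "p (W, d)"])
      show "p (W, d) \<in> Hom (dual \<C>) W M \<and> (\<forall>i\<in>Obj J. Comp (dual \<C>) W M (on_obj D i) (c i) (p (W, d)) = d i)"
        using u pc[OF _ k] d by (simp add: Comp_eq_iff)
      fix v assume v': "v \<in> Hom (dual \<C>) W M \<and> (\<forall>i\<in>Obj J. Comp (dual \<C>) W M (on_obj D i) (c i) v = d i)"
      then have v: "nat_trans A M W v" by simp
      have vc: "v x (c i x a) = d i x a" if "i \<in> Obj J" "x \<in> Obj A" "a \<in> carr (on_obj D i) x" for i x a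
        using v' that d by (simp add: Comp_eq_iff)
      have W: "is_module U A W" using Wd by (simp add: cone)
      show "v = p (W, d)"
      proof (rule nat_trans_eqI[OF v u])
        fix x m assume x: "x \<in> Obj A" and m: "m \<in> carr M x"
        interpret W: comm_group "on_obj W x" by (rule module_group[OF W x])
        note inv = nat_trans_inv[OF subproduct_nat_trans[OF sp] M Y[THEN conjunct1] x]
        \<comment> \<open>Uniqueness: \<open>v\<close> and the projection agree on the generators by
          the cocone equations, and induction over \<open>generate\<close> extends this to the whole
          of \<open>M\<close>. Elements of the product have to be realized as elements
          \<open>n\<close> of \<open>M\<close> on the way, since \<open>M\<close> is only a
          copy.\<close>
        have "\<exists>n\<in>carr M x. (\<lambda>k\<in>K. p k x n) = s \<and> v x n = p (W, d) x n" if "s \<in> generate (B x) (T x)" for s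
          using that
        proof induction
          case one
          have "p k x \<one>\<^bsub>on_obj M x\<^esub> = \<one>\<^bsub>on_obj (fst k) x\<^esub>" if "k \<in> K" for k
            using nat_trans_one[OF subproduct_nat_trans[OF sp that] M Y[OF that, THEN conjunct1] x] .
          then show ?case
            using module_one[OF M x] nat_trans_one[OF v M W x] nat_trans_one[OF u M W x]
            by (intro bexI[of _ "\<one>\<^bsub>on_obj M x\<^esub>"]) (simp_all add: B_def cong: restrict_cong)
        next
          case (incl s)
          then obtain i a where i: "i \<in> Obj J" "a \<in> carr (on_obj D i) x" "s = (\<lambda>k\<in>K. snd k i x a)"
            by (auto simp: T_def)
          then show ?case
            using pc[OF i(1) _ x i(2)] vc[OF i(1) x i(2)] pc[OF i(1) k x i(2)] nat_trans_closed[OF c x i(2)]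
            by (intro bexI[of _ "c i x a"]) (auto intro!: restrict_ext)
        next
          case (inv s)
          then obtain i a where i: "i \<in> Obj J" "a \<in> carr (on_obj D i) x" and s: "s = (\<lambda>k\<in>K. snd k i x a)"
            by (auto simp: T_def)
          note ca = nat_trans_closed[OF c[OF i(1)] x i(2)]
          have "inv\<^bsub>B x\<^esub> s = (\<lambda>k\<in>K. inv\<^bsub>on_obj (fst k) x\<^esub> s k)"
            unfolding B_def using inv T_sub[OF x] by (intro inv_product_group module_group'[OF Y[THEN conjunct1] x]) (auto simp: B_def)
          also have "\<dots> = (\<lambda>k\<in>K. p k x (inv\<^bsub>on_obj M x\<^esub> c i x a))"
            unfolding s using nat_trans_inv[OF subproduct_nat_trans[OF sp] M Y[THEN conjunct1] x ca] pc[OF i(1) _ x i(2)]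
            by (intro restrict_ext) simp
          finally show ?case
            using ca nat_trans_inv[OF v M W x ca] nat_trans_inv[OF u M W x ca] vc[OF i(1) x i(2)] pc[OF i(1) k x i(2)]
              module_inv[OF M x ca]
            by (intro bexI[of _ "inv\<^bsub>on_obj M x\<^esub> c i x a"]) simp_all
        next
          case (eng s t)
          then obtain a b where ab: "a \<in> carr M x" "b \<in> carr M x" "v x a = p (W, d) x a" "v x b = p (W, d) x b"
            and s: "s = (\<lambda>k\<in>K. p k x a)" and t: "t = (\<lambda>k\<in>K. p k x b)"
            by blast
          have "s \<otimes>\<^bsub>B x\<^esub> t = (\<lambda>k\<in>K. p k x (a \<otimes>\<^bsub>on_obj M x\<^esub> b))"
            unfolding s t B_def using nat_trans_mult[OF subproduct_nat_trans[OF sp] x ab(1,2)]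
            by (auto intro!: restrict_ext)
          then show ?case
            using ab module_mult[OF M x ab(1,2)] nat_trans_mult[OF v x ab(1,2)] nat_trans_mult[OF u x ab(1,2)]
            by (intro bexI[of _ "a \<otimes>\<^bsub>on_obj M x\<^esub> b"]) simp_all
        qed
        from this[OF subproduct_in[OF sp x m]] obtain n where n: "n \<in> carr M x"
          "(\<lambda>k\<in>K. p k x n) = (\<lambda>k\<in>K. p k x m)" "v x n = p (W, d) x n" by blast
        have "n = m"
        proof (rule subproduct_eqI[OF sp x n(1) m])
          show "p k x n = p k x m" if "k \<in> K" for k using fun_cong[OF n(2), of k] that by simp
        qed
        then show "v x m = p (W, d) x m" using n(3) by simp
      qed
    qed
  qed
  then show "\<exists>x c. is_limit J (dual \<C>) D x c" by blast
qed

lemma pre_abelian: "pre_abelian \<C>"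
  by (rule pre_abelian_if_complete[OF U has_preadditive_structure complete cocomplete])

end

subsection \<open>Kernels and cokernels\<close>

lemma restrict_restrict_eqD:
  assumes eq: "(\<lambda>x\<in>X. \<lambda>a\<in>C x. f x a) = (\<lambda>x\<in>X. \<lambda>a\<in>C x. g x a)" and "x \<in> X" "a \<in> C x"
  shows "f x a = g x a"
proof -
  have "(\<lambda>x\<in>X. \<lambda>a\<in>C x. f x a) x a = (\<lambda>x\<in>X. \<lambda>a\<in>C x. g x a) x a" by (simp only: eq)
  then show ?thesis using assms(2,3) by simp
qed

context cogenerated_class
begin

text \<open>Zero morphisms are determined by the category alone, so they may be computed with the
  pointwise structure \<open>pre_C\<close>.\<close>

lemma zero_morphism_iff:
  assumes "is_module U A M" "P M" "is_module U A N" "P N" "nat_trans A M N t"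
  shows "zero_morphism \<C> M N t \<longleftrightarrow> (\<forall>x\<in>Obj A. \<forall>a\<in>carr M x. t x a = \<one>\<^bsub>on_obj N x\<^esub>)"
proof -
  obtain z where "zero_object \<C> z"
    using pre_abelian unfolding pre_abelian_def additive_category_def by blast
  then have "zero_morphism \<C> M N t \<longleftrightarrow> t = (\<lambda>x\<in>Obj A. \<lambda>a\<in>carr M x. \<one>\<^bsub>on_obj N x\<^esub>)"
    using preadditive.zero_morphism_iff[OF preadditive_pre_C, of z M N t] assms
    by (simp add: truncate_pre_C pre_C_simps)
  also have "\<dots> \<longleftrightarrow> (\<forall>x\<in>Obj A. \<forall>a\<in>carr M x. t x a = \<one>\<^bsub>on_obj N x\<^esub>)"
    using nat_trans_eqI[OF assms(5) nat_trans_one_trans[OF assms(1,3)]] by auto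
  finally show ?thesis .
qed

lemma is_kernel_iff:
  assumes X: "is_module U A X" "P X" and Y: "is_module U A Y" "P Y" and f: "nat_trans A X Y f"
  shows "is_kernel \<C> X Y f K i \<longleftrightarrow> is_module U A K \<and> P K \<and> nat_trans A K X i \<and>
    (\<forall>x\<in>Obj A. \<forall>a\<in>carr K x. f x (i x a) = \<one>\<^bsub>on_obj Y x\<^esub>) \<and>
    (\<forall>W h. is_module U A W \<and> P W \<and> nat_trans A W X h \<and> (\<forall>x\<in>Obj A. \<forall>a\<in>carr W x. f x (h x a) = \<one>\<^bsub>on_obj Y x\<^esub>) \<longrightarrow>
      (\<exists>!u. nat_trans A W K u \<and> (\<forall>x\<in>Obj A. \<forall>a\<in>carr W x. i x (u x a) = h x a)))"
proof -
  have 1: "zero_morphism \<C> W Y (Comp \<C> W X Y f h) \<longleftrightarrow> (\<forall>x\<in>Obj A. \<forall>a\<in>carr W x. f x (h x a) = \<one>\<^bsub>on_obj Y x\<^esub>)"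
    if "is_module U A W" "P W" "nat_trans A W X h" for W h
    using that X Y f by (subst zero_morphism_iff) (auto intro: nat_trans_Comp_C)
  have 2: "(nat_trans A W K u \<and> Comp \<C> W K X i u = h) \<longleftrightarrow>
      (nat_trans A W K u \<and> (\<forall>x\<in>Obj A. \<forall>a\<in>carr W x. i x (u x a) = h x a))"
    if "nat_trans A W X h" for W h u
    using that by (simp add: Comp_eq_iff)
  have 3: "(\<exists>!u. nat_trans A W K u \<and> Comp \<C> W K X i u = h) \<longleftrightarrow>
      (\<exists>!u. nat_trans A W K u \<and> (\<forall>x\<in>Obj A. \<forall>a\<in>carr W x. i x (u x a) = h x a))"
    if "nat_trans A W X h" for W h
    by (simp only: 2[OF that])
  show ?thesis
    unfolding is_kernel_def Ball_def[of "Obj \<C>"] Ball_def[of "Hom \<C> _ _"] C_simps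
    by (rule iffI; clarsimp simp: 1 3)
qed

lemma is_cokernel_iff:
  assumes X: "is_module U A X" "P X" and Y: "is_module U A Y" "P Y" and f: "nat_trans A X Y f"
  shows "is_cokernel \<C> X Y f Z q \<longleftrightarrow> is_module U A Z \<and> P Z \<and> nat_trans A Y Z q \<and>
    (\<forall>x\<in>Obj A. \<forall>a\<in>carr X x. q x (f x a) = \<one>\<^bsub>on_obj Z x\<^esub>) \<and>
    (\<forall>W h. is_module U A W \<and> P W \<and> nat_trans A Y W h \<and> (\<forall>x\<in>Obj A. \<forall>a\<in>carr X x. h x (f x a) = \<one>\<^bsub>on_obj W x\<^esub>) \<longrightarrow>
      (\<exists>!u. nat_trans A Z W u \<and> (\<forall>x\<in>Obj A. \<forall>a\<in>carr Y x. u x (q x a) = h x a)))"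
proof -
  have 1: "zero_morphism \<C> X W (Comp \<C> X Y W h f) \<longleftrightarrow> (\<forall>x\<in>Obj A. \<forall>a\<in>carr X x. h x (f x a) = \<one>\<^bsub>on_obj W x\<^esub>)"
    if "is_module U A W" "P W" "nat_trans A Y W h" for W h
    using that X Y f by (subst zero_morphism_iff) (auto intro: nat_trans_Comp_C)
  have 2: "(nat_trans A Z W u \<and> Comp \<C> Y Z W u q = h) \<longleftrightarrow>
      (nat_trans A Z W u \<and> (\<forall>x\<in>Obj A. \<forall>a\<in>carr Y x. u x (q x a) = h x a))"
    if "nat_trans A Y W h" for W h u
    using that by (simp add: Comp_eq_iff)
  have 3: "(\<exists>!u. nat_trans A Z W u \<and> Comp \<C> Y Z W u q = h) \<longleftrightarrow>
      (\<exists>!u. nat_trans A Z W u \<and> (\<forall>x\<in>Obj A. \<forall>a\<in>carr Y x. u x (q x a) = h x a))"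
    if "nat_trans A Y W h" for W h
    by (simp only: 2[OF that])
  show ?thesis
    unfolding is_cokernel_def is_kernel_def dual_simps zero_morphism_dual
      Ball_def[of "Obj \<C>"] Ball_def[of "Hom \<C> _ _"] C_simps
    by (rule iffI; clarsimp simp: 1 3)
qed

lemma factor_through_submodule:
  assumes M: "is_module U A M" and t: "nat_trans A M N t"
    and T: "\<And>x a. \<lbrakk>x \<in> Obj A; a \<in> carr M x\<rbrakk> \<Longrightarrow> t x a \<in> T x"
  shows "nat_trans A M (submodule N T) t"
proof -
  have "nat_trans A M (submodule N T) (\<lambda>x\<in>Obj A. \<lambda>a\<in>carr M x. t x a)"
    by (rule nat_transI[OF M]) (use T nat_trans_mult[OF t] nat_trans_natural[OF t] in simp_all)
  also have "(\<lambda>x\<in>Obj A. \<lambda>a\<in>carr M x. t x a) = t"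
    by (rule nat_trans_eqI[OF calculation t]) simp
  finally show ?thesis .
qed

lemma kernel_object:
  assumes M: "is_module U A M" "P M" and N: "is_module U A N" and t: "nat_trans A M N t"
  defines "K \<equiv> submodule M (\<lambda>x. {a \<in> carr M x. t x a = \<one>\<^bsub>on_obj N x\<^esub>})"
  shows "is_module U A K" "P K" "nat_trans A K M (\<lambda>x\<in>Obj A. \<lambda>a\<in>{a \<in> carr M x. t x a = \<one>\<^bsub>on_obj N x\<^esub>}. a)"
proof -
  have "on_hom M x y f a \<in> {a \<in> carr M y. t y a = \<one>\<^bsub>on_obj N y\<^esub>}"
    if "x \<in> Obj A" "y \<in> Obj A" "f \<in> Hom A x y" "a \<in> {a \<in> carr M x. t x a = \<one>\<^bsub>on_obj N x\<^esub>}" for x y f a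
    using that module_closed[OF M(1) that(1-3)] nat_trans_natural[OF t that(1-3)] module_hom_one[OF N that(1-3)] by simp
  from submodule_in[OF M nat_trans_kernel_subgroup[OF t M(1) N] this]
  show "is_module U A K" "P K" "nat_trans A K M (\<lambda>x\<in>Obj A. \<lambda>a\<in>{a \<in> carr M x. t x a = \<one>\<^bsub>on_obj N x\<^esub>}. a)"
    unfolding K_def by blast+
qed

text \<open>The image of \<open>f\<close> lies in the class, so a cokernel map factors through its
  image and uniqueness forces the image to be everything. Conversely a surjection is the cokernel of
  the inclusion of its kernel, since maps that vanish on the kernel descend.\<close>

lemma cokernel_iff_surjective:
  assumes X: "is_module U A X" "P X" and Z: "is_module U A Z" "P Z" and f: "nat_trans A X Z f"
  shows "(\<exists>W\<in>Obj \<C>. \<exists>h\<in>Hom \<C> W X. is_cokernel \<C> W X h Z f) \<longleftrightarrow> (\<forall>x\<in>Obj A. f x ` carr X x = carr Z x)"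
proof
  assume "\<exists>W\<in>Obj \<C>. \<exists>h\<in>Hom \<C> W X. is_cokernel \<C> W X h Z f"
  then obtain W h where W: "is_module U A W" "P W" "nat_trans A W X h" and "is_cokernel \<C> W X h Z f" by auto
  then have cok: "\<And>x a. \<lbrakk>x \<in> Obj A; a \<in> carr W x\<rbrakk> \<Longrightarrow> f x (h x a) = \<one>\<^bsub>on_obj Z x\<^esub>"
    and univ: "\<And>V g. \<lbrakk>is_module U A V; P V; nat_trans A X V g; \<forall>x\<in>Obj A. \<forall>a\<in>carr W x. g x (h x a) = \<one>\<^bsub>on_obj V x\<^esub>\<rbrakk> \<Longrightarrow>
      \<exists>!u. nat_trans A Z V u \<and> (\<forall>x\<in>Obj A. \<forall>a\<in>carr X x. u x (f x a) = g x a)"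
    unfolding is_cokernel_iff[OF W(1,2) X W(3)] by auto
  define T where "T x = f x ` carr X x" for x
  let ?I = "submodule Z T" and ?i = "\<lambda>x\<in>Obj A. \<lambda>a\<in>T x. a"
  have T_sub: "subgroup (T x) (on_obj Z x)" if "x \<in> Obj A" for x
    unfolding T_def by (rule nat_trans_image_subgroup[OF f X(1) Z(1) that])
  have T_stable: "on_hom Z x y k a \<in> T y" if "x \<in> Obj A" "y \<in> Obj A" "k \<in> Hom A x y" "a \<in> T x" for x y k a
    using that nat_trans_natural[OF f that(1-3), symmetric] module_closed[OF X(1) that(1-3)] by (auto simp: T_def)
  note I = submodule_in[where T = T, OF Z T_sub T_stable]
  have fT: "f x a \<in> T x" if "a \<in> carr X x" for x a using that by (simp add: T_def)
  have fI: "nat_trans A X ?I f" by (rule factor_through_submodule[OF X(1) f fT])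
  obtain r where r: "nat_trans A Z ?I r" "\<forall>x\<in>Obj A. \<forall>a\<in>carr X x. r x (f x a) = f x a"
    using univ[OF I(1,2) fI] cok by auto
  \<comment> \<open>\<open>Z\<close> mapped to the image by \<open>r\<close> and back by inclusion.
    It agrees with the identity after \<open>f\<close>, hence equals it, and so every element of
    \<open>Z\<close> lies in the image.\<close>
  let ?ir = "\<lambda>x\<in>Obj A. \<lambda>a\<in>carr Z x. ?i x (r x a)" and ?id = "\<lambda>x\<in>Obj A. \<lambda>a\<in>carr Z x. a"
  have "nat_trans A Z Z ?ir \<and> (\<forall>x\<in>Obj A. \<forall>a\<in>carr X x. ?ir x (f x a) = f x a)"
    using nat_trans_Comp[OF Z(1) r(1) I(3)] r(2) nat_trans_closed[OF f] fT by simp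
  moreover have "nat_trans A Z Z ?id \<and> (\<forall>x\<in>Obj A. \<forall>a\<in>carr X x. ?id x (f x a) = f x a)"
    using nat_trans_Ident[OF Z(1)] nat_trans_closed[OF f] by simp
  ultimately have eq: "?ir = ?id" using univ[OF Z f] cok by blast
  have "b \<in> T x" if x: "x \<in> Obj A" and b: "b \<in> carr Z x" for x b
    using restrict_restrict_eqD[OF eq x b] nat_trans_closed[OF r(1) x b] x by simp
  then show "\<forall>x\<in>Obj A. f x ` carr X x = carr Z x"
    using nat_trans_closed[OF f] unfolding T_def by blast
next
  assume surj: "\<forall>x\<in>Obj A. f x ` carr X x = carr Z x"
  define T where "T x = {a \<in> carr X x. f x a = \<one>\<^bsub>on_obj Z x\<^esub>}" for x
  let ?K = "submodule X T" and ?i = "\<lambda>x\<in>Obj A. \<lambda>a\<in>T x. a"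
  have K: "is_module U A ?K" "P ?K" "nat_trans A ?K X ?i"
    using kernel_object[OF X Z(1) f] unfolding T_def[symmetric] by auto
  have "is_cokernel \<C> ?K X ?i Z f"
    unfolding is_cokernel_iff[OF K(1,2) X K(3)]
  proof (intro conjI allI impI Z f, goal_cases)
    case 1
    then show ?case by (simp add: T_def)
  next
    case (2 W g)
    then have W: "is_module U A W" "P W" and g: "nat_trans A X W g"
      and ker: "\<And>x a. \<lbrakk>x \<in> Obj A; a \<in> carr X x; f x a = \<one>\<^bsub>on_obj Z x\<^esub>\<rbrakk> \<Longrightarrow> g x a = \<one>\<^bsub>on_obj W x\<^esub>"
      by (auto simp: T_def)
    have wd: "g x a = g x b" if x: "x \<in> Obj A" and ab: "a \<in> carr X x" "b \<in> carr X x" "f x a = f x b" for x a b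
    proof -
      let ?c = "a \<otimes>\<^bsub>on_obj X x\<^esub> inv\<^bsub>on_obj X x\<^esub> b"
      have c: "?c \<in> carr X x" using ab module_mult[OF X(1) x] module_inv[OF X(1) x] by blast
      have "f x ?c = \<one>\<^bsub>on_obj Z x\<^esub>"
        using ab nat_trans_mult[OF f x] nat_trans_inv[OF f X(1) Z(1) x] module_inv[OF X(1) x]
          module_eq_iff[OF Z(1) x] nat_trans_closed[OF f x] by simp
      then have "g x ?c = \<one>\<^bsub>on_obj W x\<^esub>" using ker[OF x c] by blast
      then show ?thesis
        using ab nat_trans_mult[OF g x] nat_trans_inv[OF g X(1) W(1) x] module_inv[OF X(1) x]
          module_eq_iff[OF W(1) x] nat_trans_closed[OF g x] by simp
    qed
    have "\<exists>w. \<forall>a\<in>carr X x. f x a = b \<longrightarrow> w = g x a" if "x \<in> Obj A" for x b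
      using wd[OF that] by metis
    then obtain u where u: "\<And>x a. \<lbrakk>x \<in> Obj A; a \<in> carr X x\<rbrakk> \<Longrightarrow> u x (f x a) = g x a" by metis
    let ?u = "\<lambda>x\<in>Obj A. \<lambda>b\<in>carr Z x. u x b"
    have rep: "\<exists>a\<in>carr X x. b = f x a" if "x \<in> Obj A" "b \<in> carr Z x" for x b using surj that by blast
    have ut: "nat_trans A Z W ?u"
    proof (rule nat_transI[OF Z(1)])
      fix x b assume x: "x \<in> Obj A" and b: "b \<in> carr Z x"
      obtain a where a: "a \<in> carr X x" "b = f x a" using rep[OF x b] by blast
      show "u x b \<in> carr W x" using a u x nat_trans_closed[OF g x] by simp
      show "u y (on_hom Z x y k b) = on_hom W x y k (u x b)" if y: "y \<in> Obj A" "k \<in> Hom A x y" for y k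
        using nat_trans_natural[OF f x y a(1)] nat_trans_natural[OF g x y a(1)] u[OF x a(1)]
          u[OF y(1) module_closed[OF X(1) x y a(1)]] a(2) by simp
      fix b' assume b': "b' \<in> carr Z x"
      obtain a' where a': "a' \<in> carr X x" "b' = f x a'" using rep[OF x b'] by blast
      show "u x (b \<otimes>\<^bsub>on_obj Z x\<^esub> b') = u x b \<otimes>\<^bsub>on_obj W x\<^esub> u x b'"
        using nat_trans_mult[OF f x a(1) a'(1)] nat_trans_mult[OF g x a(1) a'(1)] u[OF x a(1)] u[OF x a'(1)]
          u[OF x module_mult[OF X(1) x a(1) a'(1)]] a(2) a'(2) by simp
    qed
    show ?case
    proof (rule ex1I)
      show "nat_trans A Z W ?u \<and> (\<forall>x\<in>Obj A. \<forall>a\<in>carr X x. ?u x (f x a) = g x a)"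
        using ut u nat_trans_closed[OF f] by simp
      fix v assume v: "nat_trans A Z W v \<and> (\<forall>x\<in>Obj A. \<forall>a\<in>carr X x. v x (f x a) = g x a)"
      show "v = ?u"
      proof (rule nat_trans_eqI[OF v[THEN conjunct1] ut])
        fix x b assume x: "x \<in> Obj A" and b: "b \<in> carr Z x"
        obtain a where a: "a \<in> carr X x" "b = f x a" using rep[OF x b] by blast
        then show "v x b = ?u x b" using v u x b by simp
      qed
    qed
  qed
  then show "\<exists>W\<in>Obj \<C>. \<exists>h\<in>Hom \<C> W X. is_cokernel \<C> W X h Z f" using K
    by (intro bexI[of _ ?K] bexI[of _ ?i]) (auto simp del: submodule_simps)
qed

text \<open>Subproducts of two factors, with pairs in place of functions on \<open>bool\<close>.
  Used for the concrete pullback and for the graph of a map between restricted pregliders.\<close>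

lemma pair_submodule:
  assumes X: "is_module U A X" "P X" and Y: "is_module U A Y" "P Y"
    and T: "\<And>x. x \<in> Obj A \<Longrightarrow> T x \<subseteq> carr X x \<times> carr Y x"
      "\<And>x. x \<in> Obj A \<Longrightarrow> (\<one>\<^bsub>on_obj X x\<^esub>, \<one>\<^bsub>on_obj Y x\<^esub>) \<in> T x"
      "\<And>x a b a' b'. \<lbrakk>x \<in> Obj A; (a, b) \<in> T x; (a', b') \<in> T x\<rbrakk> \<Longrightarrow> (a \<otimes>\<^bsub>on_obj X x\<^esub> a', b \<otimes>\<^bsub>on_obj Y x\<^esub> b') \<in> T x"
      "\<And>x a b. \<lbrakk>x \<in> Obj A; (a, b) \<in> T x\<rbrakk> \<Longrightarrow> (inv\<^bsub>on_obj X x\<^esub> a, inv\<^bsub>on_obj Y x\<^esub> b) \<in> T x"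
    and stable: "\<And>x y f a b. \<lbrakk>x \<in> Obj A; y \<in> Obj A; f \<in> Hom A x y; (a, b) \<in> T x\<rbrakk> \<Longrightarrow>
      (on_hom X x y f a, on_hom Y x y f b) \<in> T y"
  obtains Q q1 q2 where "is_module U A Q" "P Q" "nat_trans A Q X q1" "nat_trans A Q Y q2"
    "\<And>x. x \<in> Obj A \<Longrightarrow> bij_betw (\<lambda>m. (q1 x m, q2 x m)) (carr Q x) (T x)"
proof -
  define Z where "Z k = (if k then X else Y)" for k
  have Z: "is_module U A (Z k) \<and> P (Z k)" for k using X Y by (simp add: Z_def)
  let ?G = "\<lambda>x. product_group UNIV (\<lambda>k. on_obj (Z k) x)"
  define S where "S x = {s. (s True, s False) \<in> T x}" for x
  have carr_G: "s \<in> carrier (?G x) \<longleftrightarrow> s True \<in> carr X x \<and> s False \<in> carr Y x" for s x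
    by (auto simp: Z_def PiE_iff)
  have S_sub: "subgroup (S x) (?G x)" if x: "x \<in> Obj A" for x
  proof
    show sub: "S x \<subseteq> carrier (?G x)" using T(1)[OF x] by (auto simp: S_def carr_G simp del: carrier_product_group)
    show "\<one>\<^bsub>?G x\<^esub> \<in> S x" using T(2)[OF x] by (simp add: S_def Z_def)
    fix s t assume st: "s \<in> S x" "t \<in> S x"
    then show "s \<otimes>\<^bsub>?G x\<^esub> t \<in> S x" using T(3)[OF x] by (simp add: S_def Z_def)
    have "inv\<^bsub>?G x\<^esub> s = (\<lambda>k\<in>UNIV. inv\<^bsub>on_obj (Z k) x\<^esub> s k)"
      using sub st(1) by (intro inv_product_group module_group'[OF Z[THEN conjunct1] x]) auto
    then show "inv\<^bsub>?G x\<^esub> s \<in> S x" using st T(4)[OF x] by (simp add: S_def Z_def)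
  qed
  have S_small: "small_set U (S x)" if x: "x \<in> Obj A" for x
  proof -
    have "small_set U (T x)"
      by (rule small_subset[OF small_Times[OF U small_member small_member] T(1)[OF x]])
        (rule module_carrier[OF X(1) x] module_carrier[OF Y(1) x])+
    then have "small_set U ((\<lambda>(a, b) k. if k then a else b) ` T x)" by (rule small_image)
    moreover have "S x \<subseteq> (\<lambda>(a, b) k. if k then a else b) ` T x"
    proof
      fix s assume "s \<in> S x"
      moreover have "s = (\<lambda>k. if k then s True else s False)" by auto
      ultimately show "s \<in> (\<lambda>(a, b) k. if k then a else b) ` T x"
        by (intro image_eqI[of _ _ "(s True, s False)"]) (auto simp: S_def)
    qed
    ultimately show ?thesis by (rule small_subset)
  qed
  obtain Q p where Q: "is_module U A Q" and sp: "subproduct A UNIV Z S Q p"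
  proof (rule subproduct_exists[where A = A and K = UNIV and Y = Z and S = S, OF U _ S_sub S_small])
    show "(\<lambda>k\<in>UNIV. on_hom (Z k) x y f (s k)) \<in> S y"
      if "x \<in> Obj A" "y \<in> Obj A" "f \<in> Hom A x y" "s \<in> S x" for x y f s
      using stable[OF that(1-3)] that(4) by (simp add: S_def Z_def)
  qed (use Z in auto)
  have PQ: "P Q" by (rule cogenerated_subproduct[OF Q sp Z])
  show thesis
  proof (rule that[OF Q PQ])
    show "nat_trans A Q X (p True)" "nat_trans A Q Y (p False)"
      using subproduct_nat_trans[OF sp, of True] subproduct_nat_trans[OF sp, of False] by (simp_all add: Z_def)
    fix x assume x: "x \<in> Obj A"
    show "bij_betw (\<lambda>m. (p True x m, p False x m)) (carr Q x) (T x)"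
      unfolding bij_betw_def
    proof (intro conjI inj_onI equalityI subsetI)
      fix m n assume mn: "m \<in> carr Q x" "n \<in> carr Q x" and eq: "(p True x m, p False x m) = (p True x n, p False x n)"
      show "m = n"
      proof (rule subproduct_eqI[OF sp x mn])
        show "p k x m = p k x n" for k using eq by (cases k) auto
      qed
    next
      fix c assume "c \<in> (\<lambda>m. (p True x m, p False x m)) ` carr Q x"
      then show "c \<in> T x" using subproduct_in[OF sp x] by (auto simp: S_def)
    next
      fix c assume c: "c \<in> T x"
      have "(\<lambda>k\<in>UNIV. if k then fst c else snd c) \<in> S x" using c by (simp add: S_def)
      then obtain m where "m \<in> carr Q x" "\<And>k. k \<in> UNIV \<Longrightarrow> p k x m = (if k then fst c else snd c)"
        by (rule subproduct_element[OF sp x]) blast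
      then show "c \<in> (\<lambda>m. (p True x m, p False x m)) ` carr Q x"
        by (intro image_eqI[of _ _ m]) simp_all
    qed
  qed
qed

text \<open>Surjectivity of \<open>f\<close> makes the second projection \<open>q2\<close> of the
  concrete pullback \<open>Q\<close> surjective. The induced map from \<open>Q\<close> to the given
  pullback factors \<open>q2\<close> through \<open>p2\<close>, so \<open>p2\<close> is surjective
  too.\<close>

lemma cokernels_stable: "cokernels_stable_under_pullback \<C>"
  unfolding cokernels_stable_under_pullback_def
proof (intro ballI allI impI, elim conjE)
  fix X Y Z f g M p1 p2
  assume "X \<in> Obj \<C>" "Y \<in> Obj \<C>" "Z \<in> Obj \<C>" "f \<in> Hom \<C> X Z" "g \<in> Hom \<C> Y Z"
  then have X: "is_module U A X" "P X" and Y: "is_module U A Y" "P Y" and Z: "is_module U A Z" "P Z"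
    and f: "nat_trans A X Z f" and g: "nat_trans A Y Z g" by auto
  assume cok: "\<exists>w\<in>Obj \<C>. \<exists>h\<in>Hom \<C> w X. is_cokernel \<C> w X h Z f" and pb: "is_pullback \<C> X Y Z f g M p1 p2"
  have M: "is_module U A M" "P M" and p2: "nat_trans A M Y p2" using pb unfolding is_pullback_def by auto
  have surj: "f x ` carr X x = carr Z x" if "x \<in> Obj A" for x
    using cok that unfolding cokernel_iff_surjective[OF X Z f] by blast
  define T where "T x = {(a, b). a \<in> carr X x \<and> b \<in> carr Y x \<and> f x a = g x b}" for x
  obtain Q q1 q2 where Q: "is_module U A Q" "P Q" and q: "nat_trans A Q X q1" "nat_trans A Q Y q2"
    and bij: "\<And>x. x \<in> Obj A \<Longrightarrow> bij_betw (\<lambda>m. (q1 x m, q2 x m)) (carr Q x) (T x)"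
    by (rule pair_submodule[OF X Y, of T])
      (auto simp: T_def module_one[OF X(1)] module_one[OF Y(1)] module_mult[OF X(1)] module_mult[OF Y(1)]
        module_inv[OF X(1)] module_inv[OF Y(1)] module_closed[OF X(1)] module_closed[OF Y(1)]
        nat_trans_one[OF f X(1) Z(1)] nat_trans_one[OF g Y(1) Z(1)] nat_trans_mult[OF f] nat_trans_mult[OF g]
        nat_trans_inv[OF f X(1) Z(1)] nat_trans_inv[OF g Y(1) Z(1)] nat_trans_natural[OF f] nat_trans_natural[OF g])
  have "(q1 x m, q2 x m) \<in> T x" if "x \<in> Obj A" "m \<in> carr Q x" for x m
    using bij[OF that(1)] that(2) unfolding bij_betw_def by blast
  then have "Comp \<C> Q X Z f q1 = Comp \<C> Q Y Z g q2" by (simp add: Comp_eq_Comp_iff T_def)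
  then obtain u where "nat_trans A Q M u" "Comp \<C> Q M Y p2 u = q2"
    using pb[unfolded is_pullback_def] Q q by (metis C_simps(1,2))
  then have u: "nat_trans A Q M u" "\<And>x m. \<lbrakk>x \<in> Obj A; m \<in> carr Q x\<rbrakk> \<Longrightarrow> p2 x (u x m) = q2 x m"
    using q by (auto simp: Comp_eq_iff)
  have "b \<in> p2 x ` carr M x" if x: "x \<in> Obj A" and b: "b \<in> carr Y x" for x b
  proof -
    obtain a where a: "a \<in> carr X x" "f x a = g x b"
      using surj[OF x] nat_trans_closed[OF g x b] by (metis imageE)
    then have "(a, b) \<in> (\<lambda>m. (q1 x m, q2 x m)) ` carr Q x"
      unfolding bij_betw_imp_surj_on[OF bij[OF x]] using b by (simp add: T_def)
    then obtain m where "m \<in> carr Q x" "q2 x m = b" by auto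
    then show ?thesis using u(2)[OF x] nat_trans_closed[OF u(1) x] by (intro image_eqI[of _ _ "u x m"]) auto
  qed
  then have "\<forall>x\<in>Obj A. p2 x ` carr M x = carr Y x" using nat_trans_closed[OF p2] by blast
  then show "\<exists>w\<in>Obj \<C>. \<exists>h\<in>Hom \<C> w M. is_cokernel \<C> w M h Y p2"
    unfolding cokernel_iff_surjective[OF M Y p2] .
qed

lemma deflation_quasi_abelian: "deflation_quasi_abelian \<C>"
  unfolding deflation_quasi_abelian_def using pre_abelian cokernels_stable by blast

text \<open>The universal property is tested twice: against the inclusion of the concrete kernel,
  which gives the image, and against the inclusion of the kernel of \<open>f\<close>, which gives
  injectivity.\<close>

lemma is_kernelD:
  assumes X: "is_module U A X" "P X" and W: "is_module U A W" "P W" and h: "nat_trans A X W h"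
    and Z: "is_kernel \<C> X W h Z f" and x: "x \<in> Obj A"
  shows "inj_on (f x) (carr Z x)" "f x ` carr Z x = {a \<in> carr X x. h x a = \<one>\<^bsub>on_obj W x\<^esub>}"
proof -
  have Z: "is_module U A Z" "P Z" "nat_trans A Z X f"
    and hf: "\<And>x a. \<lbrakk>x \<in> Obj A; a \<in> carr Z x\<rbrakk> \<Longrightarrow> h x (f x a) = \<one>\<^bsub>on_obj W x\<^esub>"
    and univ: "\<And>V g. \<lbrakk>is_module U A V; P V; nat_trans A V X g; \<forall>x\<in>Obj A. \<forall>a\<in>carr V x. h x (g x a) = \<one>\<^bsub>on_obj W x\<^esub>\<rbrakk> \<Longrightarrow>
      \<exists>!u. nat_trans A V Z u \<and> (\<forall>x\<in>Obj A. \<forall>a\<in>carr V x. f x (u x a) = g x a)"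
    using Z unfolding is_kernel_iff[OF X W h] by auto
  define T where "T x = {a \<in> carr X x. h x a = \<one>\<^bsub>on_obj W x\<^esub>}" for x
  let ?K = "submodule X T" and ?i = "\<lambda>x\<in>Obj A. \<lambda>a\<in>T x. a"
  have K: "is_module U A ?K" "P ?K" "nat_trans A ?K X ?i"
    using kernel_object[OF X W(1) h] unfolding T_def[symmetric] by auto
  obtain u where u: "nat_trans A ?K Z u" "\<forall>x\<in>Obj A. \<forall>a\<in>T x. f x (u x a) = a"
    using univ[OF K] by (auto simp: T_def)
  show "f x ` carr Z x = {a \<in> carr X x. h x a = \<one>\<^bsub>on_obj W x\<^esub>}"
  proof (intro equalityI subsetI)
    fix a assume "a \<in> {a \<in> carr X x. h x a = \<one>\<^bsub>on_obj W x\<^esub>}"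
    then have "a \<in> T x" by (simp add: T_def)
    then show "a \<in> f x ` carr Z x"
      using u(2) x nat_trans_closed[OF u(1) x, of a] by (intro image_eqI[of _ _ "u x a"]) auto
  qed (use x hf nat_trans_closed[OF Z(3)] in auto)
  define T' where "T' x = {a \<in> carr Z x. f x a = \<one>\<^bsub>on_obj X x\<^esub>}" for x
  let ?L = "submodule Z T'" and ?j = "\<lambda>x\<in>Obj A. \<lambda>a\<in>T' x. a"
  let ?o = "\<lambda>x\<in>Obj A. \<lambda>a\<in>carr ?L x. \<one>\<^bsub>on_obj Z x\<^esub>" and ?g = "\<lambda>x\<in>Obj A. \<lambda>a\<in>carr ?L x. \<one>\<^bsub>on_obj X x\<^esub>"
  have L: "is_module U A ?L" "P ?L" "nat_trans A ?L Z ?j"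
    using kernel_object[OF Z(1,2) X(1) Z(3)] unfolding T'_def[symmetric] by auto
  \<comment> \<open>On the kernel \<open>?L\<close> of \<open>f\<close>, the inclusion and the
    trivial map have the same composite with \<open>f\<close>; uniqueness makes them equal, so
    \<open>?L\<close> is trivial.\<close>
  have "nat_trans A ?L Z ?j \<and> (\<forall>x\<in>Obj A. \<forall>a\<in>carr ?L x. f x (?j x a) = ?g x a)"
    using L by (simp add: T'_def)
  moreover have "nat_trans A ?L Z ?o \<and> (\<forall>x\<in>Obj A. \<forall>a\<in>carr ?L x. f x (?o x a) = ?g x a)"
    using nat_trans_one_trans[OF L(1) Z(1)] nat_trans_one[OF Z(3) Z(1) X(1)] by simp
  moreover have "\<forall>x\<in>Obj A. \<forall>a\<in>carr ?L x. h x (?g x a) = \<one>\<^bsub>on_obj W x\<^esub>"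
    using nat_trans_one[OF h X(1) W(1)] by simp
  ultimately have "?j = ?o" using univ[OF L(1,2) nat_trans_one_trans[OF L(1) X(1)]] by blast
  then have "a = \<one>\<^bsub>on_obj Z x\<^esub>" if "a \<in> carr Z x" "f x a = \<one>\<^bsub>on_obj X x\<^esub>" for a
    using restrict_restrict_eqD[where X = "Obj A" and C = T' and f = "\<lambda>x a. a" and g = "\<lambda>x a. \<one>\<^bsub>on_obj Z x\<^esub>", of x a] x that
    by (simp add: T'_def)
  then show "inj_on (f x) (carr Z x)" by (rule nat_trans_injI[OF Z(3,1) X(1) x])
qed

lemma is_kernelI:
  assumes X: "is_module U A X" "P X" and W: "is_module U A W" "P W" and h: "nat_trans A X W h"
    and Z: "is_module U A Z" "P Z" and f: "nat_trans A Z X f"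
    and inj: "\<And>x. x \<in> Obj A \<Longrightarrow> inj_on (f x) (carr Z x)"
    and ker: "\<And>x. x \<in> Obj A \<Longrightarrow> f x ` carr Z x = {a \<in> carr X x. h x a = \<one>\<^bsub>on_obj W x\<^esub>}"
  shows "is_kernel \<C> X W h Z f"
  unfolding is_kernel_iff[OF X W h]
proof (intro conjI allI impI Z f ballI, goal_cases)
  case (1 x a)
  then show ?case using ker[of x] by blast
next
  case (2 V g)
  then have V: "is_module U A V" "P V" and g: "nat_trans A V X g"
    and hg: "\<And>x a. \<lbrakk>x \<in> Obj A; a \<in> carr V x\<rbrakk> \<Longrightarrow> h x (g x a) = \<one>\<^bsub>on_obj W x\<^esub>" by auto
  have "\<exists>b. b \<in> carr Z x \<and> f x b = g x a" if x: "x \<in> Obj A" and a: "a \<in> carr V x" for x a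
  proof -
    have "g x a \<in> f x ` carr Z x" using ker[OF x] hg[OF x a] nat_trans_closed[OF g x a] by simp
    then show ?thesis by auto
  qed
  then obtain u where u: "\<And>x a. \<lbrakk>x \<in> Obj A; a \<in> carr V x\<rbrakk> \<Longrightarrow> u x a \<in> carr Z x"
    and fu: "\<And>x a. \<lbrakk>x \<in> Obj A; a \<in> carr V x\<rbrakk> \<Longrightarrow> f x (u x a) = g x a" by metis
  let ?u = "\<lambda>x\<in>Obj A. \<lambda>a\<in>carr V x. u x a"
  have ut: "nat_trans A V Z ?u"
  proof (rule nat_transI[OF V(1)])
    fix x a assume x: "x \<in> Obj A" and a: "a \<in> carr V x"
    show "u x a \<in> carr Z x" using u x a .
    show "u x (a \<otimes>\<^bsub>on_obj V x\<^esub> b) = u x a \<otimes>\<^bsub>on_obj Z x\<^esub> u x b" if b: "b \<in> carr V x" for b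
      by (rule inj_onD[OF inj[OF x]])
        (use module_mult[OF V(1) x a b] module_mult[OF Z(1) x] nat_trans_mult[OF f x] nat_trans_mult[OF g x a b]
          u[OF x] fu[OF x] a b in simp_all)
    show "u y (on_hom V x y k a) = on_hom Z x y k (u x a)" if y: "y \<in> Obj A" "k \<in> Hom A x y" for y k
      by (rule inj_onD[OF inj[OF y(1)]])
        (use module_closed[OF V(1) x y a] module_closed[OF Z(1) x y] nat_trans_natural[OF f x y]
          nat_trans_natural[OF g x y a] u fu x y a in simp_all)
  qed
  show ?case
  proof (rule ex1I)
    show "nat_trans A V Z ?u \<and> (\<forall>x\<in>Obj A. \<forall>a\<in>carr V x. f x (?u x a) = g x a)" using ut fu by simp
    fix v assume v: "nat_trans A V Z v \<and> (\<forall>x\<in>Obj A. \<forall>a\<in>carr V x. f x (v x a) = g x a)"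
    then have vt: "nat_trans A V Z v" by blast
    show "v = ?u"
    proof (rule nat_trans_eqI[OF vt ut])
      fix x a assume x: "x \<in> Obj A" and a: "a \<in> carr V x"
      show "v x a = ?u x a"
        by (rule inj_onD[OF inj[OF x]]) (use v fu x a u nat_trans_closed[OF vt x a] in simp_all)
    qed
  qed
qed

end

section \<open>Modules on which given arrows are injective\<close>

lemma quotient_group_copy:
  fixes G :: "'v monoid" and U :: "'u set set"
  assumes U: "universe U" and G: "comm_group G" and small: "small_set U (carrier G)" and N: "subgroup N G"
  shows "\<exists>(H :: 'u monoid) r. comm_group H \<and> carrier H \<in> U \<and> r \<in> hom G H \<and> r ` carrier G = carrier H \<and>
    (\<forall>a\<in>carrier G. r a = \<one>\<^bsub>H\<^esub> \<longleftrightarrow> a \<in> N)"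
proof -
  interpret comm_group G by (rule G)
  interpret N: normal N G by (rule subgroup_imp_normal[OF N])
  have Q: "comm_group (G Mod N)" by (rule abelian_FactGroup[OF N])
  have "small_set U (carrier (G Mod N))"
    unfolding carrier_FactGroup by (rule small_image[OF small])
  from small_group_copy[OF U Q this] obtain H :: "'u monoid" and \<phi> where
    H: "comm_group H" "carrier H \<in> U" and \<phi>: "\<phi> \<in> iso (G Mod N) H" by blast
  have \<phi>_hom: "\<phi> \<in> hom (G Mod N) H" and \<phi>_bij: "bij_betw \<phi> (carrier (G Mod N)) (carrier H)"
    using \<phi> by (simp_all add: iso_def)
  have one: "\<phi> N = \<one>\<^bsub>H\<^esub>"
    using hom_one[OF \<phi>_hom N.factorgroup_is_group comm_group.axioms(2)[OF H(1)]] by simp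
  have r: "(\<lambda>a. \<phi> (N #>\<^bsub>G\<^esub> a)) \<in> hom G H"
    using Group.hom_compose[OF N.r_coset_hom_Mod \<phi>_hom] by (simp add: comp_def)
  have "\<phi> (N #>\<^bsub>G\<^esub> a) = \<one>\<^bsub>H\<^esub> \<longleftrightarrow> a \<in> N" if a: "a \<in> carrier G" for a
  proof -
    have "N #>\<^bsub>G\<^esub> a \<in> carrier (G Mod N)" "N \<in> carrier (G Mod N)"
      using a monoid.one_closed[OF group.is_monoid[OF N.factorgroup_is_group]] by (simp_all add: carrier_FactGroup)
    then have "\<phi> (N #>\<^bsub>G\<^esub> a) = \<phi> N \<longleftrightarrow> N #>\<^bsub>G\<^esub> a = N"
      by (rule inj_on_eq_iff[OF bij_betw_imp_inj_on[OF \<phi>_bij]])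
    moreover have "N #>\<^bsub>G\<^esub> a = N \<longleftrightarrow> a \<in> N"
      using coset_join1[OF _ a N] coset_join2[OF a N] by blast
    ultimately show ?thesis using one by simp
  qed
  moreover have "(\<lambda>a. \<phi> (N #>\<^bsub>G\<^esub> a)) ` carrier G = carrier H"
    using \<phi>_bij unfolding bij_betw_def carrier_FactGroup by (simp add: image_image)
  ultimately show ?thesis using H r by blast
qed

definition pair_module :: "('o, 'm, 'u) amod \<Rightarrow> ('o, 'm, 'u) amod \<Rightarrow> ('o, 'm, 'u \<times> 'u) amod" where
  "pair_module X Y = \<lparr>on_obj = (\<lambda>x. on_obj X x \<times>\<times> on_obj Y x),
     on_hom = (\<lambda>x y f. \<lambda>(a, b)\<in>carr X x \<times> carr Y x. (on_hom X x y f a, on_hom Y x y f b))\<rparr>"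

lemma is_module_pair:
  assumes X: "is_module U A X" and Y: "is_module V A Y"
  shows "is_module UNIV A (pair_module X Y)"
proof -
  have cg: "comm_group (on_obj X x \<times>\<times> on_obj Y x)" if x: "x \<in> Obj A" for x
    using DirProd_group[OF module_group'[OF X x] module_group'[OF Y x]]
    by (rule group.group_comm_groupI)
      (auto simp: DirProd_def comm_groupE(4)[OF module_group[OF X x]] comm_groupE(4)[OF module_group[OF Y x]])
  show ?thesis
    unfolding is_module_def
    by (auto simp: pair_module_def cg hom_def module_closed[OF X] module_closed[OF Y]
        module_hom_mult[OF X] module_hom_mult[OF Y] module_mult[OF X] module_mult[OF Y]
        module_Ident[OF X] module_Ident[OF Y] module_Comp[OF X] module_Comp[OF Y]
        module_Plus[OF X] module_Plus[OF Y] intro!: restrict_ext)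
qed

text \<open>\<open>E\<close> selects the arrows that must act injectively; for prefragments and
  pregliders these are the elements 1 between comparable objects, including those into
  \<infinity>.\<close>

locale separated_modules =
  fixes U :: "'u set set" and A :: "('o, 'm) preadd" and E :: "'o \<Rightarrow> 'o \<Rightarrow> 'm set"
  assumes universe: "universe U"
    and E: "\<And>x y. x \<in> Obj A \<Longrightarrow> y \<in> Obj A \<Longrightarrow> E x y \<subseteq> Hom A x y"
begin

definition sep :: "('o, 'm, 'u) amod \<Rightarrow> bool" where
  "sep M \<longleftrightarrow> (\<forall>x\<in>Obj A. \<forall>y\<in>Obj A. \<forall>e\<in>E x y. on_hom M x y e \<in> mon (on_obj M x) (on_obj M y))"

lemma sep_iff:
  assumes M: "is_module U A M"
  shows "sep M \<longleftrightarrow> (\<forall>x\<in>Obj A. \<forall>y\<in>Obj A. \<forall>e\<in>E x y. \<forall>a\<in>carr M x.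
    on_hom M x y e a = \<one>\<^bsub>on_obj M y\<^esub> \<longrightarrow> a = \<one>\<^bsub>on_obj M x\<^esub>)"
proof -
  have "on_hom M x y e \<in> mon (on_obj M x) (on_obj M y) \<longleftrightarrow>
      (\<forall>a\<in>carr M x. on_hom M x y e a = \<one>\<^bsub>on_obj M y\<^esub> \<longrightarrow> a = \<one>\<^bsub>on_obj M x\<^esub>)"
    if xy: "x \<in> Obj A" "y \<in> Obj A" "e \<in> E x y" for x y e
  proof -
    have e: "e \<in> Hom A x y" using E xy by blast
    interpret group_hom "on_obj M x" "on_obj M y" "on_hom M x y e"
      by (intro group_hom.intro group_hom_axioms.intro module_group'[OF M] module_hom[OF M] xy e)
    show ?thesis unfolding mon_def using inj_on_one_iff homh by auto
  qed
  then show ?thesis unfolding sep_def by simp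
qed

lemma sepD:
  assumes "is_module U A M" "sep M" "x \<in> Obj A" "y \<in> Obj A" "e \<in> E x y"
    "a \<in> carr M x" "on_hom M x y e a = \<one>\<^bsub>on_obj M y\<^esub>"
  shows "a = \<one>\<^bsub>on_obj M x\<^esub>"
  using assms sep_iff by blast

lemma sep_injD:
  assumes "is_module U A M" "sep M" "x \<in> Obj A" "y \<in> Obj A" "e \<in> E x y"
    "a \<in> carr M x" "b \<in> carr M x" "on_hom M x y e a = on_hom M x y e b"
  shows "a = b"
  using assms unfolding sep_def mon_def inj_on_def by blast

text \<open>If an arrow of \<open>E\<close> kills \<open>a\<close>, then it kills the image of
  \<open>a\<close> under every map to a separated module, by naturality; so that image is trivial
  and no such map detects \<open>a\<close>.\<close>

sublocale cogenerated_class U A sep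
proof
  show "universe U" by (rule universe)
  fix M assume M: "is_module U A M" and cog: "\<And>x a. \<lbrakk>x \<in> Obj A; a \<in> carr M x; a \<noteq> \<one>\<^bsub>on_obj M x\<^esub>\<rbrakk> \<Longrightarrow>
        \<exists>Y t. is_module U A Y \<and> sep Y \<and> nat_trans A M Y t \<and> t x a \<noteq> \<one>\<^bsub>on_obj Y x\<^esub>"
  show "sep M"
    unfolding sep_iff[OF M]
  proof (intro ballI impI, rule ccontr)
    fix x y e a assume xy: "x \<in> Obj A" "y \<in> Obj A" "e \<in> E x y" and a: "a \<in> carr M x"
      and ea: "on_hom M x y e a = \<one>\<^bsub>on_obj M y\<^esub>" and ne: "a \<noteq> \<one>\<^bsub>on_obj M x\<^esub>"
    obtain Y t where Y: "is_module U A Y" "sep Y" and t: "nat_trans A M Y t" and ta: "t x a \<noteq> \<one>\<^bsub>on_obj Y x\<^esub>"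
      using cog[OF xy(1) a ne] by blast
    have e: "e \<in> Hom A x y" using E xy by blast
    have "on_hom Y x y e (t x a) = \<one>\<^bsub>on_obj Y y\<^esub>"
      using nat_trans_natural[OF t xy(1,2) e a] ea nat_trans_one[OF t M Y(1) xy(2)] by simp
    then show False using sepD[OF Y xy nat_trans_closed[OF t xy(1) a]] ta by blast
  qed
qed

text \<open>
  \<open>Q\<close> is the pushout \<open>(X \<oplus> Y)/Z\<close> of all modules; it is separated because \<open>X/f(Z)\<close> embeds into \<open>W\<close>.
\<close>

lemma kernel_pushout_injective:
  assumes X: "is_module U A X" "sep X" and Y: "is_module U A Y" "sep Y" and Z: "is_module U A Z" "sep Z"
    and f: "nat_trans A Z X f" and g: "nat_trans A Z Y g"
    and W: "is_module U A W" "sep W" and h: "nat_trans A X W h" and k: "is_kernel \<C> X W h Z f"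
  obtains Q q1 q2 where "is_module U A Q" "sep Q" "nat_trans A X Q q1" "nat_trans A Y Q q2"
    "\<And>x z. \<lbrakk>x \<in> Obj A; z \<in> carr Z x\<rbrakk> \<Longrightarrow> q1 x (f x z) = q2 x (g x z)"
    "\<And>x b. \<lbrakk>x \<in> Obj A; b \<in> carr Y x; q2 x b = \<one>\<^bsub>on_obj Q x\<^esub>\<rbrakk> \<Longrightarrow> b = \<one>\<^bsub>on_obj Y x\<^esub>"
proof -
  let ?B = "pair_module X Y"
  have B: "is_module UNIV A ?B" by (rule is_module_pair[OF X(1) Y(1)])
  have carrB: "carr ?B x = carr X x \<times> carr Y x" for x by (simp add: pair_module_def DirProd_def)
  have multB: "(a, b) \<otimes>\<^bsub>on_obj ?B x\<^esub> (a', b') = (a \<otimes>\<^bsub>on_obj X x\<^esub> a', b \<otimes>\<^bsub>on_obj Y x\<^esub> b')" for x a b a' b'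
    by (simp add: pair_module_def DirProd_def)
  have oneB: "\<one>\<^bsub>on_obj ?B x\<^esub> = (\<one>\<^bsub>on_obj X x\<^esub>, \<one>\<^bsub>on_obj Y x\<^esub>)" for x
    by (simp add: pair_module_def DirProd_def)
  have homB: "on_hom ?B x y k (a, b) = (on_hom X x y k a, on_hom Y x y k b)" if "a \<in> carr X x" "b \<in> carr Y x" for x y k a b
    using that by (simp add: pair_module_def)
  \<comment> \<open>The antidiagonal copy of \<open>Z\<close> in the sum of \<open>X\<close> and
    \<open>Y\<close>; dividing by it identifies \<open>f z\<close> with \<open>g z\<close>.\<close>
  define N where "N x = (\<lambda>z. (f x z, inv\<^bsub>on_obj Y x\<^esub> g x z)) ` carr Z x" for x
  have N_sub: "subgroup (N x) (on_obj ?B x)" if x: "x \<in> Obj A" for x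
  proof -
    interpret Yx: comm_group "on_obj Y x" by (rule module_group[OF Y(1) x])
    have "(\<lambda>z. (f x z, inv\<^bsub>on_obj Y x\<^esub> g x z)) \<in> hom (on_obj Z x) (on_obj ?B x)"
      by (rule homI) (simp_all add: carrB multB nat_trans_closed[OF f x] nat_trans_closed[OF g x]
          nat_trans_mult[OF f x] nat_trans_mult[OF g x] Yx.inv_mult)
    then show ?thesis
      unfolding N_def
      by (intro group_hom.img_is_subgroup group_hom.intro group_hom_axioms.intro
          module_group'[OF Z(1) x] module_group'[OF B x])
  qed
  have B_small: "small_set U (carr ?B x)" if x: "x \<in> Obj A" for x
    unfolding carrB by (intro small_Times[OF universe] small_member module_carrier[OF X(1) x] module_carrier[OF Y(1) x])
  have "\<exists>(H :: 'u monoid) r. comm_group H \<and> carrier H \<in> U \<and> r \<in> hom (on_obj ?B x) H \<and> r ` carr ?B x = carrier H \<and>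
      (\<forall>a\<in>carr ?B x. r a = \<one>\<^bsub>H\<^esub> \<longleftrightarrow> a \<in> N x)" if x: "x \<in> Obj A" for x
    by (rule quotient_group_copy[OF universe module_group[OF B x] B_small[OF x] N_sub[OF x]])
  then obtain G :: "'o \<Rightarrow> 'u monoid" and r where
    G: "\<And>x. x \<in> Obj A \<Longrightarrow> comm_group (G x) \<and> carrier (G x) \<in> U" and
    r: "\<And>x. x \<in> Obj A \<Longrightarrow> r x \<in> hom (on_obj ?B x) (G x) \<and> r x ` carr ?B x = carrier (G x)" and
    r_ker: "\<And>x a. x \<in> Obj A \<Longrightarrow> a \<in> carr ?B x \<Longrightarrow> r x a = \<one>\<^bsub>G x\<^esub> \<longleftrightarrow> a \<in> N x" by metis
  have N_stable: "on_hom ?B x y k c \<in> N y" if xy: "x \<in> Obj A" "y \<in> Obj A" "k \<in> Hom A x y" and c: "c \<in> N x" for x y k c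
  proof -
    obtain z where z: "z \<in> carr Z x" "c = (f x z, inv\<^bsub>on_obj Y x\<^esub> g x z)" using c by (auto simp: N_def)
    have "on_hom ?B x y k c = (f y (on_hom Z x y k z), inv\<^bsub>on_obj Y y\<^esub> g y (on_hom Z x y k z))"
      using z nat_trans_closed[OF f xy(1) z(1)] nat_trans_closed[OF g xy(1) z(1)]
      by (simp add: homB module_inv[OF Y(1) xy(1)] nat_trans_natural[OF f xy z(1)] nat_trans_natural[OF g xy z(1)]
          module_hom_inv[OF Y(1) xy])
    then show ?thesis unfolding N_def using module_closed[OF Z(1) xy z(1)] by blast
  qed
  obtain Q where Q: "is_module U A Q" "on_obj Q = G" and
    Q_hom: "\<And>x y k c. \<lbrakk>x \<in> Obj A; y \<in> Obj A; k \<in> Hom A x y; c \<in> carr ?B x\<rbrakk> \<Longrightarrow>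
      on_hom Q x y k (r x c) = r y (on_hom ?B x y k c)"
  proof (rule module_image[OF B G r])
    show "r y (on_hom ?B x y k c) = \<one>\<^bsub>G y\<^esub>"
      if "x \<in> Obj A" "y \<in> Obj A" "k \<in> Hom A x y" "c \<in> carr ?B x" "r x c = \<one>\<^bsub>G x\<^esub>" for x y k c
      using that r_ker N_stable module_closed[OF B] by metis
  qed (assumption | (rule that; assumption))+
  have r_in: "r x c \<in> carr Q x" if "x \<in> Obj A" "c \<in> carr ?B x" for x c using r that Q(2) by auto
  have r_mult: "r x (c \<otimes>\<^bsub>on_obj ?B x\<^esub> d) = r x c \<otimes>\<^bsub>on_obj Q x\<^esub> r x d"
    if "x \<in> Obj A" "c \<in> carr ?B x" "d \<in> carr ?B x" for x c d
    using r that Q(2) unfolding hom_def by auto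
  have f_inj: "inj_on (f x) (carr Z x)" and f_image: "f x ` carr Z x = {a \<in> carr X x. h x a = \<one>\<^bsub>on_obj W x\<^esub>}"
    if "x \<in> Obj A" for x
    using is_kernelD[OF X W h k that] by auto
  have "sep Q"
    unfolding sep_iff[OF Q(1)]
  proof (intro ballI impI)
    fix x y e q assume xy: "x \<in> Obj A" "y \<in> Obj A" and e: "e \<in> E x y" and q: "q \<in> carr Q x"
      and eq: "on_hom Q x y e q = \<one>\<^bsub>on_obj Q y\<^esub>"
    have eH: "e \<in> Hom A x y" using E xy e by blast
    note xye = xy eH
    obtain a b where ab: "a \<in> carr X x" "b \<in> carr Y x" "q = r x (a, b)"
    proof -
      have "q \<in> r x ` (carr X x \<times> carr Y x)" using q r[OF xy(1)] Q(2) by (simp add: carrB)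
      then show thesis using that by auto
    qed
    then have abB: "(a, b) \<in> carr ?B x" by (simp add: carrB)
    have "r y (on_hom ?B x y e (a, b)) = \<one>\<^bsub>G y\<^esub>"
      using Q_hom[OF xye abB] eq ab(3) Q(2) by simp
    then have "on_hom ?B x y e (a, b) \<in> N y" using r_ker[OF xy(2) module_closed[OF B xye abB]] by blast
    then obtain z where z: "z \<in> carr Z y" "on_hom X x y e a = f y z" "on_hom Y x y e b = inv\<^bsub>on_obj Y y\<^esub> g y z"
      using homB[OF ab(1,2)] by (auto simp: N_def)
    \<comment> \<open>The extension argument. Modulo the image of \<open>f\<close>, which is the
      kernel of \<open>h\<close>, the element \<open>a\<close> embeds into the separated module
      \<open>W\<close>, so \<open>e\<close> killing the class of \<open>(a, b)\<close> forces
      \<open>a = f z'\<close>. Injectivity of \<open>f\<close> identifies \<open>e z'\<close> with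
      \<open>z\<close>, and injectivity of \<open>e\<close> on \<open>Y\<close> then determines
      \<open>b\<close>.\<close>
    have "h y (f y z) = \<one>\<^bsub>on_obj W y\<^esub>" using f_image[OF xy(2)] z(1) by blast
    then have "on_hom W x y e (h x a) = \<one>\<^bsub>on_obj W y\<^esub>"
      using nat_trans_natural[OF h xye ab(1)] z(2) by simp
    then have "h x a = \<one>\<^bsub>on_obj W x\<^esub>"
      using sepD[OF W xy e] nat_trans_closed[OF h xy(1) ab(1)] by blast
    then have "a \<in> f x ` carr Z x" using f_image[OF xy(1)] ab(1) by blast
    then obtain z' where z': "z' \<in> carr Z x" "a = f x z'" by blast
    have "f y (on_hom Z x y e z') = f y z"
      using nat_trans_natural[OF f xye z'(1)] z'(2) z(2) by simp
    then have zz: "on_hom Z x y e z' = z"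
      using inj_onD[OF f_inj[OF xy(2)]] module_closed[OF Z(1) xye z'(1)] z(1) by blast
    note gz' = nat_trans_closed[OF g xy(1) z'(1)]
    have "on_hom Y x y e b = on_hom Y x y e (inv\<^bsub>on_obj Y x\<^esub> g x z')"
      using z(3) zz nat_trans_natural[OF g xye z'(1)] module_hom_inv[OF Y(1) xye gz'] by simp
    then have "b = inv\<^bsub>on_obj Y x\<^esub> g x z'"
      using sep_injD[OF Y xy e ab(2) module_inv[OF Y(1) xy(1) gz']] by blast
    then have "(a, b) \<in> N x" unfolding N_def using z' by blast
    then show "q = \<one>\<^bsub>on_obj Q x\<^esub>" using r_ker[OF xy(1) abB] ab(3) Q(2) by simp
  qed
  note one = module_one[OF X(1)] module_one[OF Y(1)]
  note l_one = monoid.l_one[OF group.is_monoid[OF module_group'[OF X(1)]]] monoid.l_one[OF group.is_monoid[OF module_group'[OF Y(1)]]]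
  note r_one = monoid.r_one[OF group.is_monoid[OF module_group'[OF X(1)]]] monoid.r_one[OF group.is_monoid[OF module_group'[OF Y(1)]]]
  define q1 where "q1 = (\<lambda>x\<in>Obj A. \<lambda>a\<in>carr X x. r x (a, \<one>\<^bsub>on_obj Y x\<^esub>))"
  define q2 where "q2 = (\<lambda>x\<in>Obj A. \<lambda>b\<in>carr Y x. r x (\<one>\<^bsub>on_obj X x\<^esub>, b))"
  have q1: "nat_trans A X Q q1"
    unfolding q1_def
    by (rule nat_transI[OF X(1)])
      (simp_all add: r_in carrB one r_mult[symmetric] multB l_one Q_hom homB module_hom_one[OF Y(1)])
  have q2: "nat_trans A Y Q q2"
    unfolding q2_def
    by (rule nat_transI[OF Y(1)])
      (simp_all add: r_in carrB one r_mult[symmetric] multB l_one Q_hom homB module_hom_one[OF X(1)])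
  show thesis
  proof (rule that[OF Q(1) \<open>sep Q\<close> q1 q2])
    fix x z assume x: "x \<in> Obj A" and z: "z \<in> carr Z x"
    note fz = nat_trans_closed[OF f x z] and gz = nat_trans_closed[OF g x z]
    have n: "(f x z, inv\<^bsub>on_obj Y x\<^esub> g x z) \<in> N x" "(f x z, inv\<^bsub>on_obj Y x\<^esub> g x z) \<in> carr ?B x"
      using z fz module_inv[OF Y(1) x gz] by (auto simp: N_def carrB)
    have "(f x z, \<one>\<^bsub>on_obj Y x\<^esub>) = (f x z, inv\<^bsub>on_obj Y x\<^esub> g x z) \<otimes>\<^bsub>on_obj ?B x\<^esub> (\<one>\<^bsub>on_obj X x\<^esub>, g x z)"
      using fz gz x by (simp add: multB r_one group.l_inv[OF module_group'[OF Y(1) x]])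
    then have "r x (f x z, \<one>\<^bsub>on_obj Y x\<^esub>) = r x (\<one>\<^bsub>on_obj X x\<^esub>, g x z)"
      using r_mult[OF x n(2), of "(\<one>\<^bsub>on_obj X x\<^esub>, g x z)"] r_ker[OF x n(2)] n(1) gz one[OF x] Q r_in[OF x]
        monoid.l_one[OF group.is_monoid[OF module_group'[OF Q(1) x]]] by (simp add: carrB)
    then show "q1 x (f x z) = q2 x (g x z)" using x fz gz by (simp add: q1_def q2_def)
  next
    fix x b assume x: "x \<in> Obj A" and b: "b \<in> carr Y x" and "q2 x b = \<one>\<^bsub>on_obj Q x\<^esub>"
    then have "(\<one>\<^bsub>on_obj X x\<^esub>, b) \<in> N x"
      using r_ker[OF x, of "(\<one>\<^bsub>on_obj X x\<^esub>, b)"] one[OF x] Q(2) by (simp add: q2_def carrB)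
    then obtain z where z: "z \<in> carr Z x" "f x z = \<one>\<^bsub>on_obj X x\<^esub>" "b = inv\<^bsub>on_obj Y x\<^esub> g x z"
      by (auto simp: N_def)
    have "z = \<one>\<^bsub>on_obj Z x\<^esub>"
      using inj_onD[OF f_inj[OF x], of z "\<one>\<^bsub>on_obj Z x\<^esub>"] z nat_trans_one[OF f Z(1) X(1) x] module_one[OF Z(1) x] by simp
    then show "b = \<one>\<^bsub>on_obj Y x\<^esub>"
      using z(3) nat_trans_one[OF g Z(1) Y(1) x] monoid.inv_one[OF group.is_monoid, OF module_group'[OF Y(1) x]] by simp
  qed
qed

text \<open>Concretely, the pushed-out map \<open>p2\<close> is shown to be the kernel of the map
  \<open>v\<close> from the pushout to \<open>W\<close> that is \<open>h\<close> on \<open>X\<close>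
  and trivial on \<open>Y\<close>. This requires \<open>p2\<close> to be injective and
  \<open>M\<close> to be generated by the images of \<open>p1\<close> and \<open>p2\<close>.\<close>

lemma kernels_stable: "kernels_stable_under_pushout \<C>"
  unfolding kernels_stable_under_pushout_def cokernels_stable_under_pullback_def
proof (intro ballI allI impI, elim conjE bexE)
  fix X Y Z f g M p1 p2 W h
  assume "X \<in> Obj (dual \<C>)" "Y \<in> Obj (dual \<C>)" "Z \<in> Obj (dual \<C>)" "f \<in> Hom (dual \<C>) X Z" "g \<in> Hom (dual \<C>) Y Z"
    "W \<in> Obj (dual \<C>)" "h \<in> Hom (dual \<C>) W X"
  then have X: "is_module U A X" "sep X" and Y: "is_module U A Y" "sep Y" and Z: "is_module U A Z" "sep Z"
    and f: "nat_trans A Z X f" and g: "nat_trans A Z Y g"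
    and W: "is_module U A W" "sep W" and h: "nat_trans A X W h" by auto
  assume "is_cokernel (dual \<C>) W X h Z f" and pb: "is_pullback (dual \<C>) X Y Z f g M p1 p2"
  then have k: "is_kernel \<C> X W h Z f" by (simp add: is_cokernel_def)
  have M: "is_module U A M" "sep M" and p: "nat_trans A X M p1" "nat_trans A Y M p2"
    and "Comp \<C> Z X M p1 f = Comp \<C> Z Y M p2 g"
    and univ0: "\<And>V q1 q2. \<lbrakk>is_module U A V; sep V; nat_trans A X V q1; nat_trans A Y V q2;
      Comp \<C> Z X V q1 f = Comp \<C> Z Y V q2 g\<rbrakk> \<Longrightarrow>
      \<exists>!u. nat_trans A M V u \<and> Comp \<C> X M V u p1 = q1 \<and> Comp \<C> Y M V u p2 = q2"
    using pb unfolding is_pullback_def by auto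
  then have pfg: "\<And>x z. \<lbrakk>x \<in> Obj A; z \<in> carr Z x\<rbrakk> \<Longrightarrow> p1 x (f x z) = p2 x (g x z)"
    by (simp add: Comp_eq_Comp_iff)
  have univ: "\<exists>!u. nat_trans A M V u \<and> (\<forall>x\<in>Obj A. \<forall>a\<in>carr X x. u x (p1 x a) = q1 x a) \<and>
      (\<forall>x\<in>Obj A. \<forall>b\<in>carr Y x. u x (p2 x b) = q2 x b)"
    if "is_module U A V" "sep V" "nat_trans A X V q1" "nat_trans A Y V q2"
      "\<And>x z. \<lbrakk>x \<in> Obj A; z \<in> carr Z x\<rbrakk> \<Longrightarrow> q1 x (f x z) = q2 x (g x z)" for V q1 q2
    using univ0[OF that(1-4)] that(5) by (simp add: Comp_eq_Comp_iff Comp_eq_iff[OF that(3)] Comp_eq_iff[OF that(4)])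
  note f_image = is_kernelD(2)[OF X W h k]

  obtain v where v: "nat_trans A M W v" and v1: "\<forall>x\<in>Obj A. \<forall>a\<in>carr X x. v x (p1 x a) = h x a"
    and v2: "\<forall>x\<in>Obj A. \<forall>b\<in>carr Y x. v x (p2 x b) = \<one>\<^bsub>on_obj W x\<^esub>"
  proof -
    have "h x (f x z) = (\<lambda>x\<in>Obj A. \<lambda>b\<in>carr Y x. \<one>\<^bsub>on_obj W x\<^esub>) x (g x z)" if "x \<in> Obj A" "z \<in> carr Z x" for x z
      using f_image[OF that(1)] that nat_trans_closed[OF g that] by auto
    from univ[OF W h nat_trans_one_trans[OF Y(1) W(1)] this] show thesis using that by auto
  qed

  \<comment> \<open>The map from \<open>Y\<close> to the quotient \<open>Q\<close> is injective and
    factors through \<open>p2\<close>, because \<open>Q\<close> is separated and hence receives a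
    map from the pushout.\<close>
  have p2_inj: "inj_on (p2 x) (carr Y x)" if x: "x \<in> Obj A" for x
  proof -
    obtain Q q1 q2 where Q: "is_module U A Q" "sep Q" "nat_trans A X Q q1" "nat_trans A Y Q q2"
      "\<And>x z. \<lbrakk>x \<in> Obj A; z \<in> carr Z x\<rbrakk> \<Longrightarrow> q1 x (f x z) = q2 x (g x z)"
      and triv: "\<And>x b. \<lbrakk>x \<in> Obj A; b \<in> carr Y x; q2 x b = \<one>\<^bsub>on_obj Q x\<^esub>\<rbrakk> \<Longrightarrow> b = \<one>\<^bsub>on_obj Y x\<^esub>"
      by (rule kernel_pushout_injective[OF X Y Z f g W h k]) blast
    obtain u where u: "nat_trans A M Q u" "\<forall>x\<in>Obj A. \<forall>b\<in>carr Y x. u x (p2 x b) = q2 x b"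
      using univ[OF Q] by blast
    show ?thesis
    proof (rule nat_trans_injI[OF p(2) Y(1) M(1) x])
      fix b assume b: "b \<in> carr Y x" and "p2 x b = \<one>\<^bsub>on_obj M x\<^esub>"
      then have "q2 x b = \<one>\<^bsub>on_obj Q x\<^esub>" using u(2) x nat_trans_one[OF u(1) M(1) Q(1) x] by metis
      then show "b = \<one>\<^bsub>on_obj Y x\<^esub>" using triv[OF x b] by blast
    qed
  qed

  define T where "T x = (\<lambda>(a, b). p1 x a \<otimes>\<^bsub>on_obj M x\<^esub> p2 x b) ` (carr X x \<times> carr Y x)" for x
  have TI: "p1 x a \<otimes>\<^bsub>on_obj M x\<^esub> p2 x b \<in> T x" if "a \<in> carr X x" "b \<in> carr Y x" for x a b
    using that by (auto simp: T_def)
  have TE: "\<exists>a\<in>carr X x. \<exists>b\<in>carr Y x. m = p1 x a \<otimes>\<^bsub>on_obj M x\<^esub> p2 x b" if "m \<in> T x" for x m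
    using that by (auto simp: T_def)
  have T_sub: "subgroup (T x) (on_obj M x)" if x: "x \<in> Obj A" for x
  proof -
    interpret Mx: comm_group "on_obj M x" by (rule module_group[OF M(1) x])
    note p_in = nat_trans_closed[OF p(1) x] nat_trans_closed[OF p(2) x]
    show ?thesis
    proof
      show "T x \<subseteq> carr M x" using p_in by (auto simp: T_def)
      show "\<one>\<^bsub>on_obj M x\<^esub> \<in> T x"
        using TI[OF module_one[OF X(1) x] module_one[OF Y(1) x]] nat_trans_one[OF p(1) X(1) M(1) x]
          nat_trans_one[OF p(2) Y(1) M(1) x] by simp
      fix m assume "m \<in> T x"
      then obtain a b where ab: "a \<in> carr X x" "b \<in> carr Y x" "m = p1 x a \<otimes>\<^bsub>on_obj M x\<^esub> p2 x b" using TE by blast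
      show "inv\<^bsub>on_obj M x\<^esub> m \<in> T x"
        using TI[OF module_inv[OF X(1) x ab(1)] module_inv[OF Y(1) x ab(2)]] ab p_in
          nat_trans_inv[OF p(1) X(1) M(1) x ab(1)] nat_trans_inv[OF p(2) Y(1) M(1) x ab(2)] by (simp add: Mx.inv_mult)
      fix m' assume "m' \<in> T x"
      then obtain a' b' where ab': "a' \<in> carr X x" "b' \<in> carr Y x" "m' = p1 x a' \<otimes>\<^bsub>on_obj M x\<^esub> p2 x b'" using TE by blast
      show "m \<otimes>\<^bsub>on_obj M x\<^esub> m' \<in> T x"
        using TI[OF module_mult[OF X(1) x ab(1) ab'(1)] module_mult[OF Y(1) x ab(2) ab'(2)]] ab ab' p_in
          nat_trans_mult[OF p(1) x ab(1) ab'(1)] nat_trans_mult[OF p(2) x ab(2) ab'(2)] by (simp add: Mx.m_ac)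
    qed
  qed
  have T_stable: "on_hom M x y k m \<in> T y" if xy: "x \<in> Obj A" "y \<in> Obj A" "k \<in> Hom A x y" and m: "m \<in> T x" for x y k m
  proof -
    obtain a b where ab: "a \<in> carr X x" "b \<in> carr Y x" "m = p1 x a \<otimes>\<^bsub>on_obj M x\<^esub> p2 x b" using TE[OF m] by blast
    show ?thesis
      using TI[OF module_closed[OF X(1) xy ab(1)] module_closed[OF Y(1) xy ab(2)]] ab(3)
        module_hom_mult[OF M(1) xy nat_trans_closed[OF p(1) xy(1) ab(1)] nat_trans_closed[OF p(2) xy(1) ab(2)]]
        nat_trans_natural[OF p(1) xy ab(1)] nat_trans_natural[OF p(2) xy ab(2)] by simp
  qed
  note I = submodule_in[OF M T_sub T_stable]
  \<comment> \<open>The submodule \<open>T\<close> also has the universal property of the pushout.\<close>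
  have T_all: "T x = carr M x" if x: "x \<in> Obj A" for x
  proof -
    have pT: "p1 x a \<in> T x" "p2 x b \<in> T x" if "x \<in> Obj A" "a \<in> carr X x" "b \<in> carr Y x" for x a b
      using TI[OF that(2) module_one[OF Y(1) that(1)]] TI[OF module_one[OF X(1) that(1)] that(3)]
        nat_trans_one[OF p(1) X(1) M(1) that(1)] nat_trans_one[OF p(2) Y(1) M(1) that(1)]
        nat_trans_closed[OF p(1) that(1,2)] nat_trans_closed[OF p(2) that(1,3)]
        monoid.l_one[OF group.is_monoid[OF module_group'[OF M(1) that(1)]]]
        monoid.r_one[OF group.is_monoid[OF module_group'[OF M(1) that(1)]]] by simp_all
    have p1T: "nat_trans A X (submodule M T) p1"
      by (rule factor_through_submodule[OF X(1) p(1)]) (use pT module_one[OF Y(1)] in blast)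
    have p2T: "nat_trans A Y (submodule M T) p2"
      by (rule factor_through_submodule[OF Y(1) p(2)]) (use pT module_one[OF X(1)] in blast)
    obtain r where r: "nat_trans A M (submodule M T) r" "\<forall>x\<in>Obj A. \<forall>a\<in>carr X x. r x (p1 x a) = p1 x a"
      "\<forall>x\<in>Obj A. \<forall>b\<in>carr Y x. r x (p2 x b) = p2 x b"
      using univ[OF I(1,2) p1T p2T pfg] by blast
    let ?ir = "\<lambda>x\<in>Obj A. \<lambda>m\<in>carr M x. (\<lambda>x\<in>Obj A. \<lambda>a\<in>T x. a) x (r x m)" and ?id = "\<lambda>x\<in>Obj A. \<lambda>m\<in>carr M x. m"
    have "nat_trans A M M ?ir \<and> (\<forall>x\<in>Obj A. \<forall>a\<in>carr X x. ?ir x (p1 x a) = p1 x a) \<and>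
        (\<forall>x\<in>Obj A. \<forall>b\<in>carr Y x. ?ir x (p2 x b) = p2 x b)"
      using nat_trans_Comp[OF M(1) r(1) I(3)] r(2,3) nat_trans_closed[OF p1T] nat_trans_closed[OF p2T]
        nat_trans_closed[OF p(1)] nat_trans_closed[OF p(2)] by simp
    moreover have "nat_trans A M M ?id \<and> (\<forall>x\<in>Obj A. \<forall>a\<in>carr X x. ?id x (p1 x a) = p1 x a) \<and>
        (\<forall>x\<in>Obj A. \<forall>b\<in>carr Y x. ?id x (p2 x b) = p2 x b)"
      using nat_trans_Ident[OF M(1)] nat_trans_closed[OF p(1)] nat_trans_closed[OF p(2)] by simp
    ultimately have eq: "?ir = ?id" using univ[OF M p pfg] by blast
    have "m \<in> T x" if m: "m \<in> carr M x" for m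
      using restrict_restrict_eqD[OF eq x m] nat_trans_closed[OF r(1) x m] x by simp
    then show ?thesis using subgroup.subset[OF T_sub[OF x]] by blast
  qed

  have "is_kernel \<C> M W v Y p2"
  proof (rule is_kernelI[OF M W v Y p(2) p2_inj])
    fix x assume x: "x \<in> Obj A"
    interpret Wx: comm_group "on_obj W x" by (rule module_group[OF W(1) x])
    show "p2 x ` carr Y x = {m \<in> carr M x. v x m = \<one>\<^bsub>on_obj W x\<^esub>}"
    proof (intro equalityI subsetI)
      fix m assume "m \<in> {m \<in> carr M x. v x m = \<one>\<^bsub>on_obj W x\<^esub>}"
      then have m: "m \<in> T x" "v x m = \<one>\<^bsub>on_obj W x\<^esub>" using T_all[OF x] by auto
      then obtain a b where ab: "a \<in> carr X x" "b \<in> carr Y x" "m = p1 x a \<otimes>\<^bsub>on_obj M x\<^esub> p2 x b" using TE by blast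
      \<comment> \<open>If \<open>v\<close> kills \<open>m\<close>, then \<open>a\<close> lies in
        the kernel of \<open>h\<close>, so \<open>a = f z\<close>, and
        \<open>p1 (f z) = p2 (g z)\<close> moves this part of \<open>m\<close> into the image of
        \<open>p2\<close>.\<close>
      have "v x m = h x a"
        using nat_trans_mult[OF v x nat_trans_closed[OF p(1) x ab(1)] nat_trans_closed[OF p(2) x ab(2)]]
          v1 v2 x ab nat_trans_closed[OF h x ab(1)] by simp
      then have "a \<in> f x ` carr Z x" using f_image[OF x] ab(1) m(2) by simp
      then obtain z where z: "z \<in> carr Z x" "a = f x z" by blast
      have "m = p2 x (g x z \<otimes>\<^bsub>on_obj Y x\<^esub> b)"
        using ab(3) z pfg[OF x z(1)] nat_trans_mult[OF p(2) x nat_trans_closed[OF g x z(1)] ab(2)] by simp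
      then show "m \<in> p2 x ` carr Y x"
        using module_mult[OF Y(1) x nat_trans_closed[OF g x z(1)] ab(2)] by blast
    qed (use v2 x nat_trans_closed[OF p(2) x] in auto)
  qed
  then show "\<exists>w\<in>Obj (dual \<C>). \<exists>h\<in>Hom (dual \<C>) w M. is_cokernel (dual \<C>) w M h Y p2"
    using W v by (intro bexI[of _ W] bexI[of _ v]) (simp_all add: is_cokernel_def)
qed

lemma quasi_abelian: "quasi_abelian \<C>"
  unfolding quasi_abelian_def inflation_quasi_abelian_def
  using deflation_quasi_abelian pre_abelian kernels_stable by blast

end

section \<open>Prefragments and pregliders\<close>

lemma module_extensional:
  assumes "is_module U A M" "x \<in> Obj A" "y \<in> Obj A" "f \<in> Hom A x y"
  shows "on_hom M x y f \<in> extensional (carr M x)"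
  using assms unfolding is_module_def by blast

lemma is_module_cong:
  assumes M: "is_module U A M"
    and closed: "\<And>x. x \<in> Obj A \<Longrightarrow> Ident A x \<in> Hom A x x"
      "\<And>x y z f g. \<lbrakk>x \<in> Obj A; y \<in> Obj A; z \<in> Obj A; f \<in> Hom A x y; g \<in> Hom A y z\<rbrakk> \<Longrightarrow> Comp A x y z g f \<in> Hom A x z"
      "\<And>x y f g. \<lbrakk>x \<in> Obj A; y \<in> Obj A; f \<in> Hom A x y; g \<in> Hom A x y\<rbrakk> \<Longrightarrow> Plus A x y f g \<in> Hom A x y"
    and obj: "\<And>x. x \<in> Obj A \<Longrightarrow> on_obj N x = on_obj M x"
    and hom: "\<And>x y f. \<lbrakk>x \<in> Obj A; y \<in> Obj A; f \<in> Hom A x y\<rbrakk> \<Longrightarrow> on_hom N x y f = on_hom M x y f"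
  shows "is_module U A N"
  using M unfolding is_module_def by (simp add: closed obj hom)

lemma nat_trans_inverse:
  assumes M: "is_module U A M" and N: "is_module V A N" and s: "nat_trans A M N s"
    and bij: "\<And>x. x \<in> Obj A \<Longrightarrow> bij_betw (s x) (carr M x) (carr N x)"
  obtains t where "nat_trans A N M t"
    "\<And>x a. x \<in> Obj A \<Longrightarrow> a \<in> carr M x \<Longrightarrow> t x (s x a) = a"
    "\<And>x b. x \<in> Obj A \<Longrightarrow> b \<in> carr N x \<Longrightarrow> s x (t x b) = b"
proof -
  define u where "u x = inv_into (carr M x) (s x)" for x
  have us: "u x (s x a) = a" if "x \<in> Obj A" "a \<in> carr M x" for x a
    unfolding u_def by (rule bij_betw_inv_into_left[OF bij[OF that(1)] that(2)])
  have su: "s x (u x b) = b" if "x \<in> Obj A" "b \<in> carr N x" for x b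
    unfolding u_def by (rule bij_betw_inv_into_right[OF bij[OF that(1)] that(2)])
  have u: "u x b \<in> carr M x" if "x \<in> Obj A" "b \<in> carr N x" for x b
    using bij_betw_apply[OF bij_betw_inv_into[OF bij[OF that(1)]] that(2)] unfolding u_def .
  have "nat_trans A N M (\<lambda>x\<in>Obj A. \<lambda>b\<in>carr N x. u x b)"
  proof (rule nat_transI[OF N])
    fix x b assume x: "x \<in> Obj A" and b: "b \<in> carr N x"
    show "u x b \<in> carr M x" by (rule u[OF x b])
    show "u x (b \<otimes>\<^bsub>on_obj N x\<^esub> c) = u x b \<otimes>\<^bsub>on_obj M x\<^esub> u x c" if c: "c \<in> carr N x" for c
      using us[OF x module_mult[OF M x u[OF x b] u[OF x c]]] nat_trans_mult[OF s x u[OF x b] u[OF x c]]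
      by (simp add: su x b c)
    show "u y (on_hom N x y f b) = on_hom M x y f (u x b)" if y: "y \<in> Obj A" "f \<in> Hom A x y" for y f
      using us[OF y(1) module_closed[OF M x y u[OF x b]]] nat_trans_natural[OF s x y u[OF x b]]
      by (simp add: su x b)
  qed
  then show thesis by (rule that) (simp_all add: us su u nat_trans_closed[OF s])
qed

locale glider_setting = filtered_ring \<Gamma> leq R F
  for \<Gamma> :: "('g, 'c) monoid_scheme" and leq :: "'g rel" and R :: "('r, 'd) ring_scheme" and F :: "'g \<Rightarrow> 'r set" +
  fixes \<Lambda> :: "'g set" and U :: "'u set set"
  assumes universe: "universe U" and small_\<Gamma>: "small_set U (carrier \<Gamma>)" and small_R: "small_set U (carrier R)"
    and \<Lambda>: "\<Lambda> \<subseteq> carrier \<Gamma>"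
begin

abbreviation "\<A> \<equiv> filtration_category \<Gamma> leq R F \<Lambda>"
abbreviation "\<B> \<equiv> filtration_category_inf \<Gamma> leq R F \<Lambda>"

section \<open>The filtration categories with and without \<infinity>\<close>

lemma A_simps [simp]:
  "Obj \<A> = \<Lambda>" "Ident \<A> \<alpha> = \<one>\<^bsub>R\<^esub>" "Comp \<A> \<alpha> \<beta> \<gamma> b a = b \<otimes>\<^bsub>R\<^esub> a" "Plus \<A> \<alpha> \<beta> a b = a \<oplus>\<^bsub>R\<^esub> b"
  by (simp_all add: filtration_category_def)

lemma Hom_A: "Hom \<A> \<alpha> \<beta> = (if (\<alpha>, \<beta>) \<in> leq then F (\<beta> \<otimes>\<^bsub>\<Gamma>\<^esub> inv\<^bsub>\<Gamma>\<^esub> \<alpha>) else {\<zero>\<^bsub>R\<^esub>})"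
  by (simp add: filtration_category_def)

lemma B_simps [simp]:
  "Obj \<B> = insert None (Some ` \<Lambda>)" "Ident \<B> x = \<one>\<^bsub>R\<^esub>" "Comp \<B> x y z b a = b \<otimes>\<^bsub>R\<^esub> a"
  "Plus \<B> x y a b = a \<oplus>\<^bsub>R\<^esub> b"
  "Hom \<B> (Some \<alpha>) (Some \<beta>) = Hom \<A> \<alpha> \<beta>" "Hom \<B> None (Some \<beta>) = {\<zero>\<^bsub>R\<^esub>}" "Hom \<B> x None = carrier R"
  by (simp_all add: filtration_category_inf_def split: option.splits)

lemma leq_refl: "\<alpha> \<in> carrier \<Gamma> \<Longrightarrow> (\<alpha>, \<alpha>) \<in> leq"
  using partial_order by (simp add: partial_order_on_def preorder_on_def refl_on_def)

lemma leq_trans: "(\<alpha>, \<beta>) \<in> leq \<Longrightarrow> (\<beta>, \<gamma>) \<in> leq \<Longrightarrow> (\<alpha>, \<gamma>) \<in> leq"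
  using partial_order unfolding partial_order_on_def preorder_on_def trans_def by blast

lemma F_sub: "\<gamma> \<in> carrier \<Gamma> \<Longrightarrow> F \<gamma> \<subseteq> carrier R"
  using additive_subgroup.a_subset[OF additive_subgroup] .

lemma degree_closed: "\<alpha> \<in> \<Lambda> \<Longrightarrow> \<beta> \<in> \<Lambda> \<Longrightarrow> \<beta> \<otimes>\<^bsub>\<Gamma>\<^esub> inv\<^bsub>\<Gamma>\<^esub> \<alpha> \<in> carrier \<Gamma>"
  using \<Lambda> by (intro m_closed inv_closed) auto

lemma Hom_A_carrier: "\<alpha> \<in> \<Lambda> \<Longrightarrow> \<beta> \<in> \<Lambda> \<Longrightarrow> Hom \<A> \<alpha> \<beta> \<subseteq> carrier R"
  using F_sub[OF degree_closed] by (simp add: Hom_A)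

lemma zero_Hom_A: "\<alpha> \<in> \<Lambda> \<Longrightarrow> \<beta> \<in> \<Lambda> \<Longrightarrow> \<zero>\<^bsub>R\<^esub> \<in> Hom \<A> \<alpha> \<beta>"
  using additive_subgroup.zero_closed[OF additive_subgroup[OF degree_closed]] by (simp add: Hom_A)

text \<open>Multiplying \<open>\<alpha> \<le> \<beta>\<close> on the right by the inverse of
  \<alpha> shows that the degree of the hom set is at least the unit, so it contains the filtration
  piece of the unit.\<close>

lemma one_Hom_A:
  assumes "\<alpha> \<in> \<Lambda>" "\<beta> \<in> \<Lambda>" "(\<alpha>, \<beta>) \<in> leq" shows "\<one>\<^bsub>R\<^esub> \<in> Hom \<A> \<alpha> \<beta>"
proof -
  have a: "\<alpha> \<in> carrier \<Gamma>" using assms \<Lambda> by blast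
  have "(\<alpha> \<otimes>\<^bsub>\<Gamma>\<^esub> inv\<^bsub>\<Gamma>\<^esub> \<alpha>, \<beta> \<otimes>\<^bsub>\<Gamma>\<^esub> inv\<^bsub>\<Gamma>\<^esub> \<alpha>) \<in> leq"
    using mult_mono assms(3) leq_refl a by blast
  then have "(\<one>\<^bsub>\<Gamma>\<^esub>, \<beta> \<otimes>\<^bsub>\<Gamma>\<^esub> inv\<^bsub>\<Gamma>\<^esub> \<alpha>) \<in> leq" using a by simp
  then show ?thesis using mono one_in assms(3) by (auto simp: Hom_A)
qed

text \<open>For comparable objects the degrees telescope. If one of the two pairs is incomparable,
  then one factor is 0 and so is the product, even when \<alpha> and \<gamma> are
  comparable.\<close>

lemma Comp_Hom_A:
  assumes "\<alpha> \<in> \<Lambda>" "\<beta> \<in> \<Lambda>" "\<gamma> \<in> \<Lambda>" "a \<in> Hom \<A> \<alpha> \<beta>" "b \<in> Hom \<A> \<beta> \<gamma>"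
  shows "b \<otimes>\<^bsub>R\<^esub> a \<in> Hom \<A> \<alpha> \<gamma>"
proof (cases "(\<alpha>, \<beta>) \<in> leq \<and> (\<beta>, \<gamma>) \<in> leq")
  case True
  have c: "\<alpha> \<in> carrier \<Gamma>" "\<beta> \<in> carrier \<Gamma>" "\<gamma> \<in> carrier \<Gamma>" using assms \<Lambda> by auto
  have "b \<otimes>\<^bsub>R\<^esub> a \<in> F ((\<gamma> \<otimes>\<^bsub>\<Gamma>\<^esub> inv\<^bsub>\<Gamma>\<^esub> \<beta>) \<otimes>\<^bsub>\<Gamma>\<^esub> (\<beta> \<otimes>\<^bsub>\<Gamma>\<^esub> inv\<^bsub>\<Gamma>\<^esub> \<alpha>))"
    using True assms(4,5) c by (intro mult_in) (simp_all add: Hom_A)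
  also have "(\<gamma> \<otimes>\<^bsub>\<Gamma>\<^esub> inv\<^bsub>\<Gamma>\<^esub> \<beta>) \<otimes>\<^bsub>\<Gamma>\<^esub> (\<beta> \<otimes>\<^bsub>\<Gamma>\<^esub> inv\<^bsub>\<Gamma>\<^esub> \<alpha>) = \<gamma> \<otimes>\<^bsub>\<Gamma>\<^esub> inv\<^bsub>\<Gamma>\<^esub> \<alpha>"
    using c by (simp add: m_assoc) (simp add: m_assoc[symmetric])
  finally show ?thesis using True leq_trans by (auto simp: Hom_A)
next
  case False
  then have "a = \<zero>\<^bsub>R\<^esub> \<or> b = \<zero>\<^bsub>R\<^esub>" using assms by (auto simp: Hom_A)
  moreover have "a \<in> carrier R" "b \<in> carrier R" using assms Hom_A_carrier by blast+
  ultimately have "b \<otimes>\<^bsub>R\<^esub> a = \<zero>\<^bsub>R\<^esub>" by auto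
  then show ?thesis using zero_Hom_A assms by simp
qed

lemma Plus_Hom_A:
  assumes "\<alpha> \<in> \<Lambda>" "\<beta> \<in> \<Lambda>" "a \<in> Hom \<A> \<alpha> \<beta>" "b \<in> Hom \<A> \<alpha> \<beta>"
  shows "a \<oplus>\<^bsub>R\<^esub> b \<in> Hom \<A> \<alpha> \<beta>"
  using assms additive_subgroup.a_closed[OF additive_subgroup[OF degree_closed]] by (simp add: Hom_A split: if_splits)

lemma Hom_B_carrier: "x \<in> Obj \<B> \<Longrightarrow> y \<in> Obj \<B> \<Longrightarrow> a \<in> Hom \<B> x y \<Longrightarrow> a \<in> carrier R"
  using Hom_A_carrier[THEN subsetD] by auto

lemma zero_Hom_B: "x \<in> Obj \<B> \<Longrightarrow> y \<in> Obj \<B> \<Longrightarrow> \<zero>\<^bsub>R\<^esub> \<in> Hom \<B> x y"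
  using zero_Hom_A by auto

lemma one_Hom_B: "x \<in> Obj \<B> \<Longrightarrow> y \<in> Obj \<B> \<Longrightarrow> leq_inf leq x y \<Longrightarrow> \<one>\<^bsub>R\<^esub> \<in> Hom \<B> x y"
  using one_Hom_A by (auto simp: leq_inf_def)

lemma Ident_Hom_B: "x \<in> Obj \<B> \<Longrightarrow> \<one>\<^bsub>R\<^esub> \<in> Hom \<B> x x"
  using one_Hom_B[of x x] leq_refl \<Lambda> by (cases x) (auto simp: leq_inf_def)

lemma Comp_Hom_B:
  assumes "x \<in> Obj \<B>" "y \<in> Obj \<B>" "z \<in> Obj \<B>" "a \<in> Hom \<B> x y" "b \<in> Hom \<B> y z"
  shows "b \<otimes>\<^bsub>R\<^esub> a \<in> Hom \<B> x z"
proof -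
  have ab: "a \<in> carrier R" "b \<in> carrier R" using assms Hom_B_carrier by blast+
  show ?thesis
  proof (cases z)
    case (Some \<gamma>)
    show ?thesis
    proof (cases "x = None \<or> y = None")
      case True
      then have "b \<otimes>\<^bsub>R\<^esub> a = \<zero>\<^bsub>R\<^esub>" using assms ab Some by auto
      then show ?thesis using zero_Hom_B assms by simp
    next
      case False
      then show ?thesis using assms Some Comp_Hom_A by auto
    qed
  qed (use ab in simp)
qed

lemma Plus_Hom_B:
  assumes "x \<in> Obj \<B>" "y \<in> Obj \<B>" "a \<in> Hom \<B> x y" "b \<in> Hom \<B> x y"
  shows "a \<oplus>\<^bsub>R\<^esub> b \<in> Hom \<B> x y"
  using assms Plus_Hom_A by auto

text \<open>The equation \<open>0 + 0 = 0\<close> makes the value idempotent in a group. In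
  particular all arrows from \<infinity> to an element of \<Lambda> act trivially.\<close>

lemma module_zero_hom:
  assumes M: "is_module V \<B> M" and xy: "x \<in> Obj \<B>" "y \<in> Obj \<B>" and a: "a \<in> carr M x"
  shows "on_hom M x y \<zero>\<^bsub>R\<^esub> a = \<one>\<^bsub>on_obj M y\<^esub>"
proof -
  interpret My: group "on_obj M y" by (rule module_group'[OF M xy(2)])
  note z = zero_Hom_B[OF xy]
  have "on_hom M x y \<zero>\<^bsub>R\<^esub> a \<otimes>\<^bsub>on_obj M y\<^esub> on_hom M x y \<zero>\<^bsub>R\<^esub> a = on_hom M x y \<zero>\<^bsub>R\<^esub> a"
    using module_Plus[OF M xy z z a] by simp
  then show ?thesis using My.l_cancel_one[OF module_closed[OF M xy z a] module_closed[OF M xy z a]] by simp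
qed

text \<open>Empty for incomparable objects, where 1 need not be an arrow.\<close>

definition E_A :: "'g \<Rightarrow> 'g \<Rightarrow> 'r set" where "E_A \<alpha> \<beta> = (if (\<alpha>, \<beta>) \<in> leq then {\<one>\<^bsub>R\<^esub>} else {})"
definition E_B :: "'g option \<Rightarrow> 'g option \<Rightarrow> 'r set" where "E_B x y = (if leq_inf leq x y then {\<one>\<^bsub>R\<^esub>} else {})"

sublocale prefrag: separated_modules U \<A> E_A
  by unfold_locales (use universe one_Hom_A in \<open>auto simp: E_A_def\<close>)

sublocale preglid: separated_modules U \<B> E_B
  by unfold_locales (use universe one_Hom_B in \<open>auto simp: E_B_def\<close>)

lemma Prefrag_eq: "Prefrag U \<Gamma> leq R F \<Lambda> = prefrag.\<C>"
proof -
  have "prefrag.sep = (\<lambda>M. \<forall>\<alpha>\<in>\<Lambda>. \<forall>\<beta>\<in>\<Lambda>. (\<alpha>, \<beta>) \<in> leq \<longrightarrow> on_hom M \<alpha> \<beta> \<one>\<^bsub>R\<^esub> \<in> mon (on_obj M \<alpha>) (on_obj M \<beta>))"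
    unfolding prefrag.sep_def fun_eq_iff by (auto simp: E_A_def)
  then show ?thesis unfolding Prefrag_def by simp
qed

lemma Preglid_eq: "Preglid U \<Gamma> leq R F \<Lambda> = preglid.\<C>"
proof -
  have "preglid.sep = (\<lambda>M. \<forall>x\<in>insert None (Some ` \<Lambda>). \<forall>y\<in>insert None (Some ` \<Lambda>).
      leq_inf leq x y \<longrightarrow> on_hom M x y \<one>\<^bsub>R\<^esub> \<in> mon (on_obj M x) (on_obj M y))"
    unfolding preglid.sep_def unfolding E_B_def B_simps(1) by (intro ext ball_cong refl) simp_all
  then show ?thesis unfolding Preglid_def by simp
qed

section \<open>Gliders\<close>

definition res :: "('g option, 'r, 'u) amod \<Rightarrow> ('g, 'r, 'u) amod" where
  "res M = \<lparr>on_obj = (\<lambda>\<alpha>. on_obj M (Some \<alpha>)), on_hom = (\<lambda>\<alpha> \<beta>. on_hom M (Some \<alpha>) (Some \<beta>))\<rparr>"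

definition res_arr :: "('g option \<Rightarrow> 'u \<Rightarrow> 'u) \<Rightarrow> 'g \<Rightarrow> 'u \<Rightarrow> 'u" where
  "res_arr t = (\<lambda>\<alpha>\<in>\<Lambda>. t (Some \<alpha>))"

lemma res_simps [simp]:
  "on_obj (res M) \<alpha> = on_obj M (Some \<alpha>)" "on_hom (res M) \<alpha> \<beta> = on_hom M (Some \<alpha>) (Some \<beta>)"
  by (simp_all add: res_def)

lemma res_arr_apply [simp]: "\<alpha> \<in> \<Lambda> \<Longrightarrow> res_arr t \<alpha> = t (Some \<alpha>)"
  by (simp add: res_arr_def)

lemma is_module_res: "is_module U \<B> M \<Longrightarrow> is_module U \<A> (res M)"
  unfolding is_module_def by simp

lemma nat_trans_res: "nat_trans \<B> M N t \<Longrightarrow> nat_trans \<A> (res M) (res N) (res_arr t)"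
  unfolding nat_trans_def by (simp add: res_arr_def)

text \<open>Literal equality of records, including the values off \<Lambda>, so that
  \<open>res\<close> is surjective on objects as \<open>fraction_functor\<close> demands.\<close>

definition embeddable :: "('g, 'r, 'u) amod \<Rightarrow> bool" where
  "embeddable N \<longleftrightarrow> (\<exists>M. is_module U \<B> M \<and> preglid.sep M \<and> res M = N)"

text \<open>
  The value at \<open>\<infinity>\<close> of a preglider restricting to \<open>M\<close> is the \<open>R\<close>-submodule generated by \<open>M\<close> in
  the product of the values at \<open>\<infinity>\<close> of all pregliders whose restriction receives a map from \<open>M\<close>.
\<close>

lemma embeddable_if_cogenerated:
  assumes M: "is_module U \<A> M"
    and cog: "\<And>\<alpha> a. \<lbrakk>\<alpha> \<in> Obj \<A>; a \<in> carr M \<alpha>; a \<noteq> \<one>\<^bsub>on_obj M \<alpha>\<^esub>\<rbrakk> \<Longrightarrow>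
        \<exists>Y t. is_module U \<A> Y \<and> embeddable Y \<and> nat_trans \<A> M Y t \<and> t \<alpha> a \<noteq> \<one>\<^bsub>on_obj Y \<alpha>\<^esub>"
  shows "embeddable M"
proof -
  \<comment> \<open>All pairs of a preglider and a map from \<open>M\<close> to its
    restriction.\<close>
  define K where "K = {k. is_module U \<B> (fst k) \<and> preglid.sep (fst k) \<and> nat_trans \<A> M (res (fst k)) (snd k)}"
  have Y: "is_module U \<B> (fst k)" "preglid.sep (fst k)" and t: "nat_trans \<A> M (res (fst k)) (snd k)"
    if "k \<in> K" for k using that by (simp_all add: K_def)
  have t_one: "snd k \<alpha> \<one>\<^bsub>on_obj M \<alpha>\<^esub> = \<one>\<^bsub>on_obj (fst k) (Some \<alpha>)\<^esub>" if "k \<in> K" "\<alpha> \<in> \<Lambda>" for k \<alpha>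
    using nat_trans_one[OF t[OF that(1)] M is_module_res[OF Y(1)[OF that(1)]]] that(2) by simp
  \<comment> \<open>The hypothesis applied to the difference of \<open>a\<close> and
    \<open>b\<close>: the module \<open>Y'\<close> that detects it is the restriction of a preglider
    \<open>V\<close>, so the detecting map is among the indices.\<close>
  have joint: "a = b" if \<alpha>: "\<alpha> \<in> \<Lambda>" and ab: "a \<in> carr M \<alpha>" "b \<in> carr M \<alpha>"
    and eq: "\<And>k. k \<in> K \<Longrightarrow> snd k \<alpha> a = snd k \<alpha> b" for \<alpha> a b
  proof (rule ccontr)
    assume "a \<noteq> b"
    have \<alpha>': "\<alpha> \<in> Obj \<A>" using \<alpha> by simp
    let ?c = "a \<otimes>\<^bsub>on_obj M \<alpha>\<^esub> inv\<^bsub>on_obj M \<alpha>\<^esub> b"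
    have c: "?c \<in> carr M \<alpha>" "?c \<noteq> \<one>\<^bsub>on_obj M \<alpha>\<^esub>"
      using module_mult[OF M \<alpha>'] module_inv[OF M \<alpha>'] module_eq_iff[OF M \<alpha>'] ab \<open>a \<noteq> b\<close> by auto
    then obtain Y' s where Y': "embeddable Y'" "nat_trans \<A> M Y' s" "s \<alpha> ?c \<noteq> \<one>\<^bsub>on_obj Y' \<alpha>\<^esub>"
      using cog[OF \<alpha>'] by blast
    then obtain V where V: "is_module U \<B> V" "preglid.sep V" "res V = Y'" unfolding embeddable_def by blast
    then have "(V, s) \<in> K" using Y' by (simp add: K_def)
    from eq[OF this] have "s \<alpha> a = s \<alpha> b" by simp
    moreover have Y'M: "is_module U \<A> Y'" using V is_module_res by blast
    ultimately have "s \<alpha> ?c = \<one>\<^bsub>on_obj Y' \<alpha>\<^esub>"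
      using nat_trans_mult[OF Y'(2) \<alpha>' ab(1) module_inv[OF M \<alpha>' ab(2)]] nat_trans_inv[OF Y'(2) M Y'M \<alpha>' ab(2)]
        module_eq_iff[OF Y'M \<alpha>'] nat_trans_closed[OF Y'(2) \<alpha>'] ab by simp
    then show False using Y'(3) by blast
  qed
  define \<iota> where "\<iota> \<alpha> m = (\<lambda>k\<in>K. snd k \<alpha> m)" for \<alpha> m
  define G where "G x = product_group K (\<lambda>k. on_obj (fst k) x)" for x
  \<comment> \<open>All multiples of images of elements of \<open>M\<close> by elements of
    \<open>R\<close>. Including \<open>R\<close> here makes the generated subgroup an
    \<open>R\<close>-submodule, and the set is small since \<Lambda>, \<open>R\<close> and the
    values of \<open>M\<close> are.\<close>
  define gens where "gens = (\<Union>\<alpha>\<in>\<Lambda>. \<Union>r\<in>carrier R. (\<lambda>m. \<lambda>k\<in>K. on_hom (fst k) (Some \<alpha>) None r (snd k \<alpha> m)) ` carr M \<alpha>)"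
  define S where "S x = (case x of None \<Rightarrow> generate (G None) gens | Some \<alpha> \<Rightarrow> \<iota> \<alpha> ` carr M \<alpha>)" for x
  have G_group: "group (G x)" if "x \<in> Obj \<B>" for x
    unfolding G_def by (intro product_group module_group'[OF Y(1) that])
  have t_in: "snd k \<alpha> m \<in> carr (fst k) (Some \<alpha>)" if "k \<in> K" "\<alpha> \<in> \<Lambda>" "m \<in> carr M \<alpha>" for k \<alpha> m
    using nat_trans_closed[OF t[OF that(1)]] that by simp
  have gens_sub: "gens \<subseteq> carrier (G None)"
  proof
    fix s assume "s \<in> gens"
    then obtain \<alpha> r m where "\<alpha> \<in> \<Lambda>" "r \<in> carrier R" "m \<in> carr M \<alpha>"
      "s = (\<lambda>k\<in>K. on_hom (fst k) (Some \<alpha>) None r (snd k \<alpha> m))" unfolding gens_def by blast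
    then show "s \<in> carrier (G None)"
      using module_closed[OF Y(1), of _ "Some \<alpha>" None r] t_in by (simp add: G_def)
  qed
  have S_sub: "subgroup (S x) (product_group K (\<lambda>k. on_obj (fst k) x))" if x: "x \<in> Obj \<B>" for x
  proof (cases x)
    case None
    then show ?thesis
      using group.generate_is_subgroup[OF G_group gens_sub] unfolding S_def G_def by simp
  next
    case (Some \<alpha>)
    then have \<alpha>: "\<alpha> \<in> \<Lambda>" using x by auto
    have "\<iota> \<alpha> \<in> hom (on_obj M \<alpha>) (G (Some \<alpha>))"
      using t_in[OF _ \<alpha>] nat_trans_mult[OF t, of _ \<alpha>] \<alpha>
      by (intro homI) (auto simp: \<iota>_def G_def intro!: restrict_ext)
    then have "group_hom (on_obj M \<alpha>) (G (Some \<alpha>)) (\<iota> \<alpha>)"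
      using \<alpha> by (intro group_hom.intro group_hom_axioms.intro G_group module_group'[OF M]) auto
    from group_hom.img_is_subgroup[OF this] show ?thesis by (simp add: S_def Some G_def)
  qed
  have S_small: "small_set U (S x)" if x: "x \<in> Obj \<B>" for x
  proof (cases x)
    case None
    have "small_set U gens"
      unfolding gens_def
    proof (rule small_UN[OF universe small_subset[OF small_\<Gamma> \<Lambda>]], rule small_UN[OF universe small_R])
      show "small_set U ((\<lambda>m. \<lambda>k\<in>K. on_hom (fst k) (Some \<alpha>) None r (snd k \<alpha> m)) ` carr M \<alpha>)" if "\<alpha> \<in> \<Lambda>" for \<alpha> r
        using that by (intro small_image small_member module_carrier[OF M]) simp
    qed
    then show ?thesis using small_generate[OF universe] by (simp add: S_def None)
  next
    case (Some \<alpha>)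
    then show ?thesis
      using x by (auto simp: S_def intro!: small_image small_member module_carrier[OF M])
  qed
  have S_stable: "(\<lambda>k\<in>K. on_hom (fst k) x y f (s k)) \<in> S y"
    if xy: "x \<in> Obj \<B>" "y \<in> Obj \<B>" "f \<in> Hom \<B> x y" and s: "s \<in> S x" for x y f s
  proof (cases x)
    case None
    let ?h = "\<lambda>s. \<lambda>k\<in>K. on_hom (fst k) x y f (s k)"
    have s': "s \<in> generate (G None) gens" using s by (simp add: S_def None)
    have s_in: "s k \<in> carr (fst k) None" if "k \<in> K" for k
      using group.generate_in_carrier[OF G_group gens_sub s'] that by (auto simp: G_def)
    show ?thesis
    proof (cases y)
      case (Some \<beta>)
      then have \<beta>: "\<beta> \<in> \<Lambda>" and f: "f = \<zero>\<^bsub>R\<^esub>" using xy None by auto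
      have "?h s = \<iota> \<beta> \<one>\<^bsub>on_obj M \<beta>\<^esub>"
        unfolding \<iota>_def f using module_zero_hom[OF Y(1) xy(1,2)] s_in t_one[OF _ \<beta>] Some None
        by (intro restrict_ext) simp
      then show ?thesis using module_one[OF M] \<beta> by (simp add: S_def Some)
    next
      case y: None
      have f: "f \<in> carrier R" and N: "None \<in> Obj \<B>" using xy y by auto
      have h: "group_hom (G None) (G None) ?h"
      proof (intro group_hom.intro group_hom_axioms.intro homI G_group[OF N])
        fix s t assume "s \<in> carrier (G None)" "t \<in> carrier (G None)"
        then have st: "s k \<in> carr (fst k) None" "t k \<in> carr (fst k) None" if "k \<in> K" for k
          using that by (auto simp: G_def)
        note Yf = Y(1)[THEN module_closed, OF _ N N] Y(1)[THEN module_hom_mult, OF _ N N]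
        show "?h s \<in> carrier (G None)"
          unfolding G_def carrier_product_group None y
          by (intro restrict_PiE_iff[THEN iffD2] ballI Yf st) (use f in auto)
        show "?h (s \<otimes>\<^bsub>G None\<^esub> t) = ?h s \<otimes>\<^bsub>G None\<^esub> ?h t"
          unfolding G_def mult_product_group None y
          using Yf(2)[OF _ _ st(1) st(2)] f by (intro restrict_ext) simp
      qed
      have "?h ` gens \<subseteq> gens"
      proof
        fix u assume "u \<in> ?h ` gens"
        then obtain \<alpha> r m where \<alpha>: "\<alpha> \<in> \<Lambda>" and r: "r \<in> carrier R" and m: "m \<in> carr M \<alpha>"
          and u: "u = ?h (\<lambda>k\<in>K. on_hom (fst k) (Some \<alpha>) None r (snd k \<alpha> m))" unfolding gens_def by blast
        have "u = (\<lambda>k\<in>K. on_hom (fst k) (Some \<alpha>) None (f \<otimes>\<^bsub>R\<^esub> r) (snd k \<alpha> m))"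
          unfolding u None y
        proof (rule restrict_ext)
          fix k assume k: "k \<in> K"
          show "on_hom (fst k) None None f ((\<lambda>k\<in>K. on_hom (fst k) (Some \<alpha>) None r (snd k \<alpha> m)) k) =
              on_hom (fst k) (Some \<alpha>) None (f \<otimes>\<^bsub>R\<^esub> r) (snd k \<alpha> m)"
            using module_Comp[OF Y(1)[OF k], of "Some \<alpha>" None None r f "snd k \<alpha> m"] \<alpha> f r t_in[OF k \<alpha> m] k by simp
        qed
        then show "u \<in> gens" unfolding gens_def using \<alpha> f r m R.m_closed[of f r] by blast
      qed
      then have "generate (G None) (?h ` gens) \<subseteq> generate (G None) gens"
        by (rule group.mono_generate[OF G_group[OF N]])
      then have "?h s \<in> generate (G None) gens"
        using group_hom.generate_img[OF h gens_sub] s' by blast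
      then show ?thesis by (simp add: S_def y)
    qed
  next
    case (Some \<alpha>)
    then have \<alpha>: "\<alpha> \<in> \<Lambda>" using xy by auto
    obtain m where m: "m \<in> carr M \<alpha>" "s = \<iota> \<alpha> m" using s by (auto simp: S_def Some)
    show ?thesis
    proof (cases y)
      case None
      have "(\<lambda>k\<in>K. on_hom (fst k) x y f (s k)) = (\<lambda>k\<in>K. on_hom (fst k) (Some \<alpha>) None f (snd k \<alpha> m))"
        unfolding m Some None \<iota>_def by (rule restrict_ext) simp
      also have "\<dots> \<in> gens" unfolding gens_def using \<alpha> m(1) xy None by auto
      finally show ?thesis by (auto simp: S_def None intro: generate.incl)
    next
      case y: (Some \<beta>)
      then have \<beta>: "\<beta> \<in> \<Lambda>" and f: "f \<in> Hom \<A> \<alpha> \<beta>" using xy Some by auto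
      have "(\<lambda>k\<in>K. on_hom (fst k) x y f (s k)) = \<iota> \<beta> (on_hom M \<alpha> \<beta> f m)"
        unfolding m Some y \<iota>_def using nat_trans_natural[OF t, of _ \<alpha> \<beta> f m] \<alpha> \<beta> f m(1)
        by (intro restrict_ext) simp
      then show ?thesis using module_closed[OF M, of \<alpha> \<beta> f m] \<alpha> \<beta> f m(1) by (simp add: S_def y)
    qed
  qed
  obtain N p where N: "is_module U \<B> N" and sp: "subproduct \<B> K fst S N p"
    by (rule subproduct_exists[where A = \<B> and K = K and Y = fst and S = S, OF universe Y(1) S_sub S_small S_stable])
  have sepN: "preglid.sep N" by (rule preglid.cogenerated_subproduct[OF N sp]) (use Y in blast)
  have p: "nat_trans \<B> N (fst k) (p k)" if "k \<in> K" for k by (rule subproduct_nat_trans[OF sp that])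

  \<comment> \<open>\<open>N\<close> contains only a copy of each \<open>M \<alpha>\<close>. The
    groups of \<open>M\<close> itself are put back in place of these copies, and the structure is
    carried over along \<open>\<rho>\<close>, which sends an element of \<open>N\<close> to the
    element of \<open>M\<close> with the same coordinates.\<close>
  define H where "H x = (case x of None \<Rightarrow> on_obj N None | Some \<alpha> \<Rightarrow> on_obj M \<alpha>)" for x
  have "\<exists>m. m \<in> carr M \<alpha> \<and> (\<forall>k\<in>K. p k (Some \<alpha>) n = snd k \<alpha> m)" if \<alpha>: "\<alpha> \<in> \<Lambda>" and n: "n \<in> carr N (Some \<alpha>)" for \<alpha> n
  proof -
    have "(\<lambda>k\<in>K. p k (Some \<alpha>) n) \<in> S (Some \<alpha>)" using subproduct_in[OF sp _ n] \<alpha> by simp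
    then obtain m where m: "m \<in> carr M \<alpha>" "(\<lambda>k\<in>K. p k (Some \<alpha>) n) = \<iota> \<alpha> m" by (auto simp: S_def)
    have "p k (Some \<alpha>) n = snd k \<alpha> m" if "k \<in> K" for k
      using fun_cong[OF m(2), of k] that by (simp add: \<iota>_def)
    then show ?thesis using m(1) by blast
  qed
  then obtain \<rho> where \<rho>_in: "\<And>\<alpha> n. \<lbrakk>\<alpha> \<in> \<Lambda>; n \<in> carr N (Some \<alpha>)\<rbrakk> \<Longrightarrow> \<rho> \<alpha> n \<in> carr M \<alpha>"
    and \<rho>: "\<And>\<alpha> n k. \<lbrakk>\<alpha> \<in> \<Lambda>; n \<in> carr N (Some \<alpha>); k \<in> K\<rbrakk> \<Longrightarrow> p k (Some \<alpha>) n = snd k \<alpha> (\<rho> \<alpha> n)" by metis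
  have \<rho>_eqI: "\<rho> \<alpha> n = m" if "\<alpha> \<in> \<Lambda>" "n \<in> carr N (Some \<alpha>)" "m \<in> carr M \<alpha>"
    "\<And>k. k \<in> K \<Longrightarrow> p k (Some \<alpha>) n = snd k \<alpha> m" for \<alpha> n m
    using \<rho>[OF that(1,2)] that(4) by (intro joint[OF that(1) \<rho>_in[OF that(1,2)] that(3)]) simp
  define r where "r x = (case x of None \<Rightarrow> (\<lambda>n. n) | Some \<alpha> \<Rightarrow> \<rho> \<alpha>)" for x
  have r_hom: "r x \<in> hom (on_obj N x) (H x) \<and> r x ` carr N x = carrier (H x)" if x: "x \<in> Obj \<B>" for x
  proof (cases x)
    case None
    then show ?thesis by (simp add: r_def H_def hom_def module_mult[OF N])
  next
    case (Some \<alpha>)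
    then have \<alpha>: "\<alpha> \<in> \<Lambda>" "\<alpha> \<in> Obj \<A>" using x by auto
    have "\<rho> \<alpha> \<in> hom (on_obj N (Some \<alpha>)) (on_obj M \<alpha>)"
    proof (rule homI)
      fix a b assume ab: "a \<in> carr N (Some \<alpha>)" "b \<in> carr N (Some \<alpha>)"
      show "\<rho> \<alpha> a \<in> carr M \<alpha>" by (rule \<rho>_in[OF \<alpha>(1) ab(1)])
      show "\<rho> \<alpha> (a \<otimes>\<^bsub>on_obj N (Some \<alpha>)\<^esub> b) = \<rho> \<alpha> a \<otimes>\<^bsub>on_obj M \<alpha>\<^esub> \<rho> \<alpha> b"
      proof (rule \<rho>_eqI[OF \<alpha>(1)])
        show "a \<otimes>\<^bsub>on_obj N (Some \<alpha>)\<^esub> b \<in> carr N (Some \<alpha>)" using module_mult[OF N _ ab] x Some by blast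
        show "\<rho> \<alpha> a \<otimes>\<^bsub>on_obj M \<alpha>\<^esub> \<rho> \<alpha> b \<in> carr M \<alpha>" using module_mult[OF M \<alpha>(2)] \<rho>_in[OF \<alpha>(1)] ab by blast
        fix k assume k: "k \<in> K"
        show "p k (Some \<alpha>) (a \<otimes>\<^bsub>on_obj N (Some \<alpha>)\<^esub> b) = snd k \<alpha> (\<rho> \<alpha> a \<otimes>\<^bsub>on_obj M \<alpha>\<^esub> \<rho> \<alpha> b)"
          using nat_trans_mult[OF p[OF k] _ ab] nat_trans_mult[OF t[OF k] \<alpha>(2) \<rho>_in[OF \<alpha>(1) ab(1)] \<rho>_in[OF \<alpha>(1) ab(2)]]
            \<rho>[OF \<alpha>(1) ab(1) k] \<rho>[OF \<alpha>(1) ab(2) k] x Some by simp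
      qed
    qed
    moreover have "\<rho> \<alpha> ` carr N (Some \<alpha>) = carr M \<alpha>"
    proof (intro equalityI subsetI)
      fix m assume m: "m \<in> carr M \<alpha>"
      have "(\<lambda>k\<in>K. snd k \<alpha> m) \<in> S (Some \<alpha>)" using m by (auto simp: S_def \<iota>_def)
      then obtain n where n: "n \<in> carr N (Some \<alpha>)" "\<And>k. k \<in> K \<Longrightarrow> p k (Some \<alpha>) n = snd k \<alpha> m"
        using subproduct_element[OF sp, of "Some \<alpha>" "\<lambda>k. snd k \<alpha> m"] x Some by blast
      then show "m \<in> \<rho> \<alpha> ` carr N (Some \<alpha>)" using \<rho>_eqI[OF \<alpha>(1) n(1) m n(2)] by blast
    qed (use \<rho>_in[OF \<alpha>(1)] in auto)
    ultimately show ?thesis by (simp add: r_def H_def Some)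
  qed
  have H: "comm_group (H x) \<and> carrier (H x) \<in> U" if "x \<in> Obj \<B>" for x
    using that module_group[OF N] module_group[OF M] module_carrier[OF N] module_carrier[OF M]
    by (auto simp: H_def)
  have r_one: "r x \<one>\<^bsub>on_obj N x\<^esub> = \<one>\<^bsub>H x\<^esub>" if "x \<in> Obj \<B>" for x
    using hom_one[OF r_hom[OF that, THEN conjunct1] module_group'[OF N that]] H[OF that] comm_group.axioms(2) by blast
  obtain M' where M': "is_module U \<B> M'" "on_obj M' = H" and
    M'_hom: "\<And>x y f a. \<lbrakk>x \<in> Obj \<B>; y \<in> Obj \<B>; f \<in> Hom \<B> x y; a \<in> carr N x\<rbrakk> \<Longrightarrow>
      on_hom M' x y f (r x a) = r y (on_hom N x y f a)"
  proof (rule module_image[OF N H r_hom])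
    fix x y f a assume xy: "x \<in> Obj \<B>" "y \<in> Obj \<B>" "f \<in> Hom \<B> x y" and a: "a \<in> carr N x" "r x a = \<one>\<^bsub>H x\<^esub>"
    have "a = \<one>\<^bsub>on_obj N x\<^esub>"
    proof (cases x)
      case (Some \<alpha>)
      then have \<alpha>: "\<alpha> \<in> \<Lambda>" using xy(1) by auto
      have "p k (Some \<alpha>) a = p k (Some \<alpha>) \<one>\<^bsub>on_obj N x\<^esub>" if "k \<in> K" for k
        using \<rho>[OF \<alpha> _ that, of a] a t_one[OF that \<alpha>] nat_trans_one[OF p[OF that] N Y(1)[OF that] xy(1)] Some
        by (simp add: r_def H_def)
      then show ?thesis using Some by (intro subproduct_eqI[OF sp xy(1) a(1) module_one[OF N xy(1)]]) simp
    qed (use a in \<open>simp add: r_def H_def\<close>)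
    then show "r y (on_hom N x y f a) = \<one>\<^bsub>H y\<^esub>" using module_hom_one[OF N xy] r_one[OF xy(2)] by simp
  qed (assumption | (rule that; assumption))+
  have M'_Some: "on_hom M' (Some \<alpha>) (Some \<beta>) f = on_hom M \<alpha> \<beta> f"
    if \<alpha>\<beta>: "\<alpha> \<in> \<Lambda>" "\<beta> \<in> \<Lambda>" "f \<in> Hom \<A> \<alpha> \<beta>" for \<alpha> \<beta> f
  proof (rule extensionalityI[of _ "carr M \<alpha>"])
    have xy: "Some \<alpha> \<in> Obj \<B>" "Some \<beta> \<in> Obj \<B>" "f \<in> Hom \<B> (Some \<alpha>) (Some \<beta>)"
      and \<alpha>\<beta>': "\<alpha> \<in> Obj \<A>" "\<beta> \<in> Obj \<A>" using \<alpha>\<beta> by auto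
    show "on_hom M' (Some \<alpha>) (Some \<beta>) f \<in> extensional (carr M \<alpha>)"
      using module_extensional[OF M'(1) xy] M'(2) by (simp add: H_def)
    show "on_hom M \<alpha> \<beta> f \<in> extensional (carr M \<alpha>)"
      by (rule module_extensional[OF M \<alpha>\<beta>' \<alpha>\<beta>(3)])
    fix m assume m: "m \<in> carr M \<alpha>"
    then obtain n where n: "n \<in> carr N (Some \<alpha>)" "m = \<rho> \<alpha> n"
      using r_hom[OF xy(1)] by (auto simp: r_def H_def)
    have "on_hom M' (Some \<alpha>) (Some \<beta>) f m = \<rho> \<beta> (on_hom N (Some \<alpha>) (Some \<beta>) f n)"
      using M'_hom[OF xy n(1)] n(2) by (simp add: r_def)
    also have "\<dots> = on_hom M \<alpha> \<beta> f m"
    proof (rule \<rho>_eqI[OF \<alpha>\<beta>(2) module_closed[OF N xy n(1)] module_closed[OF M \<alpha>\<beta>' \<alpha>\<beta>(3) m]])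
      fix k assume k: "k \<in> K"
      show "p k (Some \<beta>) (on_hom N (Some \<alpha>) (Some \<beta>) f n) = snd k \<beta> (on_hom M \<alpha> \<beta> f m)"
        using nat_trans_natural[OF p[OF k] xy n(1)] nat_trans_natural[OF t[OF k] \<alpha>\<beta>' \<alpha>\<beta>(3) m] \<rho>[OF \<alpha>\<beta>(1) n(1) k] n(2)
        by simp
    qed
    finally show "on_hom M' (Some \<alpha>) (Some \<beta>) f m = on_hom M \<alpha> \<beta> f m" .
  qed
  \<comment> \<open>\<open>M'\<close> agrees with \<open>M\<close> only on actual arrows between
    elements of \<Lambda>. \<open>L\<close> copies \<open>M\<close> on all other arguments too,
    which makes \<open>res L = M\<close> an equality of records.\<close>
  define L where "L = \<lparr>on_obj = H, on_hom = (\<lambda>x y. case (x, y) of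
      (Some \<alpha>, Some \<beta>) \<Rightarrow> on_hom M \<alpha> \<beta> | _ \<Rightarrow> on_hom M' x y)\<rparr>"
  have L_hom: "on_hom L x y f = on_hom M' x y f" if "x \<in> Obj \<B>" "y \<in> Obj \<B>" "f \<in> Hom \<B> x y" for x y f
    using that M'_Some by (auto simp: L_def split: option.splits)
  have L: "is_module U \<B> L"
    by (rule is_module_cong[OF M'(1)])
      (simp_all only: B_simps(2-4) Ident_Hom_B Comp_Hom_B Plus_Hom_B L_hom, simp_all add: L_def M'(2))
  have "preglid.sep L"
    unfolding preglid.sep_iff[OF L]
  proof (intro ballI impI)
    fix x y e a assume xy: "x \<in> Obj \<B>" "y \<in> Obj \<B>" "e \<in> E_B x y" and a: "a \<in> carr L x"
      and ea: "on_hom L x y e a = \<one>\<^bsub>on_obj L y\<^esub>"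
    have e: "e \<in> Hom \<B> x y" using preglid.E xy by blast
    obtain n where n: "n \<in> carr N x" "a = r x n" using a r_hom[OF xy(1)] by (auto simp: L_def)
    have "r y (on_hom N x y e n) = \<one>\<^bsub>H y\<^esub>"
      using ea M'_hom[OF xy(1,2) e n(1)] L_hom[OF xy(1,2) e] n(2) by (simp add: L_def)
    then have "r y (on_hom N x y e n) = r y \<one>\<^bsub>on_obj N y\<^esub>" using r_one[OF xy(2)] by simp
    moreover have "inj_on (r y) (carr N y)"
    proof (cases y)
      case (Some \<beta>)
      then have \<beta>: "\<beta> \<in> \<Lambda>" using xy(2) by auto
      show ?thesis
      proof (rule inj_onI)
        fix b c assume bc: "b \<in> carr N y" "c \<in> carr N y" "r y b = r y c"
        show "b = c"
        proof (rule subproduct_eqI[OF sp xy(2) bc(1,2)])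
          show "p k y b = p k y c" if "k \<in> K" for k
            using \<rho>[OF \<beta> _ that] bc by (simp add: r_def Some)
        qed
      qed
    qed (simp add: r_def inj_on_def)
    ultimately have "on_hom N x y e n = \<one>\<^bsub>on_obj N y\<^esub>"
      using module_closed[OF N xy(1,2) e n(1)] module_one[OF N xy(2)] by (simp add: inj_on_def)
    then have "n = \<one>\<^bsub>on_obj N x\<^esub>" by (rule preglid.sepD[OF N sepN xy n(1)])
    then show "a = \<one>\<^bsub>on_obj L x\<^esub>" using n(2) r_one[OF xy(1)] by (simp add: L_def)
  qed
  moreover have "res L = M" by (simp add: res_def L_def H_def)
  ultimately show ?thesis unfolding embeddable_def using L by blast
qed

sublocale glid: cogenerated_class U \<A> embeddable
  by unfold_locales (use universe embeddable_if_cogenerated in blast)+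

section \<open>Restriction as a localization functor\<close>

abbreviation "\<W> \<equiv> glid_weak_equivalences U \<Gamma> leq R F \<Lambda>"

lemma weak_equivalence_iff:
  "t \<in> \<W> M N \<longleftrightarrow>
    nat_trans \<B> M N t \<and> (\<forall>\<alpha>\<in>\<Lambda>. bij_betw (t (Some \<alpha>)) (carr M (Some \<alpha>)) (carr N (Some \<alpha>)))"
proof -
  have "t (Some \<alpha>) \<in> hom (on_obj M (Some \<alpha>)) (on_obj N (Some \<alpha>))" if "nat_trans \<B> M N t" "\<alpha> \<in> \<Lambda>" for \<alpha>
    using nat_trans_hom[OF that(1), of "Some \<alpha>"] that(2) by simp
  then show ?thesis
    unfolding glid_weak_equivalences_def Preglid_eq by (auto simp: iso_def)
qed

lemma fraction_functor: "fraction_functor preglid.\<C> glid.\<C> res (\<lambda>_ _. res_arr) (\<W>)"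
proof (intro fraction_functor.intro fraction_functor_axioms.intro preglid.category glid.category)
  show "res ` Obj preglid.\<C> = Obj glid.\<C>"
  proof (intro equalityI subsetI)
    fix N assume "N \<in> Obj glid.\<C>"
    then show "N \<in> res ` Obj preglid.\<C>" unfolding glid.C_simps embeddable_def by force
  qed (auto simp: embeddable_def is_module_res)
next
  fix M N t assume "M \<in> Obj preglid.\<C>" "N \<in> Obj preglid.\<C>" "t \<in> Hom preglid.\<C> M N"
  then show "res_arr t \<in> Hom glid.\<C> (res M) (res N)" by (simp add: nat_trans_res)
next
  fix M assume "M \<in> Obj preglid.\<C>"
  show "res_arr (Ident preglid.\<C> M) = Ident glid.\<C> (res M)"
    by (auto simp: res_arr_def intro!: restrict_ext)
next
  fix L M N s t assume "L \<in> Obj preglid.\<C>"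
  show "res_arr (Comp preglid.\<C> L M N t s) = Comp glid.\<C> (res L) (res M) (res N) (res_arr t) (res_arr s)"
    by (auto simp: res_arr_def preglid.Comp_C glid.Comp_C intro!: restrict_ext)
next
  fix M N s assume "s \<in> \<W> M N"
  then show "s \<in> Hom preglid.\<C> M N" by (simp add: weak_equivalence_iff)
next
  fix M N s assume "M \<in> Obj preglid.\<C>" "N \<in> Obj preglid.\<C>" and s: "s \<in> \<W> M N"
  then have M: "is_module U \<A> (res M)" and N: "is_module U \<A> (res N)" by (simp_all add: is_module_res)
  have s: "nat_trans \<A> (res M) (res N) (res_arr s)" "\<And>\<alpha>. \<alpha> \<in> Obj \<A> \<Longrightarrow> bij_betw (res_arr s \<alpha>) (carr (res M) \<alpha>) (carr (res N) \<alpha>)"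
    using s by (simp_all add: weak_equivalence_iff nat_trans_res)
  obtain t where "nat_trans \<A> (res N) (res M) t"
    "\<And>\<alpha> a. \<alpha> \<in> Obj \<A> \<Longrightarrow> a \<in> carr (res M) \<alpha> \<Longrightarrow> t \<alpha> (res_arr s \<alpha> a) = a"
    "\<And>\<alpha> b. \<alpha> \<in> Obj \<A> \<Longrightarrow> b \<in> carr (res N) \<alpha> \<Longrightarrow> res_arr s \<alpha> (t \<alpha> b) = b"
    by (rule nat_trans_inverse[OF M N s]; (assumption | (rule that; assumption)))
  then show "\<exists>t\<in>Hom glid.\<C> (res N) (res M).
      Comp glid.\<C> (res M) (res N) (res M) t (res_arr s) = Ident glid.\<C> (res M) \<and>
      Comp glid.\<C> (res N) (res M) (res N) (res_arr s) t = Ident glid.\<C> (res N)"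
    using nat_trans_Ident[OF M] nat_trans_Ident[OF N]
    by (intro bexI[of _ t]) (simp_all add: glid.Comp_eq_iff del: res_simps A_simps)
next
  fix M N f g assume "M \<in> Obj preglid.\<C>" "N \<in> Obj preglid.\<C>" "f \<in> Hom preglid.\<C> M N" "g \<in> Hom preglid.\<C> M N"
    and eq: "res_arr f = res_arr g"
  then have M: "is_module U \<B> M" "preglid.sep M" and N: "is_module U \<B> N" "preglid.sep N"
    and f: "nat_trans \<B> M N f" and g: "nat_trans \<B> M N g" by auto
  \<comment> \<open>The equalizer of \<open>f\<close> and \<open>g\<close>. Since they agree on
    \<Lambda>, it can be smaller than \<open>M\<close> only at \<infinity>, so its inclusion lies in
    \<open>\<W>\<close>.\<close>
  define T where "T x = {m \<in> carr M x. f x m = g x m}" for x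
  have T_Some: "T (Some \<alpha>) = carr M (Some \<alpha>)" if "\<alpha> \<in> \<Lambda>" for \<alpha>
    using fun_cong[OF eq, of \<alpha>] that by (auto simp: T_def)
  have T_sub: "subgroup (T x) (on_obj M x)" if x: "x \<in> Obj \<B>" for x
    by standard (auto simp: T_def module_one[OF M(1) x] module_mult[OF M(1) x] module_inv[OF M(1) x]
        nat_trans_one[OF f M(1) N(1) x] nat_trans_one[OF g M(1) N(1) x] nat_trans_mult[OF f x] nat_trans_mult[OF g x]
        nat_trans_inv[OF f M(1) N(1) x] nat_trans_inv[OF g M(1) N(1) x])
  have T_stable: "on_hom M x y k a \<in> T y" if "x \<in> Obj \<B>" "y \<in> Obj \<B>" "k \<in> Hom \<B> x y" "a \<in> T x" for x y k a
    using that module_closed[OF M(1) that(1-3)] nat_trans_natural[OF f that(1-3)] nat_trans_natural[OF g that(1-3)]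
    by (simp add: T_def)
  let ?W = "submodule M T" and ?k = "\<lambda>x\<in>Obj \<B>. \<lambda>a\<in>T x. a"
  note W = preglid.submodule_in[where T = T, OF M T_sub T_stable]
  have "bij_betw (?k (Some \<alpha>)) (carr ?W (Some \<alpha>)) (carr M (Some \<alpha>))" if "\<alpha> \<in> \<Lambda>" for \<alpha>
    using that T_Some by (auto simp: bij_betw_def inj_on_def)
  then have "?k \<in> \<W> ?W M"
    unfolding weak_equivalence_iff using W by blast
  moreover have "Comp preglid.\<C> ?W M N f ?k = Comp preglid.\<C> ?W M N g ?k"
    by (simp add: preglid.Comp_eq_Comp_iff T_def)
  ultimately show "\<exists>W\<in>Obj preglid.\<C>. \<exists>k\<in>\<W> W M.
      Comp preglid.\<C> W M N f k = Comp preglid.\<C> W M N g k"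
    using W by (intro bexI[of _ ?W] bexI[of _ ?k]) (auto simp del: submodule_simps)
next
  fix M N t assume "M \<in> Obj preglid.\<C>" "N \<in> Obj preglid.\<C>" "t \<in> Hom glid.\<C> (res M) (res N)"
  then have M: "is_module U \<B> M" "preglid.sep M" and N: "is_module U \<B> N" "preglid.sep N"
    and t: "nat_trans \<A> (res M) (res N) t" by auto
  note rM = is_module_res[OF M(1)] and rN = is_module_res[OF N(1)]
  \<comment> \<open>The graph of \<open>t\<close>, completed at \<open>\<infinity>\<close> by the whole product.\<close>
  define T where "T x = (case x of None \<Rightarrow> carr M None \<times> carr N None
    | Some \<alpha> \<Rightarrow> (\<lambda>m. (m, t \<alpha> m)) ` carr M (Some \<alpha>))" for x
  have t_in: "t \<alpha> m \<in> carr N (Some \<alpha>)" if "\<alpha> \<in> \<Lambda>" "m \<in> carr M (Some \<alpha>)" for \<alpha> m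
    using nat_trans_closed[OF t, of \<alpha> m] that by simp
  have t_one: "t \<alpha> \<one>\<^bsub>on_obj M (Some \<alpha>)\<^esub> = \<one>\<^bsub>on_obj N (Some \<alpha>)\<^esub>" if "\<alpha> \<in> \<Lambda>" for \<alpha>
    using nat_trans_one[OF t rM rN, of \<alpha>] that by simp
  have t_mult: "t \<alpha> (a \<otimes>\<^bsub>on_obj M (Some \<alpha>)\<^esub> b) = t \<alpha> a \<otimes>\<^bsub>on_obj N (Some \<alpha>)\<^esub> t \<alpha> b"
    if "\<alpha> \<in> \<Lambda>" "a \<in> carr M (Some \<alpha>)" "b \<in> carr M (Some \<alpha>)" for \<alpha> a b
    using nat_trans_mult[OF t, of \<alpha> a b] that by simp
  have t_inv: "t \<alpha> (inv\<^bsub>on_obj M (Some \<alpha>)\<^esub> a) = inv\<^bsub>on_obj N (Some \<alpha>)\<^esub> t \<alpha> a"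
    if "\<alpha> \<in> \<Lambda>" "a \<in> carr M (Some \<alpha>)" for \<alpha> a
    using nat_trans_inv[OF t rM rN, of \<alpha> a] that by simp
  have T_Some: "(m, n) \<in> T (Some \<alpha>) \<longleftrightarrow> m \<in> carr M (Some \<alpha>) \<and> n = t \<alpha> m" for \<alpha> m n by (auto simp: T_def)
  have T_None: "(m, n) \<in> T None \<longleftrightarrow> m \<in> carr M None \<and> n \<in> carr N None" for m n by (simp add: T_def)
  obtain Q q1 q2 where Q: "is_module U \<B> Q" "preglid.sep Q" and q: "nat_trans \<B> Q M q1" "nat_trans \<B> Q N q2"
    and bij: "\<And>x. x \<in> Obj \<B> \<Longrightarrow> bij_betw (\<lambda>m. (q1 x m, q2 x m)) (carr Q x) (T x)"
  proof (rule preglid.pair_submodule[OF M N, of T])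
    fix x assume x: "x \<in> Obj \<B>"
    show "T x \<subseteq> carr M x \<times> carr N x" using x t_in by (auto simp: T_def split: option.splits)
    show "(\<one>\<^bsub>on_obj M x\<^esub>, \<one>\<^bsub>on_obj N x\<^esub>) \<in> T x"
      using x module_one[OF M(1)] module_one[OF N(1)] t_one by (cases x) (auto simp: T_Some T_None)
    show "(a \<otimes>\<^bsub>on_obj M x\<^esub> a', b \<otimes>\<^bsub>on_obj N x\<^esub> b') \<in> T x" if "(a, b) \<in> T x" "(a', b') \<in> T x" for a b a' b'
      using x that module_mult[OF M(1) x] module_mult[OF N(1) x] t_mult by (cases x) (auto simp: T_Some T_None)
    show "(inv\<^bsub>on_obj M x\<^esub> a, inv\<^bsub>on_obj N x\<^esub> b) \<in> T x" if "(a, b) \<in> T x" for a b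
      using x that module_inv[OF M(1) x] module_inv[OF N(1) x] t_inv by (cases x) (auto simp: T_Some T_None)
    fix y k a b assume y: "y \<in> Obj \<B>" "k \<in> Hom \<B> x y" and ab: "(a, b) \<in> T x"
    then have ab': "a \<in> carr M x" "b \<in> carr N x" using x t_in by (auto simp: T_def split: option.splits)
    note cl = module_closed[OF M(1) x y ab'(1)] module_closed[OF N(1) x y ab'(2)]
    show "(on_hom M x y k a, on_hom N x y k b) \<in> T y"
    \<comment> \<open>At \<infinity> the set is the whole product, so stability is automatic. An
      arrow from \<infinity> to \<beta> is 0 and yields the pair of units, which lies on the graph.
      Between elements of \<Lambda> stability is naturality of \<open>t\<close>.\<close>
    proof (cases y)
      case None
      then show ?thesis using cl by (simp add: T_None)
    next
      case (Some \<beta>)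
      then have \<beta>: "\<beta> \<in> \<Lambda>" using y by auto
      show ?thesis
      proof (cases x)
        case None
        then have "k = \<zero>\<^bsub>R\<^esub>" using y(2) Some by simp
        then show ?thesis
          using module_zero_hom[OF M(1) x y(1) ab'(1)] module_zero_hom[OF N(1) x y(1) ab'(2)] module_one[OF M(1) y(1)] t_one[OF \<beta>]
          by (simp add: Some T_Some)
      next
        case x': (Some \<alpha>)
        then show ?thesis
          using ab x y cl nat_trans_natural[OF t, of \<alpha> \<beta> k a] \<beta> by (auto simp: Some T_Some)
      qed
    qed
  qed (assumption | (rule that; assumption))+
  have graph: "q2 (Some \<alpha>) m = t \<alpha> (q1 (Some \<alpha>) m)" if "\<alpha> \<in> \<Lambda>" "m \<in> carr Q (Some \<alpha>)" for \<alpha> m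
    using bij_betw_apply[OF bij that(2)] that(1) by (simp add: T_Some)
  have "bij_betw (q1 (Some \<alpha>)) (carr Q (Some \<alpha>)) (carr M (Some \<alpha>))" if \<alpha>: "\<alpha> \<in> \<Lambda>" for \<alpha>
  proof -
    \<comment> \<open>The first projection of a graph is bijective, which puts \<open>q1\<close>
      into \<open>\<W>\<close>.\<close>
    have "bij_betw fst (T (Some \<alpha>)) (carr M (Some \<alpha>))"
      by (rule bij_betw_byWitness[where f' = "\<lambda>m. (m, t \<alpha> m)"]) (auto simp: T_def)
    from bij_betw_trans[OF bij this] show ?thesis using \<alpha> by (simp add: comp_def)
  qed
  then have "q1 \<in> \<W> Q M"
    unfolding weak_equivalence_iff using q by blast
  moreover have "Comp glid.\<C> (res Q) (res M) (res N) t (res_arr q1) = res_arr q2"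
    unfolding glid.Comp_eq_iff[OF nat_trans_res[OF q(2)]] using graph by simp
  ultimately show "\<exists>W\<in>Obj preglid.\<C>. \<exists>k\<in>\<W> W M. \<exists>g\<in>Hom preglid.\<C> W N.
      res_arr g = Comp glid.\<C> (res W) (res M) (res N) t (res_arr k)"
    using Q q by (intro bexI[of _ Q] bexI[of _ q1] bexI[of _ q2]) auto
qed

text \<open>Limits, colimits, the additive structure and stability of cokernels are transported from
  the extendable modules; kernels and cokernels then come from completeness and cocompleteness of
  the localization itself.\<close>

lemma Glid_complete: "complete_category U (Glid U \<Gamma> leq R F \<Lambda>)"
  and Glid_cocomplete: "cocomplete_category U (Glid U \<Gamma> leq R F \<Lambda>)"
  and Glid_deflation_quasi_abelian: "deflation_quasi_abelian (Glid U \<Gamma> leq R F \<Lambda>)"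
proof -
  interpret fraction_functor preglid.\<C> glid.\<C> res "\<lambda>_ _. res_arr" "\<W>"
    by (rule fraction_functor)
  interpret L: surjective_equivalence "Glid U \<Gamma> leq R F \<Lambda>" glid.\<C> res zigzag_arr
    using localization_equivalence unfolding Glid_def Preglid_eq .
  show c: "complete_category U (Glid U \<Gamma> leq R F \<Lambda>)" "cocomplete_category U (Glid U \<Gamma> leq R F \<Lambda>)"
    by (rule L.complete[OF glid.complete] L.cocomplete[OF glid.cocomplete])+
  show "deflation_quasi_abelian (Glid U \<Gamma> leq R F \<Lambda>)"
    unfolding deflation_quasi_abelian_def
    using pre_abelian_if_complete[OF universe L.preadditive_structure[OF glid.has_preadditive_structure] c]
      L.cokernels_stable_under_pullback[OF glid.cokernels_stable] by blast
qed

end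

theorem theorem1p2:
  fixes \<Gamma> :: "('g, 'c) monoid_scheme" and leq :: "'g rel" and \<Lambda> :: "'g set"
    and R :: "('r, 'd) ring_scheme" and F :: "'g \<Rightarrow> 'r set"
    and U :: "'u set set"
  assumes "universe U" and "small_set U (carrier \<Gamma>)" and "small_set U (carrier R)"
    and "ordered_group \<Gamma> leq" and "\<Lambda> \<subseteq> carrier \<Gamma>" and "filtered_ring \<Gamma> leq R F"
  shows "(complete_category U (Preglid U \<Gamma> leq R F \<Lambda>) \<and> cocomplete_category U (Preglid U \<Gamma> leq R F \<Lambda>) \<and>
          quasi_abelian (Preglid U \<Gamma> leq R F \<Lambda>) \<and>
          complete_category U (Prefrag U \<Gamma> leq R F \<Lambda>) \<and> cocomplete_category U (Prefrag U \<Gamma> leq R F \<Lambda>) \<and>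
          quasi_abelian (Prefrag U \<Gamma> leq R F \<Lambda>)) \<and>
         (complete_category U (Glid U \<Gamma> leq R F \<Lambda>) \<and> cocomplete_category U (Glid U \<Gamma> leq R F \<Lambda>) \<and>
          deflation_quasi_abelian (Glid U \<Gamma> leq R F \<Lambda>))"
proof -
  interpret filtered_ring \<Gamma> leq R F by (rule assms(6))
  interpret glider_setting \<Gamma> leq R F \<Lambda> U by unfold_locales (rule assms)+
  show ?thesis
    unfolding Preglid_eq Prefrag_eq
    using preglid.complete preglid.cocomplete preglid.quasi_abelian
      prefrag.complete prefrag.cocomplete prefrag.quasi_abelian
      Glid_complete Glid_cocomplete Glid_deflation_quasi_abelian by blast
qed

end
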